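(* Let $\pi$ be a simple permutation of $[N]$ with $N>2$. Then $\pi$ avoids $2341$, $4123$ and $3412$ if and only if the following conditions hold: (a) listing all inflection points of $\pi$ in increasing order of first coordinate as $p_1,\dots,p_m$, their second coordinates are strictly increasing, and inflection points associated with left-to-right maxima alternate with those associated with right-to-left minima; and, with corner cells $K_1,\dots,K_n$ and central cells $C_1,\dots,C_{n-3}$ defined as in the context (which requires (a)): (b) the entries of each corner cell $K_i$ form a decreasing sequence; (c) for each $1\le i<n$, either the entries of $K_i\cup K_{i+1}$ form a decreasing sequence, or $K_i$ and $K_{i+1}$ interlace; (d) for each $i$ with $K_i$ nonempty, $K_i$ interlaces with exactly one of $K_{i-1}$ (if $i\ge 2$) and $K_{i+1}$ (if $i\le n-1$); (e) for each $1\le k\le n-3$, the central cell $C_k$ contains at most one entry; if $K_{k+1}$ and $K_{k+2}$ interlace then $C_k$ is empty, and otherwise the entries of $K_{k+1}\cup C_k\cup K_{k+2}$ form a decreasing sequence.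
   Context: A permutation $\pi$ contains $\tau$ if it has a subsequence order-isomorphic to $\tau$; otherwise it avoids $\tau$. An interval of $\pi$ is a contiguous subsequence whose values form a set of consecutive integers; $\pi$ is simple if its only intervals are itself and singletons. Identify the entry $\pi(i)$ with the point $(i,\pi(i))$. An entry $\pi(j)$ is a left-to-right maximum if $\pi(j)>\pi(i)$ for all $i<j$, and a right-to-left minimum if $\pi(j)<\pi(k)$ for all $k>j$; these are the extremal points. With left-to-right maxima at positions $i_1<\dots<i_a$, the inflection points associated with left-to-right maxima are $(i_{r+1},\pi(i_r))$, $1\le r<a$; with right-to-left minima at positions $j_1<\dots<j_b$, those associated with right-to-left minima are $(j_r,\pi(j_{r+1}))$, $1\le r<b$. Assume (a), write $p_k=(x_k,y_k)$, and let $n=a+b$ (so $m=n-2$). List the extremal points as $e_1,\dots,e_n$ so that left-to-right maxima and right-to-left minima alternate, each type being listed from left to right, and $e_1$ is of the same type as $p_1$. For a left-to-right maximum $e=(i,v)$, its corner cell is the set of entries $(k,\pi(k))$ with $i<k<x'$ and $y'<\pi(k)<v$, where $x'$ is the least $x_j$ exceeding $i$ ($N+1$ if none) and $y'$ is the largest $y_j$ below $v$ ($0$ if none). For a right-to-left minimum $e=(j,v)$, its corner cell is the set of entries with $x''<k<j$ and $v<\pi(k)<y''$, where $x''$ is the largest $x_i$ below $j$ ($0$ if none) and $y''$ is the least $y_i$ exceeding $v$ ($N+1$ if none). Let $K_i$ be the corner cell of $e_i$. For $1\le k\le n-3$, the central cell $C_k$ is the set of entries $(l,\pi(l))$ with $x_k<l<x_{k+1}$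 and $y_k<\pi(l)<y_{k+1}$. Two corner cells $K_i,K_{i+1}$ interlace if they are both nonempty and the entries of $K_i\cup K_{i+1}$ form a pattern order-isomorphic to a parallel alternation, i.e. to $(2k-1)(2k-3)\cdots3\,1\,(2k)(2k-2)\cdots4\,2$ or to its inverse $k\,(2k)\,(k-1)\,(2k-1)\cdots1\,(k+1)$ for some $k\ge1$. *)

theory Defs
  imports Main
    "HOL-Combinatorics.Permutations"
    "HOL-Library.Sublist"
    "HOL-Library.Product_Lexorder"
begin

text \<open>
  A permutation of \<open>[N]\<close> is a function \<open>\<pi>\<close> with \<open>\<pi> permutes {1..N}\<close>. An entry is
  the point \<open>(i, \<pi> i)\<close>. Points are ordered lexicographically, so \<open>sorted_list_of_set\<close>
  lists a finite set of points by increasing first coordinate.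
\<close>

type_synonym point = "nat \<times> nat"

section \<open>Patterns and simple permutations\<close>

definition one_line :: "nat \<Rightarrow> (nat \<Rightarrow> nat) \<Rightarrow> nat list" where
  "one_line N \<pi> = map \<pi> [1..<N + 1]"

definition order_isomorphic :: "nat list \<Rightarrow> nat list \<Rightarrow> bool" where
  "order_isomorphic u v \<longleftrightarrow>
     length u = length v \<and>
     (\<forall>i < length u. \<forall>j < length u. u ! i < u ! j \<longleftrightarrow> v ! i < v ! j)"

definition contains :: "nat \<Rightarrow> (nat \<Rightarrow> nat) \<Rightarrow> nat list \<Rightarrow> bool" where
  "contains N \<pi> \<tau> \<longleftrightarrow> (\<exists>s. subseq s (one_line N \<pi>) \<and> order_isomorphic s \<tau>)"

definition avoids :: "nat \<Rightarrow> (nat \<Rightarrow> nat) \<Rightarrow> nat list \<Rightarrow> bool" where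
  "avoids N \<pi> \<tau> \<longleftrightarrow> \<not> contains N \<pi> \<tau>"

text \<open>The nonempty interval of \<open>\<pi>\<close> occupying the positions \<open>i, \<dots>, j\<close>.\<close>

definition perm_interval :: "nat \<Rightarrow> (nat \<Rightarrow> nat) \<Rightarrow> nat \<Rightarrow> nat \<Rightarrow> bool" where
  "perm_interval N \<pi> i j \<longleftrightarrow> 1 \<le> i \<and> i \<le> j \<and> j \<le> N \<and> (\<exists>c d. \<pi> ` {i..j} = {c..d})"

definition simple_perm :: "nat \<Rightarrow> (nat \<Rightarrow> nat) \<Rightarrow> bool" where
  "simple_perm N \<pi> \<longleftrightarrow>
     (\<forall>i j. perm_interval N \<pi> i j \<longrightarrow> i = j \<or> (i = 1 \<and> j = N))"

section \<open>Extremal points and inflection points\<close>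

definition lr_max_pos :: "nat \<Rightarrow> (nat \<Rightarrow> nat) \<Rightarrow> nat set" where
  "lr_max_pos N \<pi> = {j \<in> {1..N}. \<forall>i \<in> {1..<j}. \<pi> i < \<pi> j}"

definition rl_min_pos :: "nat \<Rightarrow> (nat \<Rightarrow> nat) \<Rightarrow> nat set" where
  "rl_min_pos N \<pi> = {j \<in> {1..N}. \<forall>k \<in> {j<..N}. \<pi> j < \<pi> k}"

definition lr_max_list :: "nat \<Rightarrow> (nat \<Rightarrow> nat) \<Rightarrow> nat list" where
  "lr_max_list N \<pi> = sorted_list_of_set (lr_max_pos N \<pi>)"

definition rl_min_list :: "nat \<Rightarrow> (nat \<Rightarrow> nat) \<Rightarrow> nat list" where
  "rl_min_list N \<pi> = sorted_list_of_set (rl_min_pos N \<pi>)"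

definition lr_inflections :: "nat \<Rightarrow> (nat \<Rightarrow> nat) \<Rightarrow> point set" where
  "lr_inflections N \<pi> =
     (let is = lr_max_list N \<pi>
      in {(is ! Suc r, \<pi> (is ! r)) | r. Suc r < length is})"

definition rl_inflections :: "nat \<Rightarrow> (nat \<Rightarrow> nat) \<Rightarrow> point set" where
  "rl_inflections N \<pi> =
     (let js = rl_min_list N \<pi>
      in {(js ! r, \<pi> (js ! Suc r)) | r. Suc r < length js})"

definition inflections :: "nat \<Rightarrow> (nat \<Rightarrow> nat) \<Rightarrow> point set" where
  "inflections N \<pi> = lr_inflections N \<pi> \<union> rl_inflections N \<pi>"

definition inflection_list :: "nat \<Rightarrow> (nat \<Rightarrow> nat) \<Rightarrow> point list" where
  "inflection_list N \<pi> = sorted_list_of_set (inflections N \<pi>)"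

text \<open>
  The points below and the cells derived from them are indexed from 1; they are meaningful
  only for indices in range, and \<open>extremal_point\<close> only when \<open>inflections_alternate\<close> holds.
\<close>

definition inflection_point :: "nat \<Rightarrow> (nat \<Rightarrow> nat) \<Rightarrow> nat \<Rightarrow> point" where
  "inflection_point N \<pi> k = inflection_list N \<pi> ! (k - 1)"

definition inflections_alternate :: "nat \<Rightarrow> (nat \<Rightarrow> nat) \<Rightarrow> bool" where
  "inflections_alternate N \<pi> \<longleftrightarrow>
     (\<forall>k. 1 \<le> k \<and> k < length (inflection_list N \<pi>) \<longrightarrow>
        snd (inflection_point N \<pi> k) < snd (inflection_point N \<pi> (k + 1)) \<and>
        (inflection_point N \<pi> k \<in> lr_inflections N \<pi> \<and>
           inflection_point N \<pi> (k + 1) \<in> rl_inflections N \<pi> \<or>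
         inflection_point N \<pi> k \<in> rl_inflections N \<pi> \<and>
           inflection_point N \<pi> (k + 1) \<in> lr_inflections N \<pi>))"

text \<open>
  \<open>splice\<close> takes elements alternately from its two arguments, starting with the first.
\<close>

definition extremal_list :: "nat \<Rightarrow> (nat \<Rightarrow> nat) \<Rightarrow> point list" where
  "extremal_list N \<pi> =
     (let L = map (\<lambda>i. (i, \<pi> i)) (lr_max_list N \<pi>);
          R = map (\<lambda>j. (j, \<pi> j)) (rl_min_list N \<pi>)
      in if inflection_point N \<pi> 1 \<in> lr_inflections N \<pi> then splice L R else splice R L)"

definition num_extremal :: "nat \<Rightarrow> (nat \<Rightarrow> nat) \<Rightarrow> nat" where
  "num_extremal N \<pi> = length (lr_max_list N \<pi>) + length (rl_min_list N \<pi>)"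

definition extremal_point :: "nat \<Rightarrow> (nat \<Rightarrow> nat) \<Rightarrow> nat \<Rightarrow> point" where
  "extremal_point N \<pi> i = extremal_list N \<pi> ! (i - 1)"

section \<open>Cells\<close>

definition entries :: "nat \<Rightarrow> (nat \<Rightarrow> nat) \<Rightarrow> point set" where
  "entries N \<pi> = (\<lambda>i. (i, \<pi> i)) ` {1..N}"

text \<open>
  All coordinates of inflection points lie in \<open>{1..N}\<close>, so inserting \<open>N + 1\<close> (resp. \<open>0\<close>)
  below only supplies the default value for an empty set.
\<close>

definition lr_corner_cell :: "nat \<Rightarrow> (nat \<Rightarrow> nat) \<Rightarrow> point \<Rightarrow> point set" where
  "lr_corner_cell N \<pi> = (\<lambda>(i, v).
     let x' = Min (insert (N + 1) {x \<in> fst ` inflections N \<pi>. i < x});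
         y' = Max (insert 0 {y \<in> snd ` inflections N \<pi>. y < v})
     in {(k, w) \<in> entries N \<pi>. i < k \<and> k < x' \<and> y' < w \<and> w < v})"

definition rl_corner_cell :: "nat \<Rightarrow> (nat \<Rightarrow> nat) \<Rightarrow> point \<Rightarrow> point set" where
  "rl_corner_cell N \<pi> = (\<lambda>(j, v).
     let x'' = Max (insert 0 {x \<in> fst ` inflections N \<pi>. x < j});
         y'' = Min (insert (N + 1) {y \<in> snd ` inflections N \<pi>. v < y})
     in {(k, w) \<in> entries N \<pi>. x'' < k \<and> k < j \<and> v < w \<and> w < y''})"

text \<open>
  No entry of a simple permutation of length greater than 2 is both a left-to-right
  maximum and a right-to-left minimum, so the order of the two cases is immaterial there.
\<close>

definition corner_cell :: "nat \<Rightarrow> (nat \<Rightarrow> nat) \<Rightarrow> nat \<Rightarrow> point set" where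
  "corner_cell N \<pi> i =
     (if fst (extremal_point N \<pi> i) \<in> lr_max_pos N \<pi>
      then lr_corner_cell N \<pi> (extremal_point N \<pi> i)
      else rl_corner_cell N \<pi> (extremal_point N \<pi> i))"

definition central_cell :: "nat \<Rightarrow> (nat \<Rightarrow> nat) \<Rightarrow> nat \<Rightarrow> point set" where
  "central_cell N \<pi> k =
     {(l, w) \<in> entries N \<pi>.
        fst (inflection_point N \<pi> k) < l \<and> l < fst (inflection_point N \<pi> (k + 1)) \<and>
        snd (inflection_point N \<pi> k) < w \<and> w < snd (inflection_point N \<pi> (k + 1))}"

section \<open>Decreasing and interlacing sets of entries\<close>

text \<open>The second coordinates of a finite set of entries, read from left to right.\<close>

definition word_of :: "point set \<Rightarrow> nat list" where
  "word_of S = map snd (sorted_list_of_set S)"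

definition decreasing :: "point set \<Rightarrow> bool" where
  "decreasing S \<longleftrightarrow> sorted_wrt (>) (word_of S)"

text \<open>\<open>(2k-1)(2k-3)\<cdots>3 1 (2k)(2k-2)\<cdots>4 2\<close> and \<open>k (2k) (k-1) (2k-1)\<cdots>1 (k+1)\<close>\<close>

definition parallel_alternation :: "nat \<Rightarrow> nat list" where
  "parallel_alternation k =
     map (\<lambda>i. 2 * i - 1) (rev [1..<k + 1]) @ map (\<lambda>i. 2 * i) (rev [1..<k + 1])"

definition inverse_parallel_alternation :: "nat \<Rightarrow> nat list" where
  "inverse_parallel_alternation k = concat (map (\<lambda>i. [i, k + i]) (rev [1..<k + 1]))"

definition interlace :: "point set \<Rightarrow> point set \<Rightarrow> bool" where
  "interlace A B \<longleftrightarrow>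
     A \<noteq> {} \<and> B \<noteq> {} \<and>
     (\<exists>k \<ge> 1. order_isomorphic (word_of (A \<union> B)) (parallel_alternation k) \<or>
             order_isomorphic (word_of (A \<union> B)) (inverse_parallel_alternation k))"

lemma parallel_alternation_examples:
  "parallel_alternation 3 = [5, 3, 1, 6, 4, 2]"
  "inverse_parallel_alternation 3 = [3, 6, 2, 5, 1, 4]"
  by code_simp+

end

theory Submission
  imports Defs
begin

text \<open>
  Consider the graph on the entries of \<open>\<pi>\<close> whose edges are the inversions. The patterns 2341 and 4123
  are the two permutations whose inversion graph is a claw, and 3412 is the one whose inversion graph
  is a square, so avoidance says that the graph has no induced claw and no induced square. Simplicity
  gives that \<open>\<pi>\<close> is sum indecomposable and that no two adjacent vertices are twins.

  Under (a) the extremal points \<open>e\<^sub>1, \<dots>, e\<^sub>n\<close> form an induced path, the remaining entries are classified by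
  the interval of indices \<open>i\<close> with \<open>e\<^sub>i\<close> inverted with them (two or three consecutive indices), and two
  entries can be inverted only if their intervals overlap in at least two indices. The corner cell
  \<open>K\<^sub>i\<close> consists of the entries with interval \<open>{i - 1, i, i + 1}\<close> (cut off to \<open>{1..n}\<close>), the central cell
  \<open>C\<^sub>k\<close> of those with interval \<open>{k + 1, k + 2}\<close>. If the graph is claw-free, explicit claws centred at the
  \<open>e\<^sub>i\<close> rule out every forbidden increasing pair, and twin-freeness forces the alternations. Conversely,
  (b)--(e) make the neighbourhood of every entry a union of two cliques and exclude squares.
\<close>

subsection \<open>The inversion graph\<close>

text \<open>Square-freeness and sum indecomposability are spent on (a): incomparable inflection
  points of different types give either a square or a cut crossed by no inversion. So all inflection
  points form a chain, and two neighbours of one type in it lead to a claw. From (a) on,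
  claw-freeness and twin-freeness give (b)-(e).

  The cells are tractable because two consecutive corner cells are already separated in one
  coordinate. Whether two of their entries are inverted depends only on the other coordinate, called
  \<open>key\<close>, which changes from each pair of cells to the next. Along \<open>key\<close> a
  square becomes a cycle of strict inequalities, and interlacing becomes the strict merging of two
  finite sets of numbers. Twin-freeness puts an element of one cell between any two of the other;
  applied to an entry and its own \<open>e i\<close>, it also fixes the ends of the merged sequence,
  which starts in \<open>K i\<close> and ends in \<open>K (i + 1)\<close>. This is why exactly the
  two alternations occur.\<close>

definition sw :: "point \<Rightarrow> point \<Rightarrow> bool" (infix "\<lless>" 50) where
  "p \<lless> q \<longleftrightarrow> fst p < fst q \<and> snd p < snd q"

definition nw :: "point \<Rightarrow> point \<Rightarrow> bool" (infix "\<leadsto>" 50) where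
  "p \<leadsto> q \<longleftrightarrow> fst p < fst q \<and> snd q < snd p"

definition inverted :: "point \<Rightarrow> point \<Rightarrow> bool" (infix "\<sim>" 50) where
  "p \<sim> q \<longleftrightarrow> p \<leadsto> q \<or> q \<leadsto> p"

definition clique :: "point set \<Rightarrow> bool" where
  "clique X \<longleftrightarrow> (\<forall>p\<in>X. \<forall>q\<in>X. p \<noteq> q \<longrightarrow> p \<sim> q)"

text \<open>The leaves of an induced claw are pairwise non-inverted, hence an increasing triple in
  some order; naming them in that order loses nothing.\<close>

definition claw_free :: "point set \<Rightarrow> bool" where
  "claw_free S \<longleftrightarrow> (\<forall>v\<in>S. \<forall>a\<in>S. \<forall>b\<in>S. \<forall>c\<in>S.
     \<not> (a \<lless> b \<and> b \<lless> c \<and> v \<sim> a \<and> v \<sim> b \<and> v \<sim> c))"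

text \<open>Opposite vertices of an induced square are non-inverted, so each diagonal is an
  increasing pair.\<close>

definition square_free :: "point set \<Rightarrow> bool" where
  "square_free S \<longleftrightarrow> (\<forall>a\<in>S. \<forall>b\<in>S. \<forall>c\<in>S. \<forall>d\<in>S.
     \<not> (a \<lless> b \<and> c \<lless> d \<and> a \<sim> c \<and> a \<sim> d \<and> b \<sim> c \<and> b \<sim> d))"

text \<open>For an inverted pair, being indistinguishable means having equal closed
  neighbourhoods.\<close>

definition twin_free :: "point set \<Rightarrow> bool" where
  "twin_free S \<longleftrightarrow> (\<forall>p\<in>S. \<forall>q\<in>S. p \<sim> q \<longrightarrow>
     (\<exists>r\<in>S. r \<noteq> p \<and> r \<noteq> q \<and> (r \<sim> p) \<noteq> (r \<sim> q)))"

lemma inverted_sym: "p \<sim> q \<longleftrightarrow> q \<sim> p"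
  by (auto simp: inverted_def)

lemma not_inverted_self [simp]: "\<not> p \<sim> p"
  by (simp add: inverted_def nw_def)

lemma not_sw_self [simp]: "\<not> p \<lless> p"
  by (simp add: sw_def)

lemma sw_trans: "p \<lless> q \<Longrightarrow> q \<lless> r \<Longrightarrow> p \<lless> r"
  by (auto simp: sw_def)

lemma sw_asym: "p \<lless> q \<Longrightarrow> \<not> q \<lless> p"
  by (auto simp: sw_def)

lemma nw_trans: "p \<leadsto> q \<Longrightarrow> q \<leadsto> r \<Longrightarrow> p \<leadsto> r"
  by (auto simp: nw_def)

lemma sw_not_inverted: "p \<lless> q \<Longrightarrow> \<not> p \<sim> q" "p \<lless> q \<Longrightarrow> \<not> q \<sim> p"
  by (auto simp: sw_def nw_def inverted_def)

lemma cliqueD: "clique X \<Longrightarrow> p \<in> X \<Longrightarrow> q \<in> X \<Longrightarrow> p \<noteq> q \<Longrightarrow> p \<sim> q"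
  by (auto simp: clique_def)

lemma clique_empty [simp]: "clique {}"
  by (simp add: clique_def)

lemma clique_subset: "clique X \<Longrightarrow> Y \<subseteq> X \<Longrightarrow> clique Y"
  unfolding clique_def by blast

lemma clique_insert: "clique X \<Longrightarrow> (\<And>q. q \<in> X \<Longrightarrow> p \<sim> q) \<Longrightarrow> clique (insert p X)"
  unfolding clique_def using inverted_sym[of p] by auto

subsection \<open>Lists and alternations\<close>

lemma nth_splice_even:
  "\<lbrakk>i < length xs; i \<le> length ys\<rbrakk> \<Longrightarrow> splice xs ys ! (2 * i) = xs ! i"
proof (induction xs arbitrary: ys i)
  case (Cons x xs)
  then show ?case by (cases ys; cases i) auto
qed simp

lemma nth_splice_odd:
  "\<lbrakk>i < length xs; i < length ys\<rbrakk> \<Longrightarrow> splice xs ys ! Suc (2 * i) = ys ! i"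
proof (induction xs arbitrary: ys i)
  case (Cons x xs)
  then show ?case by (cases ys; cases i) auto
qed simp

lemma map_splice: "map f (splice xs ys) = splice (map f xs) (map f ys)"
  by (induction xs ys rule: splice.induct) auto

lemma set_splice: "set (splice xs ys) = set xs \<union> set ys"
  by (induction xs ys rule: splice.induct) auto

lemma concat_pairs: "concat (map (\<lambda>i. [g i, h i]) xs) = splice (map g xs) (map h xs)"
  by (induction xs) auto

text \<open>Strict separation in both directions forces alternation, and the last two hypotheses
  make it start in \<open>ps\<close> and end in \<open>qs\<close>. The heads satisfy
  \<open>p < q\<close> and lie below everything else, so both can be removed and all six hypotheses
  survive for the tails.\<close>

lemma splice_sorted:
  fixes ps qs :: "'a::linorder list"
  assumes "sorted_wrt (<) ps" "sorted_wrt (<) qs"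
    and "\<And>p p'. \<lbrakk>p \<in> set ps; p' \<in> set ps; p < p'\<rbrakk> \<Longrightarrow> \<exists>q\<in>set qs. p < q \<and> q < p'"
    and "\<And>q q'. \<lbrakk>q \<in> set qs; q' \<in> set qs; q < q'\<rbrakk> \<Longrightarrow> \<exists>p\<in>set ps. q < p \<and> p < q'"
    and "\<And>p. p \<in> set ps \<Longrightarrow> \<exists>q\<in>set qs. p < q"
    and "\<And>q. q \<in> set qs \<Longrightarrow> \<exists>p\<in>set ps. p < q"
  shows "length ps = length qs \<and> sorted_wrt (<) (splice ps qs)"
  using assms
proof (induction ps arbitrary: qs)
  case Nil
  then show ?case by (cases qs) auto
next
  case (Cons p ps)
  obtain q where "q \<in> set qs" using Cons.prems(5)[of p] by auto
  then obtain q qs' where qs: "qs = q # qs'" by (cases qs) auto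
  note C = Cons.prems[unfolded qs]
  have pq: "p < q" using C(1) C(6)[of q] by auto
  have qp: "q < p'" if "p' \<in> set ps" for p' using C(1,2) C(3)[of p p'] that by auto
  have qq: "q < q'" if "q' \<in> set qs'" for q' using C(2) that by auto
  have "length ps = length qs' \<and> sorted_wrt (<) (splice ps qs')"
  proof (rule Cons.IH)
    show "sorted_wrt (<) ps" "sorted_wrt (<) qs'" using C by auto
  next
    fix a b assume "a \<in> set ps" "b \<in> set ps" "a < b"
    then show "\<exists>q\<in>set qs'. a < q \<and> q < b" using C(3)[of a b] qp[of a] by auto
  next
    fix a b assume "a \<in> set qs'" "b \<in> set qs'" "a < b"
    then show "\<exists>p\<in>set ps. a < p \<and> p < b" using C(4)[of a b] qq[of a] pq by auto
  next
    fix a assume "a \<in> set ps"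
    then show "\<exists>q\<in>set qs'. a < q" using C(5)[of a] qp[of a] by auto
  next
    fix a assume "a \<in> set qs'"
    then show "\<exists>p\<in>set ps. p < a" using C(4)[of q a] qq[of a] pq by auto
  qed
  moreover have "set (splice ps qs') = set ps \<union> set qs'" by (rule set_splice)
  ultimately show ?case using pq qp qq C(1) unfolding qs by (fastforce intro: less_trans)
qed

section \<open>Words read off as ranks in a sorted list, and the two alternation patterns\<close>

lemma order_isomorphic_nth:
  assumes "sorted_wrt (<) Z" "set t \<subseteq> {1..length Z}"
  shows "order_isomorphic (map (\<lambda>c. Z ! (c - 1)) t) t"
proof -
  have "Z ! (a - 1) < Z ! (b - 1) \<longleftrightarrow> a < b" if "a \<in> set t" "b \<in> set t" for a b
  proof -
    have "a \<in> {1..length Z}" "b \<in> {1..length Z}" using that assms(2) by blast+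
    then have "1 \<le> a" "1 \<le> b" "a - 1 < length Z" "b - 1 < length Z" by auto
    moreover have "strict_mono_on {..<length Z} (\<lambda>i. Z ! i)"
      using assms(1) by (auto simp: sorted_wrt_iff_nth_less intro!: strict_mono_onI)
    ultimately show ?thesis using strict_mono_on_less[of "{..<length Z}" "(!) Z" "a - 1" "b - 1"]
      by auto
  qed
  then show ?thesis by (auto simp: order_isomorphic_def)
qed

text \<open>In the merged list \<open>?Z\<close>, counted from 1, rank \<open>2 * i - 1\<close> is
  the \<open>i\<close>-th smallest letter of \<open>xs\<close> and rank \<open>2 * i\<close> the
  \<open>i\<close>-th smallest of \<open>ys\<close>; hence reading \<open>?Z\<close> at the ranks
  given by the pattern returns the word.\<close>

lemma order_isomorphic_parallel:
  assumes "length xs = k" "length ys = k" "sorted_wrt (<) (splice (rev xs) (rev ys))"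
  shows "order_isomorphic (xs @ ys) (parallel_alternation k)"
proof -
  let ?Z = "splice (rev xs) (rev ys)"
  let ?f = "\<lambda>c. ?Z ! (c - 1)"
  have x: "map ?f (map (\<lambda>i. 2 * i - 1) [1..<k + 1]) = rev xs"
  proof (rule nth_equalityI)
    fix i assume "i < length (map ?f (map (\<lambda>i. 2 * i - 1) [1..<k + 1]))"
    then show "map ?f (map (\<lambda>i. 2 * i - 1) [1..<k + 1]) ! i = rev xs ! i"
      using assms nth_splice_even[of i "rev xs" "rev ys"] by (simp del: upt_Suc)
  qed (simp add: assms)
  have y: "map ?f (map (\<lambda>i. 2 * i) [1..<k + 1]) = rev ys"
  proof (rule nth_equalityI)
    fix i assume "i < length (map ?f (map (\<lambda>i. 2 * i) [1..<k + 1]))"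
    then show "map ?f (map (\<lambda>i. 2 * i) [1..<k + 1]) ! i = rev ys ! i"
      using assms nth_splice_odd[of i "rev xs" "rev ys"] by (simp del: upt_Suc)
  qed (simp add: assms)
  have "map ?f (parallel_alternation k) = xs @ ys"
    using x y unfolding parallel_alternation_def map_append rev_map[symmetric] by simp
  moreover have "set (parallel_alternation k) \<subseteq> {1..length ?Z}"
    using assms by (auto simp: parallel_alternation_def)
  ultimately show ?thesis using order_isomorphic_nth[OF assms(3)] by metis
qed

text \<open>Here the positions alternate while the values form two blocks: rank \<open>i\<close> of
  \<open>?Z\<close> belongs to \<open>xs\<close> and rank \<open>k + i\<close> to
  \<open>ys\<close>.\<close>

lemma order_isomorphic_inverse_parallel:
  assumes "length xs = k" "length ys = k" "sorted_wrt (<) (rev xs @ rev ys)"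
  shows "order_isomorphic (splice xs ys) (inverse_parallel_alternation k)"
proof -
  let ?Z = "rev xs @ rev ys"
  let ?f = "\<lambda>c. ?Z ! (c - 1)"
  have x: "map ?f [1..<k + 1] = rev xs"
    by (rule nth_equalityI) (simp_all add: assms nth_append del: upt_Suc)
  have y: "map ?f (map (\<lambda>i. k + i) [1..<k + 1]) = rev ys"
    by (rule nth_equalityI) (simp_all add: assms nth_append del: upt_Suc)
  have "map ?f (inverse_parallel_alternation k) =
      splice (map ?f (rev [1..<k + 1])) (map ?f (map (\<lambda>i. k + i) (rev [1..<k + 1])))"
    unfolding inverse_parallel_alternation_def concat_pairs map_splice by simp
  also have "\<dots> = splice xs ys"
    using x y unfolding rev_map[symmetric] by simp
  finally have "map ?f (inverse_parallel_alternation k) = splice xs ys" .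
  moreover have "set (inverse_parallel_alternation k) \<subseteq> {1..length ?Z}"
    using assms by (auto simp: inverse_parallel_alternation_def)
  ultimately show ?thesis using order_isomorphic_nth[OF assms(3)] by metis
qed

lemma sorted_list_of_set_eqI:
  fixes xs :: "'a::linorder list"
  assumes "sorted_wrt (<) xs" "set xs = A"
  shows "sorted_list_of_set A = xs"
  using assms by (metis sorted_list_of_set.idem_if_sorted_distinct strict_sorted_iff)

text \<open>With distinct first coordinates the lexicographic listing is the listing by first
  coordinate, so a descent at every pair of places is an inversion of every pair of points.\<close>

lemma decreasing_iff_clique:
  assumes "finite A" "inj_on fst A"
  shows "decreasing A \<longleftrightarrow> clique A"
proof -
  let ?L = "sorted_list_of_set A"
  have set: "set ?L = A" using assms by simp
  have lt: "p < q \<longleftrightarrow> fst p < fst q" if "p \<in> A" "q \<in> A" for p q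
    using that assms(2) by (auto simp: less_prod_def' dest: inj_onD)
  have "decreasing A \<longleftrightarrow> sorted_wrt (\<lambda>p q. snd q < snd p) ?L"
    by (simp add: decreasing_def word_of_def sorted_wrt_map)
  also have "\<dots> \<longleftrightarrow> clique A"
  proof
    assume d: "sorted_wrt (\<lambda>p q. snd q < snd p) ?L"
    show "clique A" unfolding clique_def
    proof (intro ballI impI)
      fix p q assume pq: "p \<in> A" "q \<in> A" "p \<noteq> q"
      then obtain i j where ij: "i < length ?L" "j < length ?L" "p = ?L ! i" "q = ?L ! j"
        using set by (metis in_set_conv_nth)
      have s: "sorted_wrt (<) ?L" by (simp add: assms)
      have *: "?L ! a \<leadsto> ?L ! b" if "a < b" "b < length ?L" for a b
      proof -
        have "?L ! a \<in> A" "?L ! b \<in> A" using that set nth_mem[of a ?L] nth_mem[of b ?L] by auto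
        then show ?thesis using s d that lt[of "?L ! a" "?L ! b"]
          by (auto simp: sorted_wrt_iff_nth_less nw_def)
      qed
      consider "i < j" | "j < i" using pq ij by (metis linorder_neqE_nat)
      then show "p \<sim> q" using * ij by (auto simp: inverted_def)
    qed
  next
    assume c: "clique A"
    have "sorted_wrt (<) ?L" by (simp add: assms)
    then show "sorted_wrt (\<lambda>p q. snd q < snd p) ?L"
    proof (rule sorted_wrt_mono_rel[rotated])
      fix p q assume "p \<in> set ?L" "q \<in> set ?L" "p < q"
      then have "p \<sim> q" "fst p < fst q" using c lt set by (auto simp: clique_def)
      then show "snd q < snd p" by (auto simp: inverted_def nw_def)
    qed
  qed
  finally show ?thesis .
qed

text \<open>Both patterns contain an ascent: \<open>2 * k - 1\<close> before \<open>2 * k\<close>,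
  at places 0 and \<open>k\<close>, in the first, and \<open>k\<close> before \<open>2 * k\<close>,
  at places 0 and 1, in the second. Hence the two alternatives of (c) exclude each other.\<close>

lemma interlace_not_decreasing:
  assumes "interlace A B"
  shows "\<not> decreasing (A \<union> B)"
proof
  assume d: "decreasing (A \<union> B)"
  let ?w = "word_of (A \<union> B)"
  obtain k where k: "1 \<le> k" "order_isomorphic ?w (parallel_alternation k) \<or>
      order_isomorphic ?w (inverse_parallel_alternation k)"
    using assms by (auto simp: interlace_def)
  have no: "\<not> order_isomorphic ?w t" if "i < j" "j < length t" "t ! i < t ! j" for t i j
    using d that by (fastforce simp: decreasing_def order_isomorphic_def sorted_wrt_iff_nth_less)
  have "\<not> order_isomorphic ?w (parallel_alternation k)"
    using k(1) by (intro no[of 0 k])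
      (auto simp: parallel_alternation_def nth_append rev_nth simp del: upt_Suc)
  moreover have "inverse_parallel_alternation k =
      splice (rev [1..<k + 1]) (map (\<lambda>i. k + i) (rev [1..<k + 1]))"
    unfolding inverse_parallel_alternation_def concat_pairs by simp
  then have "\<not> order_isomorphic ?w (inverse_parallel_alternation k)"
    using k(1) nth_splice_even[of 0 "rev [1..<k + 1]" "map (\<lambda>i. k + i) (rev [1..<k + 1])"]
      nth_splice_odd[of 0 "rev [1..<k + 1]" "map (\<lambda>i. k + i) (rev [1..<k + 1])"]
    by (intro no[of 0 1]) (auto simp: rev_nth simp del: upt_Suc)
  ultimately show False using k(2) by blast
qed

lemma clique_sorted_list:
  assumes "clique A" "finite A"
  shows "sorted_wrt (\<leadsto>) (sorted_list_of_set A)"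
proof -
  have "sorted_wrt (<) (sorted_list_of_set A)" using assms(2) by simp
  then show ?thesis
  proof (rule sorted_wrt_mono_rel[rotated])
    fix p q assume "p \<in> set (sorted_list_of_set A)" "q \<in> set (sorted_list_of_set A)" "p < q"
    then have "p \<sim> q" "fst p \<le> fst q"
      using assms by (auto simp: less_prod_def' dest: cliqueD)
    then show "p \<leadsto> q" by (auto simp: inverted_def nw_def)
  qed
qed

text \<open>All values of \<open>A\<close> are smaller than those of \<open>B\<close> and the
  positions merge strictly, so the word is a splice of two decreasing words: the inverse
  alternation.\<close>

lemma interlace_vertical:
  assumes fin: "finite A" "finite B" and ne: "A \<noteq> {}"
    and cl: "clique A" "clique B"
    and below: "\<And>u v. \<lbrakk>u \<in> A; v \<in> B\<rbrakk> \<Longrightarrow> snd u < snd v"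
    and 1: "\<And>u u'. \<lbrakk>u \<in> A; u' \<in> A; fst u < fst u'\<rbrakk> \<Longrightarrow> \<exists>v\<in>B. fst u < fst v \<and> fst v < fst u'"
    and 2: "\<And>v v'. \<lbrakk>v \<in> B; v' \<in> B; fst v < fst v'\<rbrakk> \<Longrightarrow> \<exists>u\<in>A. fst v < fst u \<and> fst u < fst v'"
    and 3: "\<And>u. u \<in> A \<Longrightarrow> \<exists>v\<in>B. fst u < fst v"
    and 4: "\<And>v. v \<in> B \<Longrightarrow> \<exists>u\<in>A. fst u < fst v"
  shows "interlace A B"
proof -
  let ?as = "sorted_list_of_set A" and ?bs = "sorted_list_of_set B"
  have fstlt: "fst p < fst q" if "p \<in> X" "q \<in> X" "clique X" "p < q" for p q X
    using cliqueD[OF that(3,1,2) less_imp_neq[OF that(4)]] that(4)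
    by (auto simp: inverted_def nw_def less_prod_def')
  have lt: "p < q" if "fst p < fst q" for p q :: point
    using that by (simp add: less_prod_def')
  have spl: "length ?as = length ?bs \<and> sorted_wrt (<) (splice ?as ?bs)"
  proof (rule splice_sorted)
    fix p p' assume "p \<in> set ?as" "p' \<in> set ?as" "p < p'"
    then show "\<exists>q\<in>set ?bs. p < q \<and> q < p'" using fstlt[of p A p'] cl fin 1[of p p'] lt
      by (metis set_sorted_list_of_set)
  next
    fix p p' assume "p \<in> set ?bs" "p' \<in> set ?bs" "p < p'"
    then show "\<exists>q\<in>set ?as. p < q \<and> q < p'" using fstlt[of p B p'] cl fin 2[of p p'] lt
      by (metis set_sorted_list_of_set)
  next
    fix p assume "p \<in> set ?as"
    then show "\<exists>q\<in>set ?bs. p < q" using fin 3[of p] lt by (metis set_sorted_list_of_set)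
  next
    fix p assume "p \<in> set ?bs"
    then show "\<exists>q\<in>set ?as. q < p" using fin 4[of p] lt by (metis set_sorted_list_of_set)
  qed (use fin in simp_all)
  have word: "word_of (A \<union> B) = splice (map snd ?as) (map snd ?bs)"
    using sorted_list_of_set_eqI[of "splice ?as ?bs" "A \<union> B"] spl fin
    by (simp add: word_of_def map_splice set_splice)
  have d: "sorted_wrt (\<lambda>p q. snd q < snd p) ?as" "sorted_wrt (\<lambda>p q. snd q < snd p) ?bs"
    using clique_sorted_list[OF cl(1) fin(1)] clique_sorted_list[OF cl(2) fin(2)]
    by (auto elim!: sorted_wrt_mono_rel[rotated] simp: nw_def)
  have "sorted_wrt (<) (rev (map snd ?as) @ rev (map snd ?bs))"
    using d fin below by (auto simp: sorted_wrt_append sorted_wrt_rev sorted_wrt_map)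
  then have "order_isomorphic (word_of (A \<union> B)) (inverse_parallel_alternation (length ?as))"
    unfolding word using spl by (intro order_isomorphic_inverse_parallel) auto
  moreover have "1 \<le> length ?as" using ne fin by (simp add: Suc_le_eq card_gt_0_iff)
  moreover have "B \<noteq> {}" using ne 3 by blast
  ultimately show ?thesis using ne unfolding interlace_def by blast
qed

text \<open>The transposed situation: \<open>A\<close> is read completely before \<open>B\<close>
  and the values merge strictly, which gives the parallel alternation itself.\<close>

lemma interlace_horizontal:
  assumes fin: "finite A" "finite B" and ne: "A \<noteq> {}"
    and cl: "clique A" "clique B"
    and left: "\<And>u v. \<lbrakk>u \<in> A; v \<in> B\<rbrakk> \<Longrightarrow> fst u < fst v"
    and 1: "\<And>u u'. \<lbrakk>u \<in> A; u' \<in> A; snd u < snd u'\<rbrakk> \<Longrightarrow> \<exists>v\<in>B. snd u < snd v \<and> snd v < snd u'"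
    and 2: "\<And>v v'. \<lbrakk>v \<in> B; v' \<in> B; snd v < snd v'\<rbrakk> \<Longrightarrow> \<exists>u\<in>A. snd v < snd u \<and> snd u < snd v'"
    and 3: "\<And>u. u \<in> A \<Longrightarrow> \<exists>v\<in>B. snd u < snd v"
    and 4: "\<And>v. v \<in> B \<Longrightarrow> \<exists>u\<in>A. snd u < snd v"
  shows "interlace A B"
proof -
  let ?as = "sorted_list_of_set A" and ?bs = "sorted_list_of_set B"
  let ?xs = "map snd ?as" and ?ys = "map snd ?bs"
  have d: "sorted_wrt (\<lambda>p q. snd q < snd p) ?as" "sorted_wrt (\<lambda>p q. snd q < snd p) ?bs"
    using clique_sorted_list[OF cl(1) fin(1)] clique_sorted_list[OF cl(2) fin(2)]
    by (auto elim!: sorted_wrt_mono_rel[rotated] simp: nw_def)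
  have set: "set (rev ?xs) = snd ` A" "set (rev ?ys) = snd ` B" using fin by simp_all
  have spl: "length (rev ?xs) = length (rev ?ys) \<and> sorted_wrt (<) (splice (rev ?xs) (rev ?ys))"
  proof (rule splice_sorted, unfold set)
    show "sorted_wrt (<) (rev ?xs)" "sorted_wrt (<) (rev ?ys)"
      using d by (simp_all add: sorted_wrt_rev sorted_wrt_map)
  next
    fix p p' assume "p \<in> snd ` A" "p' \<in> snd ` A" "p < p'"
    then show "\<exists>q\<in>snd ` B. p < q \<and> q < p'" using 1 by auto
  next
    fix p p' assume "p \<in> snd ` B" "p' \<in> snd ` B" "p < p'"
    then show "\<exists>q\<in>snd ` A. p < q \<and> q < p'" using 2 by auto
  next
    fix p assume "p \<in> snd ` A"
    then show "\<exists>q\<in>snd ` B. p < q" using 3 by auto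
  next
    fix p assume "p \<in> snd ` B"
    then show "\<exists>q\<in>snd ` A. q < p" using 4 by auto
  qed
  have "sorted_wrt (<) (?as @ ?bs)"
    using fin left by (simp add: sorted_wrt_append less_prod_def')
  then have word: "word_of (A \<union> B) = ?xs @ ?ys"
    using sorted_list_of_set_eqI[of "?as @ ?bs" "A \<union> B"] fin by (simp add: word_of_def)
  have "order_isomorphic (word_of (A \<union> B)) (parallel_alternation (length ?as))"
    unfolding word using spl by (intro order_isomorphic_parallel) auto
  moreover have "1 \<le> length ?as" using ne fin by (simp add: Suc_le_eq card_gt_0_iff)
  moreover have "B \<noteq> {}" using ne 3 by blast
  ultimately show ?thesis using ne unfolding interlace_def by blast
qed

text \<open>The induction passes to the negation of \<open>P\<close> on the tail, where the parity
  of every place has shifted; this exchanges the two filters and accounts for the two roundings of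
  half the length.\<close>

lemma alternating_splice:
  assumes "\<And>k. k < length xs \<Longrightarrow> P (xs ! k) = even k"
  shows "xs = splice (filter P xs) (filter (\<lambda>x. \<not> P x) xs) \<and>
    length (filter P xs) = (length xs + 1) div 2 \<and> length (filter (\<lambda>x. \<not> P x) xs) = length xs div 2"
  using assms
proof (induction xs arbitrary: P)
  case (Cons x xs)
  have x: "P x" using Cons.prems[of 0] by simp
  have "(\<not> P (xs ! k)) = even k" if "k < length xs" for k
    using Cons.prems[of "Suc k"] that by simp
  from Cons.IH[of "\<lambda>x. \<not> P x", OF this]
  show ?case using x by (auto simp: not_not)
qed simp

text \<open>A discrete intermediate value argument: at the least \<open>s\<close> with
  \<open>A < f s\<close> the predecessor violates the second alternative of the last hypothesis, so
  the first one gives \<open>g s < B\<close>. It serves to find one extremal point lying beyond a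
  whole run of extremal points of the other type.\<close>

lemma crossing_index:
  fixes f g :: "nat \<Rightarrow> nat"
  assumes "0 < b" "A < f (b - 1)" "g 0 < B"
    and "\<And>s. Suc s < b \<Longrightarrow> g (Suc s) < B \<or> A < f s"
  shows "\<exists>s<b. A < f s \<and> g s < B"
proof -
  define s where "s = (LEAST s. A < f s)"
  have s: "A < f s" "s \<le> b - 1" using assms(2) unfolding s_def by (auto intro: LeastI Least_le)
  have "g s < B"
  proof (cases s)
    case (Suc t)
    then have "\<not> A < f t" using not_less_Least[of t "\<lambda>s. A < f s"] unfolding s_def by simp
    then show ?thesis using assms(4)[of t] s Suc by auto
  qed (use assms in simp)
  then show ?thesis using s assms(1) by (intro exI[of _ s]) auto
qed

lemma nth_splice_balanced:
  assumes "length xs = (m + 1) div 2" "length ys = m div 2" "k < m"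
  shows "splice xs ys ! k = (if even k then xs ! (k div 2) else ys ! (k div 2))"
proof (cases "even k")
  case True
  then obtain r where "k = 2 * r" by blast
  then show ?thesis using nth_splice_even[of r xs ys] assms by auto
next
  case False
  then obtain r where "k = 2 * r + 1" by (rule oddE)
  then show ?thesis using nth_splice_odd[of r xs ys] assms by auto
qed

subsection \<open>Patterns\<close>

lemma no_claw: "\<lbrakk>claw_free S; v \<in> S; a \<in> S; b \<in> S; c \<in> S; a \<lless> b; b \<lless> c; v \<sim> a; v \<sim> b; v \<sim> c\<rbrakk> \<Longrightarrow>
  False"
  unfolding claw_free_def by blast

lemma contains_iff:
  "contains N \<pi> \<tau> \<longleftrightarrow>
     (\<exists>t. sorted_wrt (<) t \<and> set t \<subseteq> {1..N} \<and> order_isomorphic (map \<pi> t) \<tau>)"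
proof
  assume "contains N \<pi> \<tau>"
  then obtain s where s: "subseq s (one_line N \<pi>)" "order_isomorphic s \<tau>"
    by (auto simp: contains_def)
  then obtain M where "s = map \<pi> (nths [1..<N + 1] M)"
    unfolding one_line_def subseq_conv_nths nths_map by blast
  moreover have "sorted_wrt (<) (nths [1..<N + 1] M)"
    by (metis distinct_nthsI distinct_upt sorted_nths sorted_upt strict_sorted_iff)
  moreover have "set (nths [1..<N + 1] M) \<subseteq> {1..N}"
    using set_nths_subset[of "[1..<N + 1]" M] by auto
  ultimately show "\<exists>t. sorted_wrt (<) t \<and> set t \<subseteq> {1..N} \<and> order_isomorphic (map \<pi> t) \<tau>"
    using s by blast
next
  assume "\<exists>t. sorted_wrt (<) t \<and> set t \<subseteq> {1..N} \<and> order_isomorphic (map \<pi> t) \<tau>"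
  then obtain t where t: "sorted_wrt (<) t" "set t \<subseteq> {1..N}" "order_isomorphic (map \<pi> t) \<tau>"
    by blast
  have "sorted_wrt (<) (filter (\<lambda>x. x \<in> set t) [1..<N + 1])"
    by (intro sorted_wrt_filter sorted_wrt_upt)
  moreover have "set (filter (\<lambda>x. x \<in> set t) [1..<N + 1]) = set t" using t(2) by auto
  ultimately have "filter (\<lambda>x. x \<in> set t) [1..<N + 1] = t"
    using t(1) by (metis sorted_list_of_set_eqI)
  then have "subseq t [1..<N + 1]" by (metis subseq_filter_left)
  then show "contains N \<pi> \<tau>" using t(3) unfolding contains_def one_line_def
    by (blast intro: subseq_map)
qed

lemma order_isomorphic_4:
  "order_isomorphic u [a, b, c, d] \<longleftrightarrow> (\<exists>w x y z. u = [w, x, y, z] \<and>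
     (w < x \<longleftrightarrow> a < b) \<and> (w < y \<longleftrightarrow> a < c) \<and> (w < z \<longleftrightarrow> a < d) \<and>
     (x < w \<longleftrightarrow> b < a) \<and> (x < y \<longleftrightarrow> b < c) \<and> (x < z \<longleftrightarrow> b < d) \<and>
     (y < w \<longleftrightarrow> c < a) \<and> (y < x \<longleftrightarrow> c < b) \<and> (y < z \<longleftrightarrow> c < d) \<and>
     (z < w \<longleftrightarrow> d < a) \<and> (z < x \<longleftrightarrow> d < b) \<and> (z < y \<longleftrightarrow> d < c))"
proof
  assume o: "order_isomorphic u [a, b, c, d]"
  then have "length u = Suc (Suc (Suc (Suc 0)))" by (simp add: order_isomorphic_def)
  then obtain w x y z where u: "u = [w, x, y, z]"
    by (auto simp: length_Suc_conv)
  show "\<exists>w x y z. u = [w, x, y, z] \<and>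
     (w < x \<longleftrightarrow> a < b) \<and> (w < y \<longleftrightarrow> a < c) \<and> (w < z \<longleftrightarrow> a < d) \<and>
     (x < w \<longleftrightarrow> b < a) \<and> (x < y \<longleftrightarrow> b < c) \<and> (x < z \<longleftrightarrow> b < d) \<and>
     (y < w \<longleftrightarrow> c < a) \<and> (y < x \<longleftrightarrow> c < b) \<and> (y < z \<longleftrightarrow> c < d) \<and>
     (z < w \<longleftrightarrow> d < a) \<and> (z < x \<longleftrightarrow> d < b) \<and> (z < y \<longleftrightarrow> d < c)"
    using o unfolding u order_isomorphic_def by (auto simp: All_less_Suc)
next
  assume "\<exists>w x y z. u = [w, x, y, z] \<and>
     (w < x \<longleftrightarrow> a < b) \<and> (w < y \<longleftrightarrow> a < c) \<and> (w < z \<longleftrightarrow> a < d) \<and>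
     (x < w \<longleftrightarrow> b < a) \<and> (x < y \<longleftrightarrow> b < c) \<and> (x < z \<longleftrightarrow> b < d) \<and>
     (y < w \<longleftrightarrow> c < a) \<and> (y < x \<longleftrightarrow> c < b) \<and> (y < z \<longleftrightarrow> c < d) \<and>
     (z < w \<longleftrightarrow> d < a) \<and> (z < x \<longleftrightarrow> d < b) \<and> (z < y \<longleftrightarrow> d < c)"
  then show "order_isomorphic u [a, b, c, d]"
    by (elim exE conjE) (simp add: order_isomorphic_def All_less_Suc)
qed

lemma contains_4:
  "contains N \<pi> [a, b, c, d] \<longleftrightarrow> (\<exists>i j k l. 1 \<le> i \<and> i < j \<and> j < k \<and> k < l \<and> l \<le> N \<and>
     order_isomorphic [\<pi> i, \<pi> j, \<pi> k, \<pi> l] [a, b, c, d])"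
proof
  assume "contains N \<pi> [a, b, c, d]"
  then obtain t where t: "sorted_wrt (<) t" "set t \<subseteq> {1..N}"
    "order_isomorphic (map \<pi> t) [a, b, c, d]"
    unfolding contains_iff by blast
  then have "length t = Suc (Suc (Suc (Suc 0)))" by (simp add: order_isomorphic_def)
  then obtain i j k l where "t = [i, j, k, l]" by (auto simp: length_Suc_conv)
  then show "\<exists>i j k l. 1 \<le> i \<and> i < j \<and> j < k \<and> k < l \<and> l \<le> N \<and>
     order_isomorphic [\<pi> i, \<pi> j, \<pi> k, \<pi> l] [a, b, c, d]"
    using t by auto
next
  assume "\<exists>i j k l. 1 \<le> i \<and> i < j \<and> j < k \<and> k < l \<and> l \<le> N \<and>
     order_isomorphic [\<pi> i, \<pi> j, \<pi> k, \<pi> l] [a, b, c, d]"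
  then obtain i j k l where "1 \<le> i" "i < j" "j < k" "k < l" "l \<le> N"
     "order_isomorphic [\<pi> i, \<pi> j, \<pi> k, \<pi> l] [a, b, c, d]" by blast
  then show "contains N \<pi> [a, b, c, d]"
    unfolding contains_iff by (intro exI[of _ "[i, j, k, l]"]) auto
qed

text \<open>The centre of a claw cannot lie on different sides of two of its increasing leaves. It
  therefore comes before and above all three, giving 4123, or after and below all three, giving
  2341.\<close>

lemma avoids_claws_iff:
  "avoids N \<pi> [2,3,4,1] \<and> avoids N \<pi> [4,1,2,3] \<longleftrightarrow> claw_free (entries N \<pi>)" (is "?l \<longleftrightarrow> ?r")
proof
  assume l: ?l
  show ?r unfolding claw_free_def
  proof (intro ballI notI)
    fix v a b c
    assume S: "v \<in> entries N \<pi>" "a \<in> entries N \<pi>" "b \<in> entries N \<pi>" "c \<in> entries N \<pi>"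
      and h: "a \<lless> b \<and> b \<lless> c \<and> v \<sim> a \<and> v \<sim> b \<and> v \<sim> c"
    obtain p i j k where eq: "v = (p, \<pi> p)" "a = (i, \<pi> i)" "b = (j, \<pi> j)" "c = (k, \<pi> k)"
      and r: "p \<in> {1..N}" "i \<in> {1..N}" "j \<in> {1..N}" "k \<in> {1..N}"
      using S unfolding entries_def by blast
    have o: "i < j" "j < k" "\<pi> i < \<pi> j" "\<pi> j < \<pi> k" using h by (auto simp: eq sw_def)
    have "p < i \<and> \<pi> k < \<pi> p \<or> k < p \<and> \<pi> p < \<pi> i"
      using h o unfolding inverted_def nw_def eq by auto
    then show False
    proof
      assume "p < i \<and> \<pi> k < \<pi> p"
      then have "contains N \<pi> [4,1,2,3]" using o r unfolding contains_4 order_isomorphic_4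
        by (intro exI[of _ p] exI[of _ i] exI[of _ j] exI[of _ k]) auto
      then show False using l by (simp add: avoids_def)
    next
      assume "k < p \<and> \<pi> p < \<pi> i"
      then have "contains N \<pi> [2,3,4,1]" using o r unfolding contains_4 order_isomorphic_4
        by (intro exI[of _ i] exI[of _ j] exI[of _ k] exI[of _ p]) auto
      then show False using l by (simp add: avoids_def)
    qed
  qed
next
  assume r: ?r
  have no: False if "p \<in> {1..N}" "i \<in> {1..N}" "j \<in> {1..N}" "k \<in> {1..N}"
    "i < j" "j < k" "\<pi> i < \<pi> j" "\<pi> j < \<pi> k" "p < i \<and> \<pi> k < \<pi> p \<or> k < p \<and> \<pi> p < \<pi> i" for p i j k
    using that no_claw[OF r, of "(p, \<pi> p)" "(i, \<pi> i)" "(j, \<pi> j)" "(k, \<pi> k)"]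
    by (auto simp: entries_def sw_def inverted_def nw_def)
  show ?l unfolding avoids_def contains_4 order_isomorphic_4
  proof (intro conjI notI; elim exE conjE; clarsimp)
    fix i j k l assume "Suc 0 \<le> i" "i < j" "j < k" "k < l" "l \<le> N"
      "\<pi> i < \<pi> j" "\<pi> j < \<pi> k" "\<pi> l < \<pi> i"
    then show False using no[of l i j k] by auto
  next
    fix i j k l assume "Suc 0 \<le> i" "i < j" "j < k" "k < l" "l \<le> N"
      "\<pi> j < \<pi> k" "\<pi> k < \<pi> l" "\<pi> l < \<pi> i"
    then show False using no[of i j k l] by auto
  qed
qed

text \<open>Of two increasing pairs with all four cross inversions, one lies entirely before and
  above the other; read from left to right this is 3412.\<close>

lemma avoids_square_iff: "avoids N \<pi> [3,4,1,2] \<longleftrightarrow> square_free (entries N \<pi>)" (is "?l \<longleftrightarrow> ?r")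
proof
  assume l: ?l
  have no: False if "i \<in> {1..N}" "j \<in> {1..N}" "p \<in> {1..N}" "q \<in> {1..N}"
    "i < j" "j < p" "p < q" "\<pi> p < \<pi> q" "\<pi> q < \<pi> i" "\<pi> i < \<pi> j" for i j p q
  proof -
    have "contains N \<pi> [3,4,1,2]" using that unfolding contains_4 order_isomorphic_4
      by (intro exI[of _ i] exI[of _ j] exI[of _ p] exI[of _ q]) auto
    then show False using l by (simp add: avoids_def)
  qed
  show ?r unfolding square_free_def
  proof (intro ballI notI)
    fix a b c d
    assume S: "a \<in> entries N \<pi>" "b \<in> entries N \<pi>" "c \<in> entries N \<pi>" "d \<in> entries N \<pi>"
      and h: "a \<lless> b \<and> c \<lless> d \<and> a \<sim> c \<and> a \<sim> d \<and> b \<sim> c \<and> b \<sim> d"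
    obtain i j p q where eq: "a = (i, \<pi> i)" "b = (j, \<pi> j)" "c = (p, \<pi> p)" "d = (q, \<pi> q)"
      and r: "i \<in> {1..N}" "j \<in> {1..N}" "p \<in> {1..N}" "q \<in> {1..N}"
      using S unfolding entries_def by blast
    have o: "i < j" "p < q" "\<pi> i < \<pi> j" "\<pi> p < \<pi> q" using h by (auto simp: eq sw_def)
    have "j < p \<and> \<pi> q < \<pi> i \<or> q < i \<and> \<pi> j < \<pi> p"
      using h o unfolding inverted_def nw_def eq by auto
    then show False using no[of i j p q] no[of p q i j] o r by blast
  qed
next
  assume r: ?r
  show ?l unfolding avoids_def contains_4 order_isomorphic_4
  proof (intro notI; elim exE conjE; clarsimp)
    fix i j k l assume "Suc 0 \<le> i" "i < j" "j < k" "k < l" "l \<le> N"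
      "\<pi> i < \<pi> j" "\<pi> k < \<pi> l" "\<pi> l < \<pi> i" 
    moreover from this have "(i, \<pi> i) \<in> entries N \<pi>" "(j, \<pi> j) \<in> entries N \<pi>"
      "(k, \<pi> k) \<in> entries N \<pi>" "(l, \<pi> l) \<in> entries N \<pi>" by (auto simp: entries_def)
    ultimately show False using r[unfolded square_free_def, rule_format,
        of "(i, \<pi> i)" "(j, \<pi> j)" "(k, \<pi> k)" "(l, \<pi> l)"]
      by (auto simp: sw_def inverted_def nw_def)
  qed
qed

subsection \<open>Entries along a zigzag of extremal points\<close>

text \<open>This separates the geometry of the cells from the indexing of permutations.
  \<open>lr i\<close> marks the type of \<open>e i\<close>; \<open>adjacent\<close> and
  \<open>distant\<close> say that the extremal points form an induced path that increases at
  distance two or more. The bound \<open>four\<close> reflects that there are at least two extremal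
  points of each type.\<close>

locale zigzag =
  fixes S :: "point set" and n :: nat and e :: "nat \<Rightarrow> point" and lr :: "nat \<Rightarrow> bool"
  assumes finite_S: "finite S"
    and inj_fst: "inj_on fst S"
    and inj_snd: "inj_on snd S"
    and four: "4 \<le> n"
    and e_in: "\<lbrakk>1 \<le> i; i \<le> n\<rbrakk> \<Longrightarrow> e i \<in> S"
    and lr_Suc: "lr (Suc i) = (\<not> lr i)"
    and lr_max: "\<lbrakk>lr i; 1 \<le> i; i \<le> n; v \<in> S\<rbrakk> \<Longrightarrow> \<not> v \<leadsto> e i"
    and rl_min: "\<lbrakk>\<not> lr i; 1 \<le> i; i \<le> n; v \<in> S\<rbrakk> \<Longrightarrow> \<not> e i \<leadsto> v"
    and below_lr: "\<lbrakk>v \<in> S; v \<notin> e ` {1..n}\<rbrakk> \<Longrightarrow> \<exists>i\<in>{1..n}. lr i \<and> e i \<leadsto> v"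
    and above_rl: "\<lbrakk>v \<in> S; v \<notin> e ` {1..n}\<rbrakk> \<Longrightarrow> \<exists>i\<in>{1..n}. \<not> lr i \<and> v \<leadsto> e i"
    and adjacent: "\<lbrakk>1 \<le> i; i < n\<rbrakk> \<Longrightarrow> e i \<sim> e (Suc i)"
    and distant: "\<lbrakk>1 \<le> i; i + 2 \<le> j; j \<le> n\<rbrakk> \<Longrightarrow> e i \<lless> e j"
begin

lemma trichotomy:
  assumes "p \<in> S" "q \<in> S"
  obtains "p = q" | "p \<lless> q" | "q \<lless> p" | "p \<sim> q"
proof -
  have "fst p = fst q \<Longrightarrow> p = q" "snd p = snd q \<Longrightarrow> p = q"
    using assms inj_fst inj_snd by (auto dest: inj_onD)
  then show ?thesis
    using that unfolding sw_def nw_def inverted_def by (meson linorder_neqE_nat)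
qed

lemma lr_iff: "lr i = (lr 0 = even i)"
  by (induction i) (auto simp: lr_Suc)

lemma e_inverted_iff:
  assumes "i \<in> {1..n}" "j \<in> {1..n}"
  shows "e i \<sim> e j \<longleftrightarrow> j = Suc i \<or> i = Suc j"
proof (cases "i = j \<or> j = Suc i \<or> i = Suc j")
  case True
  then show ?thesis using assms adjacent[of i] adjacent[of j] inverted_sym[of "e i" "e j"]
    by auto
next
  case False
  then have "i + 2 \<le> j \<or> j + 2 \<le> i" by arith
  then have "e i \<lless> e j \<or> e j \<lless> e i" using assms distant by auto
  then show ?thesis using sw_not_inverted False by blast
qed

lemma e_inj:
  assumes "i \<in> {1..n}" "j \<in> {1..n}" "e i = e j"
  shows "i = j"
proof (rule ccontr)
  assume "i \<noteq> j"
  then have "j = Suc i \<or> i = Suc j \<or> i + 2 \<le> j \<or> j + 2 \<le> i" by arith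
  then have "e i \<sim> e j \<or> e i \<lless> e j \<or> e j \<lless> e i"
    using assms(1,2) distant[of i j] distant[of j i] e_inverted_iff[OF assms(1,2)]
    unfolding atLeastAtMost_iff by metis
  then show False using assms(3) by simp
qed

section \<open>Spans: the extremal points inverted with a given entry\<close>

lemma inverted_lr: "\<lbrakk>v \<in> S; i \<in> {1..n}; v \<sim> e i; lr i\<rbrakk> \<Longrightarrow> e i \<leadsto> v"
  using lr_max by (auto simp: inverted_def)

lemma inverted_rl: "\<lbrakk>v \<in> S; i \<in> {1..n}; v \<sim> e i; \<not> lr i\<rbrakk> \<Longrightarrow> v \<leadsto> e i"
  using rl_min by (auto simp: inverted_def)

text \<open>A closed neighbourhood on the path: counting \<open>v = e i\<close> as a hit makes the
  span of an extremal point an interval as well.\<close>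

definition span :: "point \<Rightarrow> nat set" where
  "span v = {i \<in> {1..n}. v = e i \<or> v \<sim> e i}"

text \<open>A non-extremal entry has neighbours of both types. Any two of opposite type are inverted
  with each other by transitivity through the entry, hence consecutive on the path. So the span
  contains some \<open>k\<close> and \<open>Suc k\<close>, and every further index is next to one of
  these.\<close>

lemma span_interval_ex:
  assumes v: "v \<in> S"
  shows "\<exists>l h. span v = {l..h} \<and> 1 \<le> l \<and> l < h \<and> h \<le> n \<and> h \<le> l + 2"
proof (cases "v \<in> e ` {1..n}")
  case True
  then obtain j where j: "j \<in> {1..n}" "v = e j" by auto
  have "span v = {i \<in> {1..n}. i = j \<or> i = Suc j \<or> j = Suc i}"
    unfolding span_def using j e_inj e_inverted_iff by auto
  also have "\<dots> = {max 1 (j - 1)..min n (Suc j)}"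
    using j by auto
  finally show ?thesis using j four
    by (intro exI[of _ "max 1 (j - 1)"] exI[of _ "min n (Suc j)"]) auto
next
  case False
  have adj: "j = Suc i \<or> i = Suc j" if "i \<in> span v" "j \<in> span v" "lr i" "\<not> lr j" for i j
  proof -
    have "v \<noteq> e i" "v \<noteq> e j" using that False by (auto simp: span_def)
    then have "e i \<leadsto> v" "v \<leadsto> e j"
      using that inverted_lr inverted_rl v unfolding span_def by auto
    then have "e i \<sim> e j" using nw_trans inverted_def by blast
    then show ?thesis using e_inverted_iff that unfolding span_def by blast
  qed
  obtain i where i: "i \<in> {1..n}" "lr i" "e i \<leadsto> v" using below_lr v False by blast
  obtain j where j: "j \<in> {1..n}" "\<not> lr j" "v \<leadsto> e j" using above_rl v False by blast
  have ij: "i \<in> span v" "j \<in> span v" using i j by (auto simp: span_def inverted_def)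
  define k where "k = min i j"
  have k: "k \<in> span v" "Suc k \<in> span v"
    using adj[OF ij i(2) j(2)] ij unfolding k_def by (auto simp: min_def)
  have near: "x = Suc y \<or> y = Suc x" if "x \<in> span v" "y \<in> span v" "lr x \<noteq> lr y" for x y
    using adj[of x y] adj[of y x] that by blast
  have sub: "x \<in> {k - 1..k + 2}" if "x \<in> span v" for x
    using near[OF k(1) that] near[OF k(2) that] lr_Suc[of k] by (cases "lr k = lr x") auto
  \<comment> \<open>The indices \<open>k - 1\<close> and \<open>k + 2\<close> differ by 3, so they
    have opposite types without being consecutive.\<close>
  have notboth: "\<not> (k - 1 \<in> span v \<and> k + 2 \<in> span v)" 
  proof
    assume a: "k - 1 \<in> span v \<and> k + 2 \<in> span v"
    then have "1 \<le> k - 1" by (auto simp: span_def)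
    then have "lr (k - 1) \<noteq> lr (k + 2)" unfolding lr_iff[of "k - 1"] lr_iff[of "k + 2"] by auto
    with near a show False by fastforce
  qed
  have rng: "x \<in> {1..n}" if "x \<in> span v" for x using that by (simp add: span_def)
  consider "k - 1 \<in> span v" "k + 2 \<notin> span v" | "k - 1 \<notin> span v" "k + 2 \<in> span v"
    | "k - 1 \<notin> span v" "k + 2 \<notin> span v" using notboth by blast
  then show ?thesis
  proof cases
    case 1
    have "span v = {k - 1..Suc k}"
    proof (intro equalityI subsetI)
      fix x assume "x \<in> span v" then show "x \<in> {k - 1..Suc k}" using sub[of x] 1
        by (cases "x = k + 2") auto
    next
      fix x assume "x \<in> {k - 1..Suc k}"
      then have "x = k - 1 \<or> x = k \<or> x = Suc k" by auto
      then show "x \<in> span v" using k 1 by auto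
    qed
    then show ?thesis using rng[OF 1(1)] rng[OF k(2)] rng[OF k(1)]
      by (intro exI[of _ "k - 1"] exI[of _ "Suc k"]) auto
  next
    case 2
    have "span v = {k..k + 2}"
    proof (intro equalityI subsetI)
      fix x assume "x \<in> span v" then show "x \<in> {k..k + 2}" using sub[of x] 2
        by (cases "x = k - 1") auto
    next
      fix x assume "x \<in> {k..k + 2}"
      then have "x = k + 2 \<or> x = k \<or> x = Suc k" by auto
      then show "x \<in> span v" using k 2 by auto
    qed
    then show ?thesis using rng[OF 2(2)] rng[OF k(2)] rng[OF k(1)]
      by (intro exI[of _ "k"] exI[of _ "k + 2"]) auto
  next
    case 3
    have "span v = {k..Suc k}"
    proof (intro equalityI subsetI)
      fix x assume "x \<in> span v" then show "x \<in> {k..Suc k}" using sub[of x] 3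
        by (cases "x = k - 1"; cases "x = k + 2") auto
    next
      fix x assume "x \<in> {k..Suc k}"
      then have "x = k \<or> x = Suc k" by auto
      then show "x \<in> span v" using k by auto
    qed
    then show ?thesis using rng[OF k(2)] rng[OF k(1)]
      by (intro exI[of _ "k"] exI[of _ "Suc k"]) auto
  qed
qed

definition lo :: "point \<Rightarrow> nat" where "lo v = Min (span v)"
definition hi :: "point \<Rightarrow> nat" where "hi v = Max (span v)"

lemma span_interval:
  assumes "v \<in> S"
  shows "span v = {lo v..hi v}" "1 \<le> lo v" "lo v < hi v" "hi v \<le> n" "hi v \<le> lo v + 2"
proof -
  obtain l h where lh: "span v = {l..h}" "1 \<le> l" "l < h" "h \<le> n" "h \<le> l + 2"
    using span_interval_ex[OF assms] by blast
  have "Min {l..h} = l" "Max {l..h} = h"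
    using lh(3) by (auto intro!: Min_eqI Max_eqI)
  then have "lo v = l" "hi v = h" using lh by (simp_all add: lo_def hi_def)
  with lh show "span v = {lo v..hi v}" "1 \<le> lo v" "lo v < hi v" "hi v \<le> n" "hi v \<le> lo v + 2"
    by simp_all
qed

lemma in_span_iff:
  "\<lbrakk>v \<in> S; i \<in> {1..n}\<rbrakk> \<Longrightarrow> v = e i \<or> v \<sim> e i \<longleftrightarrow> lo v \<le> i \<and> i \<le> hi v"
proof -
  assume "v \<in> S" "i \<in> {1..n}"
  then have "v = e i \<or> v \<sim> e i \<longleftrightarrow> i \<in> span v" by (simp add: span_def)
  then show ?thesis using span_interval(1)[OF \<open>v \<in> S\<close>] by simp
qed

lemma lo_hi_e:
  assumes "i \<in> {1..n}"
  shows "lo (e i) = max 1 (i - 1)" "hi (e i) = min n (i + 1)"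
proof -
  have eS: "e i \<in> S" using assms e_in by auto
  have "span (e i) = {j \<in> {1..n}. j = i \<or> j = Suc i \<or> i = Suc j}"
    unfolding span_def using assms e_inj e_inverted_iff by auto
  also have "\<dots> = {max 1 (i - 1)..min n (i + 1)}"
    using assms by auto
  finally have "{lo (e i)..hi (e i)} = {max 1 (i - 1)..min n (i + 1)}"
    using span_interval(1)[OF eS] by simp
  then show "lo (e i) = max 1 (i - 1)" "hi (e i) = min n (i + 1)"
    using span_interval(3)[OF eS] by (simp_all add: Icc_eq_Icc)
qed

lemma e_sw_iff:
  assumes v: "v \<in> S" and i: "i \<in> {1..n}"
  shows "e i \<lless> v \<longleftrightarrow> i < lo v"
proof
  assume "e i \<lless> v"
  then have not_in: "\<not> (lo v \<le> i \<and> i \<le> hi v)"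
    using in_span_iff[OF v i] sw_not_inverted not_sw_self by blast
  show "i < lo v"
  proof (rule ccontr)
    assume "\<not> i < lo v"
    then have h: "hi v < i" using not_in by simp
    \<comment> \<open>A span has at least two elements, so \<open>hi v - 1\<close> still belongs to
      it, and it is at distance at least 2 from \<open>i\<close>. The chain through
      \<open>e i\<close> would then put \<open>v\<close> above a point that it equals or is inverted
      with.\<close>
    have "e (hi v - 1) \<lless> e i" using h span_interval(2-5)[OF v] i by (intro distant) auto
    then have "e (hi v - 1) \<lless> v" using \<open>e i \<lless> v\<close> sw_trans by blast
    moreover have "v = e (hi v - 1) \<or> v \<sim> e (hi v - 1)"
      by (subst in_span_iff[OF v]) (use span_interval(2-5)[OF v] in auto)
    ultimately show False using sw_not_inverted not_sw_self by metis
  qed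
next
  assume a: "i < lo v"
  then have "\<not> (v = e i \<or> v \<sim> e i)" using in_span_iff[OF v i] by simp
  moreover have "\<not> v \<lless> e i"
  proof
    assume "v \<lless> e i"
    moreover have "e i \<lless> e (lo v + 1)" using a span_interval(2-5)[OF v] i by (intro distant) auto
    ultimately have "v \<lless> e (lo v + 1)" using sw_trans by blast
    moreover have "v = e (lo v + 1) \<or> v \<sim> e (lo v + 1)"
      by (subst in_span_iff[OF v]) (use span_interval(2-5)[OF v] in auto)
    ultimately show False using sw_not_inverted not_sw_self by metis
  qed
  moreover have "e i \<in> S" using i e_in by simp
  ultimately show "e i \<lless> v" using trichotomy[OF v] by blast
qed

lemma sw_e_iff:
  assumes v: "v \<in> S" and i: "i \<in> {1..n}"
  shows "v \<lless> e i \<longleftrightarrow> hi v < i"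
proof
  assume "v \<lless> e i"
  then have "\<not> (v = e i \<or> v \<sim> e i)" "\<not> e i \<lless> v"
    using sw_not_inverted not_sw_self sw_asym by blast+
  then show "hi v < i" using in_span_iff[OF v i] e_sw_iff[OF v i] by simp
next
  assume "hi v < i"
  then have "\<not> (v = e i \<or> v \<sim> e i)" "\<not> e i \<lless> v"
    using in_span_iff[OF v i] e_sw_iff[OF v i] span_interval(3)[OF v] by auto
  moreover have "e i \<in> S" using i e_in by simp
  ultimately show "v \<lless> e i" using trichotomy[OF v] by blast
qed

(* The inflection point of e i and e (i + 2), where i = hi u - 1, weakly separates u from v. *)
lemma sw_if_hi_le_lo:
  assumes u: "u \<in> S" and v: "v \<in> S" and le: "hi u \<le> lo v"
  shows "u \<lless> v"
proof -
  define i where "i = hi u - 1"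
  have b: "1 \<le> i" "i + 2 \<le> n" "i + 2 = hi u + 1" "lo u \<le> i" "i < lo v" "i + 2 \<le> hi v"
    using span_interval(2-5)[OF u] span_interval(2-5)[OF v] le unfolding i_def by linarith+
  have r: "i \<in> {1..n}" "i + 2 \<in> {1..n}" using b by auto
  have 1: "u \<lless> e (i + 2)" "\<not> e i \<lless> u" "e i \<lless> v" "\<not> v \<lless> e (i + 2)"
    using sw_e_iff e_sw_iff u v b r by auto
  have S: "e i \<in> S" "e (i + 2) \<in> S" using r e_in by auto
  show ?thesis
  proof (cases "lr i")
    case True
    then have "lr (i + 2)" by (simp add: lr_Suc)
    have "snd u \<le> snd (e i)"
      by (rule trichotomy[OF u S(1)])
        (use 1(2) inverted_lr[OF u r(1) _ True] in \<open>auto simp: sw_def nw_def\<close>)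
    moreover have "fst (e (i + 2)) \<le> fst v"
      by (rule trichotomy[OF v S(2)])
        (use 1(4) inverted_lr[OF v r(2) _ \<open>lr (i + 2)\<close>] in \<open>auto simp: sw_def nw_def\<close>)
    ultimately show ?thesis using 1 by (auto simp: sw_def)
  next
    case False
    then have "\<not> lr (i + 2)" by (simp add: lr_Suc)
    have "fst u \<le> fst (e i)"
      by (rule trichotomy[OF u S(1)])
        (use 1(2) inverted_rl[OF u r(1) _ False] in \<open>auto simp: sw_def nw_def\<close>)
    moreover have "snd (e (i + 2)) \<le> snd v"
      by (rule trichotomy[OF v S(2)])
        (use 1(4) inverted_rl[OF v r(2) _ \<open>\<not> lr (i + 2)\<close>] in \<open>auto simp: sw_def nw_def\<close>)
    ultimately show ?thesis using 1 by (auto simp: sw_def)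
  qed
qed

section \<open>Cells as classes of entries with equal span\<close>

definition D :: "nat \<Rightarrow> point set" where
  "D i = {v \<in> S. lo v = max 1 (i - 1) \<and> hi v = min n (i + 1)}"

text \<open>The point \<open>e i\<close> has exactly the span of its own corner cell. Statements
  about single entries are proved for \<open>D i\<close>, where \<open>e i\<close> is treated like
  any other entry, and \<open>e i\<close> is removed only to obtain the cell itself.\<close>

definition K :: "nat \<Rightarrow> point set" where
  "K i = D i - {e i}"

definition C :: "nat \<Rightarrow> point set" where
  "C k = {v \<in> S. lo v = k + 1 \<and> hi v = k + 2}"

lemma D_S: "u \<in> D i \<Longrightarrow> u \<in> S"
  by (simp add: D_def)

lemma C_S: "u \<in> C k \<Longrightarrow> u \<in> S"
  by (simp add: C_def)

lemma K_D: "u \<in> K i \<Longrightarrow> u \<in> D i"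
  by (simp add: K_def)

lemma e_in_D: "i \<in> {1..n} \<Longrightarrow> e i \<in> D i"
  using lo_hi_e e_in by (simp add: D_def)

lemma D_eq: "i \<in> {1..n} \<Longrightarrow> D i = insert (e i) (K i)"
  using e_in_D by (auto simp: K_def)

lemma e_in_D_iff: "\<lbrakk>i \<in> {1..n}; j \<in> {1..n}\<rbrakk> \<Longrightarrow> e i \<in> D j \<longleftrightarrow> i = j"
  using lo_hi_e[of i] e_in_D[of i] four by (auto simp: D_def min_def max_def split: if_splits)

lemma e_notin_C: "\<lbrakk>1 \<le> k; k + 3 \<le> n; i \<in> {1..n}\<rbrakk> \<Longrightarrow> e i \<notin> C k"
  using lo_hi_e[of i] by (auto simp: C_def min_def max_def split: if_splits)

lemma cells_cover:
  assumes v: "v \<in> S"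
  obtains i where "i \<in> {1..n}" "v \<in> D i" | k where "1 \<le> k" "k + 3 \<le> n" "v \<in> C k"
proof -
  note b = span_interval(2-5)[OF v]
  consider "hi v = lo v + 2" | "hi v = lo v + 1" "lo v = 1" | "hi v = lo v + 1" "hi v = n"
    | "hi v = lo v + 1" "lo v \<noteq> 1" "hi v \<noteq> n" using b by linarith
  then show ?thesis
  proof cases
    case 1 then show ?thesis using that(1)[of "lo v + 1"] b v by (auto simp: D_def)
  next
    case 2 then show ?thesis using that(1)[of 1] b v by (auto simp: D_def)
  next
    case 3 then show ?thesis using that(1)[of n] b v four by (auto simp: D_def)
  next
    case 4 then show ?thesis using that(2)[of "lo v - 1"] b v by (auto simp: C_def)
  qed
qed

lemma D_sw_D: "\<lbrakk>u \<in> D i; v \<in> D j; i + 2 \<le> j\<rbrakk> \<Longrightarrow> u \<lless> v"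
  by (rule sw_if_hi_le_lo) (auto simp: D_def)

lemma D_sw_C: "\<lbrakk>u \<in> D i; v \<in> C k; i \<le> k\<rbrakk> \<Longrightarrow> u \<lless> v"
  by (rule sw_if_hi_le_lo) (auto simp: D_def C_def)

lemma C_sw_D: "\<lbrakk>u \<in> C k; v \<in> D i; k + 3 \<le> i\<rbrakk> \<Longrightarrow> u \<lless> v"
  by (rule sw_if_hi_le_lo) (auto simp: D_def C_def)

lemma C_sw_C: "\<lbrakk>u \<in> C j; v \<in> C k; j < k\<rbrakk> \<Longrightarrow> u \<lless> v"
  by (rule sw_if_hi_le_lo) (auto simp: C_def)

lemma D_inverted_e:
  assumes "u \<in> D j" "i \<in> {1..n}" "j \<in> {1..n}" "u \<noteq> e i" "i \<le> j + 1" "j \<le> i + 1"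
  shows "u \<sim> e i"
  using in_span_iff[OF D_S[OF assms(1)] assms(2)] assms by (auto simp: D_def)

lemma D_inverted_e_other:
  assumes "u \<in> D j" "i \<in> {1..n}" "j \<in> {1..n}" "j = i + 1 \<or> i = j + 1"
  shows "u \<sim> e i" "e i \<sim> u"
proof -
  have "u \<noteq> e i" using e_in_D_iff[OF assms(2,3)] assms by auto
  then show "u \<sim> e i" using D_inverted_e[OF assms(1-3)] assms(4) by auto
  then show "e i \<sim> u" using inverted_sym by blast
qed

lemma C_inverted_e:
  assumes "u \<in> C k" "1 \<le> k" "k + 3 \<le> n" "i = k + 1 \<or> i = k + 2"
  shows "u \<sim> e i"
proof -
  have "i \<in> {1..n}" using assms by auto
  then show ?thesis
    using in_span_iff[OF C_S[OF assms(1)], of i] assms e_notin_C[OF assms(2,3)]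
      by (auto simp: C_def)
qed

text \<open>The coordinate left undecided between \<open>D i\<close> and \<open>D (Suc i)\<close>:
  \<open>D_next_side\<close> fixes the other one, so comparing keys decides between inversion and
  increase.\<close>

definition key :: "nat \<Rightarrow> point \<Rightarrow> nat" where
  "key i = (if lr i then snd else fst)"

text \<open>The point \<open>e (i + 2)\<close>, of the same type as \<open>e i\<close>, dominates
  all of \<open>D i\<close>, whereas an entry of \<open>D (Suc i)\<close> equals it or is inverted
  with it and so is at least as large in the coordinate determined by the type.\<close>

lemma D_next_side:
  assumes u: "u \<in> D i" and v: "v \<in> D (Suc i)" and i: "1 \<le> i" "i < n"
  shows "if lr i then fst u < fst v else snd u < snd v"
proof -
  note S = D_S[OF u] D_S[OF v]
  show ?thesis
  proof (cases "i + 2 \<le> n")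
    case True
    have r: "i + 2 \<in> {1..n}" using True by simp
    have 1: "u \<lless> e (i + 2)" using D_sw_D[OF u e_in_D[OF r]] by simp
    have 2: "v = e (i + 2) \<or> v \<sim> e (i + 2)" using D_inverted_e[OF v r] i by auto
    show ?thesis
    proof (cases "lr i")
      case True
      then have "v = e (i + 2) \<or> e (i + 2) \<leadsto> v" using 2 inverted_lr[OF S(2) r]
        by (auto simp: lr_Suc)
      then show ?thesis using 1 True by (auto simp: sw_def nw_def)
    next
      case False
      then have "v = e (i + 2) \<or> v \<leadsto> e (i + 2)" using 2 inverted_rl[OF S(2) r]
        by (auto simp: lr_Suc)
      then show ?thesis using 1 False by (auto simp: sw_def nw_def)
    qed
  next
    case False
    \<comment> \<open>In the last pair, \<open>i + 1 = n\<close> and there is no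
      \<open>e (i + 2)\<close>. The point \<open>e (i - 1)\<close>, dominated by all of
      \<open>D (Suc i)\<close>, plays its part from the other side.\<close>
    then have r: "i - 1 \<in> {1..n}" and i1: "Suc (i - 1) = i" using i four by auto
    have 1: "e (i - 1) \<lless> v" using D_sw_D[OF e_in_D[OF r] v] i1 by simp
    have 2: "u = e (i - 1) \<or> u \<sim> e (i - 1)" using D_inverted_e[OF u r] i by fastforce
    show ?thesis
    proof (cases "lr i")
      case True
      then have "\<not> lr (i - 1)" using lr_Suc[of "i - 1"] i1 by simp
      then have "u = e (i - 1) \<or> u \<leadsto> e (i - 1)" using 2 inverted_rl[OF S(1) r] by auto
      then show ?thesis using 1 True by (auto simp: sw_def nw_def)
    next
      case False
      then have "lr (i - 1)" using lr_Suc[of "i - 1"] i1 by simp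
      then have "u = e (i - 1) \<or> e (i - 1) \<leadsto> u" using 2 inverted_lr[OF S(1) r] by auto
      then show ?thesis using 1 False by (auto simp: sw_def nw_def)
    qed
  qed
qed

lemma D_next:
  assumes "u \<in> D i" "v \<in> D (Suc i)" "1 \<le> i" "i < n"
  shows "u \<lless> v \<longleftrightarrow> key i u < key i v" "u \<sim> v \<longleftrightarrow> key i v < key i u" "u \<sim> v \<or> u \<lless> v"
proof -
  note side = D_next_side[OF assms]
  have "u \<noteq> v" using side by (auto split: if_splits)
  then have ne: "fst u \<noteq> fst v" "snd u \<noteq> snd v"
    using D_S[OF assms(1)] D_S[OF assms(2)] inj_fst inj_snd by (auto dest: inj_onD)
  show "u \<lless> v \<longleftrightarrow> key i u < key i v" "u \<sim> v \<longleftrightarrow> key i v < key i u" "u \<sim> v \<or> u \<lless> v"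
    using side ne by (auto simp: key_def sw_def nw_def inverted_def split: if_splits)
qed

text \<open>The points \<open>e k\<close> and \<open>e (k + 3)\<close> enclose \<open>c\<close> in
  both coordinates. Being equal to or inverted with \<open>e k\<close> keeps \<open>u\<close> on its
  lower side in one coordinate, and \<open>e (k + 3)\<close> does the opposite for \<open>v\<close>
  in the same coordinate.\<close>

lemma C_sides:
  assumes u: "u \<in> D (k + 1)" and c: "c \<in> C k" and v: "v \<in> D (k + 2)" and k: "1 \<le> k" "k + 3 \<le> n"
  shows "if lr k then snd u < snd c \<and> snd c < snd v else fst u < fst c \<and> fst c < fst v"
proof -
  have r: "k \<in> {1..n}" "k + 3 \<in> {1..n}" using k by auto
  note S = D_S[OF u] D_S[OF v]
  have c1: "e k \<lless> c" "c \<lless> e (k + 3)"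
    using D_sw_C[OF e_in_D[OF r(1)] c] C_sw_D[OF c e_in_D[OF r(2)]] by auto
  have uv: "u = e k \<or> u \<sim> e k" "v = e (k + 3) \<or> v \<sim> e (k + 3)"
    using D_inverted_e[OF u r(1)] D_inverted_e[OF v r(2)] k by auto
  show ?thesis
  proof (cases "lr k")
    case True
    then have "\<not> lr (k + 3)" by (simp add: lr_Suc numeral_3_eq_3)
    then have "u = e k \<or> e k \<leadsto> u" "v = e (k + 3) \<or> v \<leadsto> e (k + 3)"
      using uv True inverted_lr[OF S(1) r(1)] inverted_rl[OF S(2) r(2)] by auto
    then show ?thesis using True c1 by (auto simp: sw_def nw_def)
  next
    case False
    then have "lr (k + 3)" by (simp add: lr_Suc numeral_3_eq_3)
    then have "u = e k \<or> u \<leadsto> e k" "v = e (k + 3) \<or> e (k + 3) \<leadsto> v"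
      using uv False inverted_rl[OF S(1) r(1)] inverted_lr[OF S(2) r(2)] by auto
    then show ?thesis using False c1 by (auto simp: sw_def nw_def)
  qed
qed

text \<open>By \<open>C_sides\<close> the value or position of \<open>c\<close> lies between those
  of \<open>u\<close> and \<open>v\<close>, so two inversions with \<open>c\<close> compose to one
  between \<open>u\<close> and \<open>v\<close>.\<close>

lemma C_transitive:
  assumes "u \<in> D (k + 1)" "c \<in> C k" "v \<in> D (k + 2)" "1 \<le> k" "k + 3 \<le> n" "u \<sim> c" "v \<sim> c"
  shows "u \<sim> v"
  using C_sides[OF assms(1-5)] assms(6,7) by (auto simp: inverted_def nw_def split: if_splits)

lemma D_inverted_D:
  assumes "u \<in> D i" "v \<in> D j" "u \<sim> v"
  shows "i \<le> j + 1" "j \<le> i + 1"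
  using D_sw_D[OF assms(1,2)] D_sw_D[OF assms(2,1)] sw_not_inverted[of u v] sw_not_inverted[of v u]
    assms(3) by (auto simp: not_less_eq_eq[symmetric])

lemma D_inverted_C:
  assumes "u \<in> D i" "v \<in> C k" "u \<sim> v"
  shows "i = k + 1 \<or> i = k + 2"
proof -
  have "\<not> i \<le> k" "\<not> k + 3 \<le> i"
    using D_sw_C[OF assms(1,2)] C_sw_D[OF assms(2,1)] sw_not_inverted[of u v] sw_not_inverted[of
      v u]
      assms(3) by auto
  then show ?thesis by linarith
qed

lemma C_inverted_C:
  assumes "u \<in> C j" "v \<in> C k" "u \<sim> v"
  shows "j = k"
  using C_sw_C[OF assms(1,2)] C_sw_C[OF assms(2,1)] sw_not_inverted[of u v] sw_not_inverted[of v u]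
      assms(3) by (metis linorder_neqE_nat)

lemma clique_D: "\<lbrakk>i \<in> {1..n}; clique (K i)\<rbrakk> \<Longrightarrow> clique (D i)"
  unfolding D_eq
  by (rule clique_insert) (auto simp: K_def inverted_sym[of "e i"] intro!: D_inverted_e)

lemma clique_D_Un_D:
  assumes "1 \<le> i" "i < n" "clique (K i \<union> K (Suc i))"
  shows "clique (D i \<union> D (Suc i))"
proof -
  have r: "i \<in> {1..n}" "Suc i \<in> {1..n}" using assms by auto
  have "q \<sim> e i" if "q \<in> insert (e (Suc i)) (K i \<union> K (Suc i))" for q
    using that adjacent[OF assms(1,2)] D_inverted_e[of q i i] D_inverted_e[of q "Suc i" i]
      e_in_D_iff[OF r] r unfolding K_def inverted_sym[of "e i"] by fastforce
  moreover have "q \<sim> e (Suc i)" if "q \<in> K i \<union> K (Suc i)" for q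
    using that D_inverted_e[of q i "Suc i"] D_inverted_e[of q "Suc i" "Suc i"]
      e_in_D_iff[OF r(2,1)] r unfolding K_def by fastforce
  ultimately have "clique (insert (e i) (insert (e (Suc i)) (K i \<union> K (Suc i))))"
    using assms(3) by (intro clique_insert) (simp_all only: inverted_sym[of "e _"])
  also have "insert (e i) (insert (e (Suc i)) (K i \<union> K (Suc i))) = D i \<union> D (Suc i)"
    using D_eq r by auto
  finally show ?thesis .
qed

text \<open>The condition says that no horizontal or vertical line through an inflection point,
  written in terms of \<open>e j\<close> and \<open>e (j + 2)\<close>, separates \<open>v\<close>
  from \<open>e i\<close>: this is the corner cell as defined by coordinates. Conversely, the lines
  through the neighbours of \<open>e i\<close> force both neighbours into the span of
  \<open>v\<close>, and at the two ends of the path a line through \<open>e 3\<close> or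
  \<open>e (n - 2)\<close> keeps the span from becoming too long.\<close>

lemma in_K_lr_iff:
  assumes i: "i \<in> {1..n}" and lr: "lr i"
  shows "v \<in> K i \<longleftrightarrow> v \<in> S \<and> e i \<leadsto> v \<and> (\<forall>j. 1 \<le> j \<and> j + 2 \<le> n \<longrightarrow>
    (if lr j
     then (fst (e i) < fst (e (j + 2)) \<longrightarrow> fst v < fst (e (j + 2))) \<and> (snd (e j) < snd (e i) \<longrightarrow>
       snd (e j) < snd v)
     else (fst (e i) < fst (e j) \<longrightarrow> fst v < fst (e j)) \<and>
       (snd (e (j + 2)) < snd (e i) \<longrightarrow> snd (e (j + 2)) < snd v)))" (is "_ \<longleftrightarrow> v \<in> S \<and> _ \<and> ?cond")
proof
  assume v: "v \<in> K i"
  note vD = K_D[OF v]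
  note vS = D_S[OF vD]
  have "v \<noteq> e i" using v by (simp add: K_def)
  then have "v \<sim> e i" using D_inverted_e[OF vD i i] by simp
  then have 1: "e i \<leadsto> v" using inverted_lr[OF vS i] lr by blast
  have beside: "fst v < fst (e j) \<and> snd (e j) < snd v"
    if "j \<in> {1..n}" "\<not> lr j" "j = i + 1 \<or> i = j + 1" for j
    using D_inverted_e_other(1)[OF vD that(1) i] that inverted_rl[OF vS that(1)]
    by (auto simp: nw_def)
  have "if lr j
     then (fst (e i) < fst (e (j + 2)) \<longrightarrow> fst v < fst (e (j + 2))) \<and> (snd (e j) < snd (e i) \<longrightarrow>
       snd (e j) < snd v)
     else (fst (e i) < fst (e j) \<longrightarrow> fst v < fst (e j)) \<and>
       (snd (e (j + 2)) < snd (e i) \<longrightarrow> snd (e (j + 2)) < snd v)" if j: "1 \<le> j" "j + 2 \<le> n" for j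
  proof -
    have r: "j \<in> {1..n}" "j + 2 \<in> {1..n}" using j by auto
    show ?thesis
    proof (cases "lr j")
      case True
      then have par: "even (i + j)" using lr by (auto simp: lr_iff[of i] lr_iff[of j])
      have "fst v < fst (e (j + 2))" if "fst (e i) < fst (e (j + 2))"
      proof -
        have "\<not> j + 2 + 2 \<le> i" using distant[of "j + 2" i] that i by (auto simp: sw_def)
        moreover have "j + 2 \<noteq> i" using that by auto
        ultimately have "i \<le> j" using par by presburger
        then show ?thesis using D_sw_D[OF vD e_in_D[OF r(2)]] by (auto simp: sw_def)
      qed
      moreover have "snd (e j) < snd v" if "snd (e j) < snd (e i)"
      proof -
        have "\<not> i + 2 \<le> j" using distant[of i j] that i j by (auto simp: sw_def)
        moreover have "j \<noteq> i" using that by auto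
        ultimately have "j + 2 \<le> i" using par by presburger
        then show ?thesis using D_sw_D[OF e_in_D[OF r(1)] vD] by (auto simp: sw_def)
      qed
      ultimately show ?thesis using True by simp
    next
      case False
      then have par: "odd (i + j)" using lr by (auto simp: lr_iff[of i] lr_iff[of j])
      have nj: "\<not> lr j" "\<not> lr (j + 2)" using False by (simp_all add: lr_Suc)
      have "fst v < fst (e j)" if "fst (e i) < fst (e j)"
      proof -
        have "\<not> j + 2 \<le> i" using distant[of "j" i] that i j by (auto simp: sw_def)
        then have "j = i + 1 \<or> i = j + 1 \<or> i + 2 \<le> j" using par by presburger
        then consider "j = i + 1 \<or> i = j + 1" | "i + 2 \<le> j" by blast
        then show ?thesis
          using beside[OF r(1) nj(1)] D_sw_D[OF vD e_in_D[OF r(1)]] by cases (auto simp: sw_def)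
      qed
      moreover have "snd (e (j + 2)) < snd v" if "snd (e (j + 2)) < snd (e i)"
      proof -
        have "\<not> i + 2 \<le> j + 2" using distant[of i "j + 2"] that i j by (auto simp: sw_def)
        then have "i = j + 1 \<or> j + 2 + 1 = i \<or> j + 2 + 2 \<le> i" using par by presburger
        then consider "j + 2 = i + 1 \<or> i = j + 2 + 1" | "j + 2 + 2 \<le> i" by fastforce
        then show ?thesis
          using beside[OF r(2) nj(2)] D_sw_D[OF e_in_D[OF r(2)] vD] by cases (auto simp: sw_def)
      qed
      ultimately show ?thesis using False by simp
    qed
  qed
  then show "v \<in> S \<and> e i \<leadsto> v \<and> ?cond" using vS 1 by blast
next
  assume P: "v \<in> S \<and> e i \<leadsto> v \<and> ?cond"
  then have v: "v \<in> S" and iv: "e i \<leadsto> v" and cond: "?cond" by blast+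
  \<comment> \<open>For a minimum \<open>e j\<close> the vertical line comes from inflection point
    \<open>j\<close>, which exists when \<open>j + 2 \<le> n\<close>; the horizontal line in
    \<open>c2\<close> comes from inflection point \<open>j - 2\<close>, which exists when
    \<open>3 \<le> j\<close>.\<close>
  have c1: "fst v < fst (e j)" if "\<not> lr j" "1 \<le> j" "j + 2 \<le> n" "fst (e i) < fst (e j)" for j
    using cond[rule_format, of j] that by auto
  have c2: "snd (e j) < snd v" if "\<not> lr j" "3 \<le> j" "j \<le> n" "snd (e j) < snd (e i)" for j
  proof -
    have e: "j - 2 + 2 = j" "1 \<le> j - 2" using that by auto
    then have "\<not> lr (j - 2)" using that(1) lr_Suc[of "j - 2"] lr_Suc[of "Suc (j - 2)"] by auto
    then show ?thesis using cond[rule_format, of "j - 2"] that e by auto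
  qed
  have ne: "v \<noteq> e i" using iv by (auto simp: nw_def)
  have iS: "i \<in> span v" using iv i by (auto simp: span_def inverted_def)
  note b = span_interval[OF v]
  have lohi: "lo v \<le> i" "i \<le> hi v" using iS b(1) by auto
  have nb: "fst (e i) < fst (e j) \<and> snd (e j) < snd (e i)"
    if "j \<in> {1..n}" "j = i + 1 \<or> i = j + 1" for j
  proof -
    have "e i \<sim> e j" using e_inverted_iff[OF i that(1)] that(2) by auto
    moreover have "\<not> lr j" using that(2) lr by (auto simp: lr_Suc)
    moreover have "e i \<in> S" using e_in i by auto
    ultimately show ?thesis using inverted_rl[OF _ that(1)] by (auto simp: nw_def)
  qed
  have nlr: "\<not> lr j" if "j = i + 1 \<or> i = j + 1" for j using that lr by (auto simp: lr_Suc)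
  have left: "lo v \<le> i - 1" if "2 \<le> i"
  proof (rule ccontr)
    assume "\<not> lo v \<le> i - 1"
    then have low: "i - 1 < lo v" by simp
    have r: "i - 1 \<in> {1..n}" using that i by auto
    have "e (i - 1) \<lless> v" using e_sw_iff[OF v r] low by simp
    moreover have "fst v < fst (e (i - 1))" if "i < n"
      using c1[of "i - 1"] nlr[of "i - 1"] nb[OF r] \<open>2 \<le> i\<close> that by auto
    \<comment> \<open>For \<open>i = n\<close> the assumed bound \<open>n - 1 < lo v\<close> would
      contradict \<open>lo v < hi v\<close> and \<open>hi v \<le> n\<close>.\<close>
    moreover have "i < n" using low b i that by auto
    ultimately show False by (auto simp: sw_def)
  qed
  have right: "i + 1 \<le> hi v" if "i < n"
  proof (rule ccontr)
    assume "\<not> i + 1 \<le> hi v"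
    then have low: "hi v < i + 1" by simp
    have r: "i + 1 \<in> {1..n}" using that i by auto
    have "v \<lless> e (i + 1)" using sw_e_iff[OF v r] low by simp
    moreover have "snd (e (i + 1)) < snd v" if "2 \<le> i"
      using c2[of "i + 1"] nlr[of "i + 1"] nb[OF r] \<open>i < n\<close> that by auto
    moreover have "2 \<le> i" using low b i that by auto
    ultimately show False by (auto simp: sw_def)
  qed
  have first: "hi v \<le> 2" if "i = 1"
  proof (rule ccontr)
    assume "\<not> hi v \<le> 2"
    then have "3 \<in> span v" using b lohi that by auto
    moreover have l3: "lr 3" using lr that by (simp add: lr_Suc numeral_3_eq_3)
    ultimately have "v = e 3 \<or> e 3 \<leadsto> v" using inverted_lr[OF v, of 3] by (auto simp: span_def)
    then have "fst (e 3) \<le> fst v" by (auto simp: nw_def)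
    moreover have "fst v < fst (e 3)"
      using cond[rule_format, of 1] lr that distant[of 1 3] four
        by (auto simp: sw_def numeral_3_eq_3)
    ultimately show False by simp
  qed
  have last: "n - 1 \<le> lo v" if "i = n"
  proof (rule ccontr)
    assume "\<not> n - 1 \<le> lo v"
    then have "n - 2 \<in> span v" using b lohi that four by auto
    moreover have n2: "n - 2 + 2 = n" using four by simp
    then have l: "lr (n - 2)" using lr that lr_Suc[of "n - 2"] lr_Suc[of "Suc (n - 2)"] by auto
    ultimately have "v = e (n - 2) \<or> e (n - 2) \<leadsto> v" using inverted_lr[OF v, of "n - 2"]
      by (auto simp: span_def)
    then have "snd v \<le> snd (e (n - 2))" by (auto simp: nw_def)
    moreover have "e (n - 2) \<lless> e n" using four by (intro distant) auto
    then have "snd (e (n - 2)) < snd v"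
      using cond[rule_format, of "n - 2", unfolded n2] l that four by (simp add: sw_def)
    ultimately show False by simp
  qed
  consider "i = 1" | "i = n" | "2 \<le> i" "i < n" using i by fastforce
  then have "lo v = max 1 (i - 1) \<and> hi v = min n (i + 1)"
  proof cases
    case 1
    then show ?thesis using first right b(2-5) lohi four by simp
  next
    case 2
    then show ?thesis using last left b(2-5) lohi four by simp
  next
    case 3
    then have "lo v = i - 1" "hi v = i + 1" using left right b(2-5) by linarith+
    then show ?thesis using 3 by simp
  qed
  then show "v \<in> K i" using v ne by (simp add: K_def D_def)
qed

text \<open>The transpose of \<open>in_K_lr_iff\<close>: reflection in the main diagonal exchanges
  the coordinates and the two types of extremal points and reverses the relation
  \<open>\<leadsto>\<close>.\<close>

lemma in_K_rl_iff:
  assumes i: "i \<in> {1..n}" and lr: "\<not> lr i"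
  shows "v \<in> K i \<longleftrightarrow> v \<in> S \<and> v \<leadsto> e i \<and> (\<forall>j. 1 \<le> j \<and> j + 2 \<le> n \<longrightarrow>
    (if \<not> lr j
     then (snd (e i) < snd (e (j + 2)) \<longrightarrow> snd v < snd (e (j + 2))) \<and> (fst (e j) < fst (e i) \<longrightarrow>
       fst (e j) < fst v)
     else (snd (e i) < snd (e j) \<longrightarrow> snd v < snd (e j)) \<and>
       (fst (e (j + 2)) < fst (e i) \<longrightarrow> fst (e (j + 2)) < fst v)))" (is "_ \<longleftrightarrow> v \<in> S \<and> _ \<and> ?cond")
proof
  assume v: "v \<in> K i"
  note vD = K_D[OF v]
  note vS = D_S[OF vD]
  have "v \<noteq> e i" using v by (simp add: K_def)
  then have "v \<sim> e i" using D_inverted_e[OF vD i i] by simp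
  then have 1: "v \<leadsto> e i" using inverted_rl[OF vS i] lr by blast
  have beside: "snd v < snd (e j) \<and> fst (e j) < fst v"
    if "j \<in> {1..n}" "lr j" "j = i + 1 \<or> i = j + 1" for j
    using D_inverted_e_other(1)[OF vD that(1) i] that inverted_lr[OF vS that(1)]
    by (auto simp: nw_def)
  have "if \<not> lr j
     then (snd (e i) < snd (e (j + 2)) \<longrightarrow> snd v < snd (e (j + 2))) \<and> (fst (e j) < fst (e i) \<longrightarrow>
       fst (e j) < fst v)
     else (snd (e i) < snd (e j) \<longrightarrow> snd v < snd (e j)) \<and>
       (fst (e (j + 2)) < fst (e i) \<longrightarrow> fst (e (j + 2)) < fst v)" if j: "1 \<le> j" "j + 2 \<le> n" for j
  proof -
    have r: "j \<in> {1..n}" "j + 2 \<in> {1..n}" using j by auto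
    show ?thesis
    proof (cases "\<not> lr j")
      case True
      then have par: "even (i + j)" using lr by (auto simp: lr_iff[of i] lr_iff[of j])
      have "snd v < snd (e (j + 2))" if "snd (e i) < snd (e (j + 2))"
      proof -
        have "\<not> j + 2 + 2 \<le> i" using distant[of "j + 2" i] that i by (auto simp: sw_def)
        moreover have "j + 2 \<noteq> i" using that by auto
        ultimately have "i \<le> j" using par by presburger
        then show ?thesis using D_sw_D[OF vD e_in_D[OF r(2)]] by (auto simp: sw_def)
      qed
      moreover have "fst (e j) < fst v" if "fst (e j) < fst (e i)"
      proof -
        have "\<not> i + 2 \<le> j" using distant[of i j] that i j by (auto simp: sw_def)
        moreover have "j \<noteq> i" using that by auto
        ultimately have "j + 2 \<le> i" using par by presburger
        then show ?thesis using D_sw_D[OF e_in_D[OF r(1)] vD] by (auto simp: sw_def)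
      qed
      ultimately show ?thesis using True by simp
    next
      case False
      then have par: "odd (i + j)" using lr by (auto simp: lr_iff[of i] lr_iff[of j])
      have nj: "lr j" "lr (j + 2)" using False by (simp_all add: lr_Suc)
      have "snd v < snd (e j)" if "snd (e i) < snd (e j)"
      proof -
        have "\<not> j + 2 \<le> i" using distant[of "j" i] that i j by (auto simp: sw_def)
        then have "j = i + 1 \<or> i = j + 1 \<or> i + 2 \<le> j" using par by presburger
        then consider "j = i + 1 \<or> i = j + 1" | "i + 2 \<le> j" by blast
        then show ?thesis
          using beside[OF r(1) nj(1)] D_sw_D[OF vD e_in_D[OF r(1)]] by cases (auto simp: sw_def)
      qed
      moreover have "fst (e (j + 2)) < fst v" if "fst (e (j + 2)) < fst (e i)"
      proof -
        have "\<not> i + 2 \<le> j + 2" using distant[of i "j + 2"] that i j by (auto simp: sw_def)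
        then have "i = j + 1 \<or> j + 2 + 1 = i \<or> j + 2 + 2 \<le> i" using par by presburger
        then consider "j + 2 = i + 1 \<or> i = j + 2 + 1" | "j + 2 + 2 \<le> i" by fastforce
        then show ?thesis
          using beside[OF r(2) nj(2)] D_sw_D[OF e_in_D[OF r(2)] vD] by cases (auto simp: sw_def)
      qed
      ultimately show ?thesis using False by simp
    qed
  qed
  then show "v \<in> S \<and> v \<leadsto> e i \<and> ?cond" using vS 1 by blast
next
  assume P: "v \<in> S \<and> v \<leadsto> e i \<and> ?cond"
  then have v: "v \<in> S" and iv: "v \<leadsto> e i" and cond: "?cond" by blast+
  have c1: "snd v < snd (e j)" if "lr j" "1 \<le> j" "j + 2 \<le> n" "snd (e i) < snd (e j)" for j
    using cond[rule_format, of j] that by auto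
  have c2: "fst (e j) < fst v" if "lr j" "3 \<le> j" "j \<le> n" "fst (e j) < fst (e i)" for j
  proof -
    have e: "j - 2 + 2 = j" "1 \<le> j - 2" using that by auto
    then have "lr (j - 2)" using that(1) lr_Suc[of "j - 2"] lr_Suc[of "Suc (j - 2)"] by auto
    then show ?thesis using cond[rule_format, of "j - 2"] that e by auto
  qed
  have ne: "v \<noteq> e i" using iv by (auto simp: nw_def)
  have iS: "i \<in> span v" using iv i by (auto simp: span_def inverted_def)
  note b = span_interval[OF v]
  have lohi: "lo v \<le> i" "i \<le> hi v" using iS b(1) by auto
  have nb: "snd (e i) < snd (e j) \<and> fst (e j) < fst (e i)"
    if "j \<in> {1..n}" "j = i + 1 \<or> i = j + 1" for j
  proof -
    have "e i \<sim> e j" using e_inverted_iff[OF i that(1)] that(2) by auto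
    moreover have "lr j" using that(2) lr by (auto simp: lr_Suc)
    moreover have "e i \<in> S" using e_in i by auto
    ultimately show ?thesis using inverted_lr[OF _ that(1)] by (auto simp: nw_def)
  qed
  have nlr: "lr j" if "j = i + 1 \<or> i = j + 1" for j using that lr by (auto simp: lr_Suc)
  have left: "lo v \<le> i - 1" if "2 \<le> i"
  proof (rule ccontr)
    assume "\<not> lo v \<le> i - 1"
    then have low: "i - 1 < lo v" by simp
    have r: "i - 1 \<in> {1..n}" using that i by auto
    have "e (i - 1) \<lless> v" using e_sw_iff[OF v r] low by simp
    moreover have "snd v < snd (e (i - 1))" if "i < n"
      using c1[of "i - 1"] nlr[of "i - 1"] nb[OF r] \<open>2 \<le> i\<close> that by auto
    moreover have "i < n" using low b i that by auto
    ultimately show False by (auto simp: sw_def)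
  qed
  have right: "i + 1 \<le> hi v" if "i < n"
  proof (rule ccontr)
    assume "\<not> i + 1 \<le> hi v"
    then have low: "hi v < i + 1" by simp
    have r: "i + 1 \<in> {1..n}" using that i by auto
    have "v \<lless> e (i + 1)" using sw_e_iff[OF v r] low by simp
    moreover have "fst (e (i + 1)) < fst v" if "2 \<le> i"
      using c2[of "i + 1"] nlr[of "i + 1"] nb[OF r] \<open>i < n\<close> that by auto
    moreover have "2 \<le> i" using low b i that by auto
    ultimately show False by (auto simp: sw_def)
  qed
  have first: "hi v \<le> 2" if "i = 1"
  proof (rule ccontr)
    assume "\<not> hi v \<le> 2"
    then have "3 \<in> span v" using b lohi that by auto
    moreover have l3: "\<not> lr 3" using lr that by (simp add: lr_Suc numeral_3_eq_3)
    ultimately have "v = e 3 \<or> v \<leadsto> e 3" using inverted_rl[OF v, of 3] by (auto simp: span_def)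
    then have "snd (e 3) \<le> snd v" by (auto simp: nw_def)
    moreover have "snd v < snd (e 3)"
      using cond[rule_format, of 1] lr that distant[of 1 3] four
        by (auto simp: sw_def numeral_3_eq_3)
    ultimately show False by simp
  qed
  have last: "n - 1 \<le> lo v" if "i = n"
  proof (rule ccontr)
    assume "\<not> n - 1 \<le> lo v"
    then have "n - 2 \<in> span v" using b lohi that four by auto
    moreover have n2: "n - 2 + 2 = n" using four by simp
    then have l: "\<not> lr (n - 2)" using lr that lr_Suc[of "n - 2"] lr_Suc[of "Suc (n - 2)"] by auto
    ultimately have "v = e (n - 2) \<or> v \<leadsto> e (n - 2)" using inverted_rl[OF v, of "n - 2"]
      by (auto simp: span_def)
    then have "fst v \<le> fst (e (n - 2))" by (auto simp: nw_def)
    moreover have "e (n - 2) \<lless> e n" using four by (intro distant) auto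
    then have "fst (e (n - 2)) < fst v"
      using cond[rule_format, of "n - 2", unfolded n2] l that four by (simp add: sw_def)
    ultimately show False by simp
  qed
  consider "i = 1" | "i = n" | "2 \<le> i" "i < n" using i by fastforce
  then have "lo v = max 1 (i - 1) \<and> hi v = min n (i + 1)"
  proof cases
    case 1
    then show ?thesis using first right b(2-5) lohi four by simp
  next
    case 2
    then show ?thesis using last left b(2-5) lohi four by simp
  next
    case 3
    then have "lo v = i - 1" "hi v = i + 1" using left right b(2-5) by linarith+
    then show ?thesis using 3 by simp
  qed
  then show "v \<in> K i" using v ne by (simp add: K_def D_def)
qed

text \<open>Two of the four bounds come from \<open>e k\<close> and \<open>e (k + 3)\<close>, which
  enclose \<open>v\<close>; the other two come from the inversions with \<open>e (k + 1)\<close> and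
  \<open>e (k + 2)\<close>. Conversely the bounds leave only these two indices for the span, which
  has at least two elements.\<close>

lemma in_C_iff:
  assumes k: "1 \<le> k" "k + 3 \<le> n"
  shows "v \<in> C k \<longleftrightarrow> v \<in> S \<and> (if lr k
    then fst (e (k + 2)) < fst v \<and> fst v < fst (e (k + 1)) \<and> snd (e k) < snd v \<and>
      snd v < snd (e (k + 3))
    else fst (e k) < fst v \<and> fst v < fst (e (k + 3)) \<and> snd (e (k + 2)) < snd v \<and>
      snd v < snd (e (k + 1)))"
    (is "_ \<longleftrightarrow> v \<in> S \<and> ?cond")
proof
  have r: "k \<in> {1..n}" "k + 1 \<in> {1..n}" "k + 2 \<in> {1..n}" "k + 3 \<in> {1..n}" using k by auto
  assume v: "v \<in> C k"
  note vS = C_S[OF v]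
  have "e k \<lless> v" "v \<lless> e (k + 3)"
    using D_sw_C[OF e_in_D[OF r(1)] v] C_sw_D[OF v e_in_D[OF r(4)]] by auto
  moreover have "v \<sim> e (k + 1)" "v \<sim> e (k + 2)" using C_inverted_e[OF v k] by auto
  then have "if lr k then v \<leadsto> e (k + 1) \<and> e (k + 2) \<leadsto> v else e (k + 1) \<leadsto> v \<and> v \<leadsto> e (k + 2)"
    using inverted_lr[OF vS r(2)] inverted_lr[OF vS r(3)] inverted_rl[OF vS r(2)] inverted_rl[OF
      vS r(3)]
    by (auto simp: lr_Suc)
  ultimately show "v \<in> S \<and> ?cond" using vS by (auto simp: sw_def nw_def)
next
  have r: "k \<in> {1..n}" "k + 3 \<in> {1..n}" using k by auto
  assume P: "v \<in> S \<and> ?cond"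
  then have v: "v \<in> S" and c: ?cond by blast+
  have S: "e k \<in> S" "e (k + 3) \<in> S" using r e_in by auto
  have lr3: "lr (k + 3) = (\<not> lr k)" by (simp add: lr_Suc numeral_3_eq_3)
  have "e k \<lless> v"
    by (rule trichotomy[OF v S(1)])
      (use c inverted_lr[OF v r(1)] inverted_rl[OF v r(1)] in \<open>auto simp: sw_def nw_def split:
        if_splits\<close>)
  moreover have "v \<lless> e (k + 3)"
    by (rule trichotomy[OF v S(2)])
      (use c lr3 inverted_lr[OF v r(2)] inverted_rl[OF v r(2)] in \<open>auto simp: sw_def nw_def
        split: if_splits\<close>)
  ultimately have "k < lo v" "hi v < k + 3" using e_sw_iff[OF v r(1)] sw_e_iff[OF v r(2)]
    by simp_all
  then show "v \<in> C k" using span_interval(2-5)[OF v] v by (auto simp: C_def)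
qed

section \<open>From decreasing cells to the absence of claws and squares\<close>

definition central_decreasing :: bool where
  "central_decreasing \<longleftrightarrow> (\<forall>k. 1 \<le> k \<and> k + 3 \<le> n \<and> C k \<noteq> {} \<longrightarrow>
     clique (K (k + 1) \<union> C k \<union> K (k + 2)))"

lemma clique_block:
  assumes "central_decreasing" "1 \<le> k" "k + 3 \<le> n" "C k \<noteq> {}"
  shows "clique (D (k + 1) \<union> C k \<union> D (k + 2))"
proof -
  have cl: "clique (K (k + 1) \<union> C k \<union> K (k + 2))"
    using assms unfolding central_decreasing_def by blast
  then have "clique (K (k + 1) \<union> K (Suc (k + 1)))"
    by (elim clique_subset) auto
  then have 1: "clique (D (k + 1) \<union> D (k + 2))"
    using clique_D_Un_D[of "k + 1"] assms(3) by simp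
  have 2: "u \<sim> c" if "u \<in> D (k + 1) \<union> D (k + 2)" "c \<in> C k" for u c
  proof (cases "u = e (k + 1) \<or> u = e (k + 2)")
    case True
    then show ?thesis using C_inverted_e[OF that(2) assms(2,3)] inverted_sym by auto
  next
    case False
    then have "u \<in> K (k + 1) \<union> C k \<union> K (k + 2)" "u \<notin> C k"
      using that assms(2,3) by (auto simp: K_def D_def C_def min_def max_def split: if_splits)
    moreover have "c \<in> K (k + 1) \<union> C k \<union> K (k + 2)" using that by blast
    ultimately show ?thesis using cliqueD[OF cl] that(2) by blast
  qed
  have 3: "clique (C k)" using cl by (elim clique_subset) auto
  show ?thesis unfolding clique_def
  proof (intro ballI impI)
    fix p q assume "p \<in> D (k + 1) \<union> C k \<union> D (k + 2)" "q \<in> D (k + 1) \<union> C k \<union> D (k + 2)" "p \<noteq> q"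
    then show "p \<sim> q" using cliqueD[OF 1, of p q] cliqueD[OF 3, of p q] 2[of p q] 2[of q p]
      inverted_sym[of p q] by blast
  qed
qed

text \<open>All neighbours of a central entry lie in one block of two corner cells around its own
  cell, and this block is a clique. Hence such an entry is neither the centre of a claw nor a vertex
  of a square.\<close>

lemma C_neighbourhood_clique:
  assumes "central_decreasing" "1 \<le> k" "k + 3 \<le> n" "v \<in> C k"
    and "a \<in> S" "b \<in> S" "v \<sim> a" "v \<sim> b" "a \<noteq> b"
  shows "a \<sim> b"
proof -
  have "w \<in> D (k + 1) \<union> C k \<union> D (k + 2)" if w: "w \<in> S" "v \<sim> w" for w
    using w(1)
  proof (cases rule: cells_cover)
    case (1 i) then show ?thesis using D_inverted_C[OF 1(2) assms(4)] w inverted_sym by auto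
  next
    case (2 j) then show ?thesis using C_inverted_C[OF assms(4) 2(3) w(2)] by auto
  qed
  then show ?thesis using clique_block[OF assms(1-3)] assms cliqueD by blast
qed

text \<open>For a centre in \<open>D i\<close> the neighbours lie in three cliques:
  \<open>D i\<close> itself, and \<open>L\<close> and \<open>R\<close>, each a neighbouring corner
  class together with the central cell next to it. A claw needs one leaf in each, which
  \<open>one\<close> forbids.\<close>

lemma claw_free_if:
  assumes cK: "\<And>i. i \<in> {1..n} \<Longrightarrow> clique (K i)"
    and cd: "central_decreasing"
    and one: "\<And>i. \<lbrakk>1 \<le> i; i + 2 \<le> n\<rbrakk> \<Longrightarrow>
      clique (K i \<union> K (i + 1)) \<or> clique (K (i + 1) \<union> K (i + 2))"
  shows "claw_free S"
  unfolding claw_free_def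
proof (intro ballI notI)
  fix v a b c
  assume S: "v \<in> S" "a \<in> S" "b \<in> S" "c \<in> S"
    and claw: "a \<lless> b \<and> b \<lless> c \<and> v \<sim> a \<and> v \<sim> b \<and> v \<sim> c"
  have ab: "\<not> a \<sim> b" "a \<noteq> b" "\<not> b \<sim> c" "b \<noteq> c" "\<not> a \<sim> c" "a \<noteq> c"
    "\<not> b \<sim> a" "\<not> c \<sim> b" "\<not> c \<sim> a"
    using claw sw_not_inverted sw_trans not_sw_self by metis+
  show False using S(1)
  proof (cases rule: cells_cover)
    case (2 k)
    then show False using C_neighbourhood_clique[OF cd 2 S(2,3)] ab claw by blast
  next
    case (1 i)
    define L where "L = (if 2 \<le> i then D (i - 1) else {}) \<union> (if 3 \<le> i \<and>
      i < n then C (i - 2) else {})"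
    define R where "R = (if i < n then D (i + 1) else {}) \<union> (if 2 \<le> i \<and>
      i + 2 \<le> n then C (i - 1) else {})"
    have clique_D_all: "clique (D i)" if "i \<in> {1..n}" for i using clique_D cK that by blast
    have classify: "w \<in> L \<union> D i \<union> R" if w: "w \<in> S" "v \<sim> w" for w
      using w(1)
    proof (cases rule: cells_cover)
      case j: (1 j)
      have "i \<le> j + 1" "j \<le> i + 1" using D_inverted_D[OF 1(2) j(2) w(2)] .
      then have "j = i - 1 \<and> 2 \<le> i \<or> j = i \<or> j = i + 1 \<and> i < n" using j(1) 1(1) by auto
      then show ?thesis using j(2) by (auto simp: L_def R_def)
    next
      case k: (2 k)
      have "i = k + 1 \<or> i = k + 2" using D_inverted_C[OF 1(2) k(3) w(2)] .
      then show ?thesis using k by (auto simp: L_def R_def)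
    qed
    have C_L: "clique (D (i - 1) \<union> C (i - 2) \<union> D i)" if "3 \<le> i" "i < n" "C (i - 2) \<noteq> {}"
    proof -
      have "i - 2 + 1 = i - 1" "i - 2 + 2 = i" using that by auto
      then show ?thesis using clique_block[OF cd, of "i - 2"] that by auto
    qed
    have C_R: "clique (D i \<union> C (i - 1) \<union> D (i + 1))" if "2 \<le> i" "i + 2 \<le> n" "C (i - 1) \<noteq> {}"
    proof -
      have "i - 1 + 1 = i" "i - 1 + 2 = i + 1" using that by auto
      then show ?thesis using clique_block[OF cd, of "i - 1"] that by auto
    qed
    have "clique L"
    proof (cases "3 \<le> i \<and> i < n \<and> C (i - 2) \<noteq> {}")
      case True then show ?thesis using C_L unfolding L_def by (auto intro: clique_subset)
    next
      case False
      then have "L = (if 2 \<le> i then D (i - 1) else {})" by (auto simp: L_def)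
      then show ?thesis using clique_D_all[of "i - 1"] 1(1) by fastforce
    qed
    have "clique R"
    proof (cases "2 \<le> i \<and> i + 2 \<le> n \<and> C (i - 1) \<noteq> {}")
      case True then show ?thesis using C_R unfolding R_def by (auto intro: clique_subset)
    next
      case False
      then have "R = (if i < n then D (i + 1) else {})" by (auto simp: R_def)
      then show ?thesis using clique_D_all[of "i + 1"] 1(1) by fastforce
    qed
    \<comment> \<open>A leaf in the central part of \<open>L\<close> or \<open>R\<close> would share
      a clique with the leaf in \<open>D i\<close>. So the outer leaves lie in
      \<open>D (i - 1)\<close> and \<open>D (i + 1)\<close>, and both pairs of consecutive corner
      cells fail to be decreasing.\<close>
    have "False" if h: "u \<in> L" "w \<in> D i" "z \<in> R" "\<not> u \<sim> w" "\<not> w \<sim> z" "u \<noteq> w" "w \<noteq> z" for u w z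
    proof -
      have u: "u \<in> D (i - 1)" "2 \<le> i"
        using h C_L cliqueD[of "D (i - 1) \<union> C (i - 2) \<union> D i" u w]
        by (auto simp: L_def split: if_splits)
      have z: "z \<in> D (i + 1)" "i < n"
        using h C_R cliqueD[of "D i \<union> C (i - 1) \<union> D (i + 1)" w z]
        by (auto simp: R_def split: if_splits)
      have e: "Suc (i - 1) = i" "i - 1 + 2 = i + 1" "i - 1 + 1 = i" using u by auto
      have "\<not> clique (K (i - 1) \<union> K i)"
        using clique_D_Un_D[of "i - 1"] u(2) z(2) e cliqueD[of "D (i - 1) \<union> D i" u w] h u(1) by auto
      moreover have "\<not> clique (K i \<union> K (i + 1))"
        using clique_D_Un_D[of "i"] u(2) z(2) cliqueD[of "D i \<union> D (Suc i)" w z] h z(1) by auto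
      ultimately show False using one[of "i - 1"] u(2) z(2) e by fastforce
    qed
    then have noL: "\<not> (x \<in> L \<and> y \<in> D i \<and> z \<in> R)"
      if "\<not> x \<sim> y" "\<not> y \<sim> z" "x \<noteq> y" "y \<noteq> z" for x y z using that by blast
    have cls: "a \<in> L \<union> D i \<union> R" "b \<in> L \<union> D i \<union> R" "c \<in> L \<union> D i \<union> R"
      using classify S claw by blast+
    have sep: "\<not> (x \<in> X \<and> y \<in> X)" if "clique X" "\<not> x \<sim> y" "x \<noteq> y" for x y X
      using that cliqueD by blast
    note L = \<open>clique L\<close> and R = \<open>clique R\<close> and M = clique_D_all[OF 1(1)]
    note nl = sep[OF L ab(1,2)] sep[OF L ab(3,4)] sep[OF L ab(5,6)]
      sep[OF M ab(1,2)] sep[OF M ab(3,4)] sep[OF M ab(5,6)]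
      sep[OF R ab(1,2)] sep[OF R ab(3,4)] sep[OF R ab(5,6)]
    note ne = ab(2,4,6) ab(2)[symmetric] ab(4)[symmetric] ab(6)[symmetric]
    \<comment> \<open>The order of the leaves along the claw says nothing about which clique holds
      which leaf, hence the six instances of \<open>noL\<close>, one for each assignment.\<close>
    show False
      using cls nl noL[OF ab(1,3) ab(2,4)] noL[OF ab(5,8) ne(3,5)] noL[OF ab(7,5) ne(4,3)]
        noL[OF ab(3,9) ne(2,6)] noL[OF ab(9,1) ne(6,1)] noL[OF ab(8,7) ne(5,4)] by blast
  qed
qed

text \<open>Every vertex of a square has two non-inverted neighbours, so none is central. Increasing
  pairs raise the corner index and inverted pairs keep it within one, which leaves both diagonals
  running from \<open>D i\<close> to \<open>D (Suc i)\<close>; there inversions are comparisons of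
  keys.\<close>

lemma square_free_if:
  assumes cK: "\<And>i. i \<in> {1..n} \<Longrightarrow> clique (K i)"
    and cd: "central_decreasing"
  shows "square_free S"
  unfolding square_free_def
proof (intro ballI notI)
  fix a b c d
  assume S: "a \<in> S" "b \<in> S" "c \<in> S" "d \<in> S"
    and sq: "a \<lless> b \<and> c \<lless> d \<and> a \<sim> c \<and> a \<sim> d \<and> b \<sim> c \<and> b \<sim> d"
  have nab: "a \<noteq> b" "c \<noteq> d" "\<not> a \<sim> b" "\<not> c \<sim> d"
    using sq sw_not_inverted not_sw_self by metis+
  have inD: "\<exists>i\<in>{1..n}. v \<in> D i"
    if "v \<in> S" "x \<in> S" "y \<in> S" "v \<sim> x" "v \<sim> y" "x \<noteq> y" "\<not> x \<sim> y" for v x y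
    using that(1)
  proof (cases rule: cells_cover)
    case (1 i) then show ?thesis by blast
  next
    case (2 k) then show ?thesis using C_neighbourhood_clique[OF cd 2 that(2-6)] that(7) by blast
  qed
  obtain i where i: "i \<in> {1..n}" "a \<in> D i" using inD[of a c d] S sq nab by blast
  obtain j where j: "j \<in> {1..n}" "b \<in> D j" using inD[of b c d] S sq nab by blast
  obtain p where p: "p \<in> {1..n}" "c \<in> D p"
    using inD[of c a b] S sq nab inverted_sym by metis
  obtain q where q: "q \<in> {1..n}" "d \<in> D q"
    using inD[of d a b] S sq nab inverted_sym by metis
  have less: "i < j" if "i \<in> {1..n}" "j \<in> {1..n}" "a \<in> D i" "b \<in> D j" "a \<lless> b" for i j a b
  proof (rule ccontr)
    assume "\<not> i < j"
    then consider "i = j" | "i = Suc j" | "j + 2 \<le> i" by linarith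
    then show False
    proof cases
      case 1
      then show False using clique_D cK that sw_not_inverted cliqueD not_sw_self by metis
    next
      case 2
      then show False using D_next(3)[of b j a] that sw_not_inverted sw_asym by auto
    next
      case 3
      then show False using D_sw_D[of b j a i] that sw_asym by blast
    qed
  qed
  have "i < j" "p < q" using less i j p q sq by blast+
  moreover have "p \<le> i + 1" "i \<le> p + 1" "q \<le> i + 1" "j \<le> p + 1"
    using D_inverted_D[of a i c p] D_inverted_D[of a i d q] D_inverted_D[of b j c p]
      i j p q sq by auto
  ultimately have eq: "p = i" "j = Suc i" "q = Suc i" "i < n" "1 \<le> i" using i j by auto
  \<comment> \<open>The four relations close up to the cycle \<open>a\<close>, \<open>b\<close>,
    \<open>c\<close>, \<open>d\<close>, \<open>a\<close> of strictly growing keys.\<close>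
  have "key i a < key i b" "key i c < key i d" "key i d < key i a" "key i b < key i c"
    using D_next(1)[of a i b] D_next(1)[of c i d] D_next(2)[of a i d] D_next(2)[of c i b]
      i j p q sq eq inverted_sym[of b c] by auto
  then show False by simp
qed

end

subsection \<open>Claw-free zigzags\<close>

locale claw_free_zigzag = zigzag +
  assumes claw_free: "claw_free S" and twin_free: "twin_free S"
begin

text \<open>An increasing pair in \<open>K i\<close> forms a claw centred at
  \<open>e (i - 1)\<close> with third leaf \<open>e (i - 2)\<close>; near the left end the mirror
  image with \<open>e (i + 1)\<close> and \<open>e (i + 2)\<close> is used.\<close>

lemma clique_K:
  assumes i: "i \<in> {1..n}"
  shows "clique (K i)"
proof -
  have False if u: "u \<in> K i" and v: "v \<in> K i" and uv: "u \<lless> v" for u v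
  proof -
    note D = K_D[OF u] K_D[OF v]
    note S = D_S[OF D(1)] D_S[OF D(2)]
    show False
    proof (cases "3 \<le> i")
      case True
      then have r: "i - 2 \<in> {1..n}" "i - 1 \<in> {1..n}" "Suc (i - 2) = i - 1" "i - 2 + 2 = i"
        using i by auto
      have "e (i - 1) \<sim> u" "e (i - 1) \<sim> v"
        using D_inverted_e_other(2)[OF D(1) r(2) i] D_inverted_e_other(2)[OF D(2) r(2) i] True
        by simp_all
      moreover have "e (i - 1) \<sim> e (i - 2)"
        using D_inverted_e_other(2)[OF e_in_D[OF r(1)] r(2) r(1)] r(3) by simp
      moreover have "e (i - 2) \<lless> u" using D_sw_D[OF e_in_D[OF r(1)] D(1)] r(4) by simp
      ultimately show False
        using no_claw[OF claw_free, of "e (i - 1)" "e (i - 2)" u v] S uv e_in r by auto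
    next
      case False
      \<comment> \<open>Now \<open>i \<le> 2\<close>, so \<open>e (i + 2)\<close> exists because of
        \<open>four\<close>.\<close>
      then have r: "i + 2 \<in> {1..n}" "i + 1 \<in> {1..n}" using i four by auto
      have "e (i + 1) \<sim> u" "e (i + 1) \<sim> v"
        using D_inverted_e_other(2)[OF D(1) r(2) i] D_inverted_e_other(2)[OF D(2) r(2) i]
        by simp_all
      moreover have "e (i + 1) \<sim> e (i + 2)" using adjacent[of "i + 1"] r by simp
      moreover have "v \<lless> e (i + 2)" using D_sw_D[OF D(2) e_in_D[OF r(1)]] by simp
      ultimately show False
        using no_claw[OF claw_free, of "e (i + 1)" u v "e (i + 2)"] S uv e_in r by auto
    qed
  qed
  then show ?thesis unfolding clique_def using trichotomy K_D D_S by metis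
qed

lemma clique_D_all: "i \<in> {1..n} \<Longrightarrow> clique (D i)"
  by (rule clique_D[OF _ clique_K])

text \<open>If \<open>u\<close> and \<open>c\<close> were increasing in either order, the extremal
  point next to \<open>e i\<close> inside the span of \<open>c\<close> would be the centre of a claw
  whose third leaf is the enclosing point \<open>e (k + 3)\<close> or \<open>e k\<close>.\<close>

lemma D_inverted_C_all:
  assumes "1 \<le> k" "k + 3 \<le> n" "c \<in> C k" "u \<in> D i" "i = k + 1 \<or> i = k + 2"
  shows "u \<sim> c"
proof -
  have r: "k \<in> {1..n}" "k + 1 \<in> {1..n}" "k + 2 \<in> {1..n}" "k + 3 \<in> {1..n}" "i \<in> {1..n}"
    using assms by auto
  note S = C_S[OF assms(3)] D_S[OF assms(4)]
  have ec: "e (k + 1) \<sim> c" "e (k + 2) \<sim> c"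
    using C_inverted_e[OF assms(3,1,2)] inverted_sym by auto
  have ne: "u \<noteq> c" using assms by (auto simp: D_def C_def min_def max_def split: if_splits)
  have no: False if uc: "x \<lless> y" and xy: "x = u \<and> y = c \<or> x = c \<and> y = u" for x y
  proof (cases "i = k + 1")
    case True
    then have "u \<lless> e (k + 3)" using D_sw_D[OF assms(4) e_in_D[OF r(4)]] by simp
    moreover have "c \<lless> e (k + 3)" using C_sw_D[OF assms(3) e_in_D[OF r(4)]] by simp
    moreover have "e (k + 2) \<sim> u"
      using D_inverted_e_other(2)[OF assms(4) r(3) r(5)] True by simp
    moreover have "e (k + 2) \<sim> e (k + 3)" using adjacent[of "k + 2"] r by (simp add: numeral_3_eq_3)
    ultimately show False
      using no_claw[OF claw_free, of "e (k + 2)" x y "e (k + 3)"] S ec e_in r uc xy by auto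
  next
    case False
    then have i: "i = k + 2" using assms by simp
    then have "e k \<lless> u" using D_sw_D[OF e_in_D[OF r(1)] assms(4)] by simp
    moreover have "e k \<lless> c" using D_sw_C[OF e_in_D[OF r(1)] assms(3)] by simp
    moreover have "e (k + 1) \<sim> u"
      using D_inverted_e_other(2)[OF assms(4) r(2) r(5)] i by simp
    moreover have "e (k + 1) \<sim> e k" using adjacent[of "k"] r inverted_sym by simp
    ultimately show False
      using no_claw[OF claw_free, of "e (k + 1)" "e k" x y] S ec e_in r uc xy by auto
  qed
  show ?thesis using trichotomy[OF S(2) S(1)] ne no by blast
qed

lemma clique_C:
  assumes "1 \<le> k" "k + 3 \<le> n"
  shows "clique (C k)"
proof -
  have r: "k \<in> {1..n}" "k + 1 \<in> {1..n}" using assms by auto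
  have False if u: "u \<in> C k" and v: "v \<in> C k" and uv: "u \<lless> v" for u v
  proof -
    have "e k \<lless> u" using D_sw_C[OF e_in_D[OF r(1)] u] by simp
    moreover have "e (k + 1) \<sim> e k" "e (k + 1) \<sim> u" "e (k + 1) \<sim> v"
      using adjacent[of "k"] r C_inverted_e[OF u assms] C_inverted_e[OF v assms] inverted_sym
        by auto
    ultimately show False
      using no_claw[OF claw_free, of "e (k + 1)" "e k" u v] C_S[OF u] C_S[OF v] e_in r uv by auto
  qed
  then show ?thesis unfolding clique_def using trichotomy C_S by metis
qed

text \<open>A single central entry suffices: it is inverted with both neighbouring corner classes,
  and \<open>C_transitive\<close> carries this over to the pairs between them.\<close>

lemma C_clique_D_Un_D:
  assumes "1 \<le> k" "k + 3 \<le> n" "C k \<noteq> {}"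
  shows "clique (D (k + 1) \<union> C k \<union> D (k + 2))"
proof -
  obtain c where c: "c \<in> C k" using assms by blast
  have 1: "u \<sim> v" if "u \<in> D (k + 1)" "v \<in> D (k + 2)" for u v
    using C_transitive[OF that(1) c that(2) assms(1,2)] D_inverted_C_all[OF assms(1,2) c] that
      by blast
  have 2: "u \<sim> w" if "u \<in> D (k + 1) \<union> D (k + 2)" "w \<in> C k" for u w
    using D_inverted_C_all[OF assms(1,2) that(2)] that(1) by blast
  have "clique (D (k + 1))" "clique (D (k + 2))" using clique_D_all assms by auto
  then show ?thesis unfolding clique_def
    using 1 2 clique_C[OF assms(1,2), unfolded clique_def] inverted_sym by (metis Un_iff)
qed

(* Only the two neighbouring corner cells are neither uniformly adjacent nor uniformly
   nonadjacent to D i. *)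
lemma distinguish_D:
  assumes i: "i \<in> {1..n}" and p: "p \<in> D i" and q: "q \<in> D i" and ne: "p \<noteq> q"
  obtains r where "2 \<le> i" "r \<in> D (i - 1)" "(r \<sim> p) \<noteq> (r \<sim> q)"
    | r where "i < n" "r \<in> D (i + 1)" "(r \<sim> p) \<noteq> (r \<sim> q)"
proof -
  have "p \<sim> q" using clique_D_all[OF i] p q ne cliqueD by blast
  then obtain r where r: "r \<in> S" "r \<noteq> p" "r \<noteq> q" "(r \<sim> p) \<noteq> (r \<sim> q)"
    using twin_free D_S p q unfolding twin_free_def by metis
  then obtain x where x: "x \<in> D i" "r \<sim> x" using p q by blast
  show ?thesis using r(1)
  proof (cases rule: cells_cover)
    case (1 j)
    have "j \<le> i + 1" "i \<le> j + 1" using D_inverted_D[OF 1(2) x] by auto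
    moreover have "j \<noteq> i" using clique_D_all[OF i] 1 p q r cliqueD by metis
    ultimately have "j = i - 1 \<and> 2 \<le> i \<or> j = i + 1 \<and> i < n" using 1(1) i by auto
    then show ?thesis using that 1(2) r(4) by blast
  next
    case (2 k)
    have "i = k + 1 \<or> i = k + 2" using D_inverted_C[OF x(1) 2(3)] x(2) inverted_sym by blast
    then have "p \<sim> r" "q \<sim> r" using D_inverted_C_all[OF 2] p q by blast+
    then show ?thesis using r(4) inverted_sym by blast
  qed
qed

text \<open>Two entries of one central cell would be twins: every entry inverted with a member of
  \<open>C k\<close> lies in \<open>D (k + 1)\<close>, \<open>D (k + 2)\<close> or
  \<open>C k\<close>, and is inverted with all other members of \<open>C k\<close>.\<close>

lemma card_C_le_1:
  assumes k: "1 \<le> k" "k + 3 \<le> n"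
  shows "card (C k) \<le> 1"
proof (rule ccontr)
  assume "\<not> card (C k) \<le> 1"
  moreover have "finite (C k)" using finite_S by (simp add: C_def)
  ultimately obtain p q where pq: "p \<in> C k" "q \<in> C k" "p \<noteq> q"
    by (metis One_nat_def card_le_Suc0_iff_eq)
  then have "p \<sim> q" using clique_C[OF k] cliqueD by blast
  then obtain r where r: "r \<in> S" "r \<noteq> p" "r \<noteq> q" "(r \<sim> p) \<noteq> (r \<sim> q)"
    using twin_free C_S pq unfolding twin_free_def by metis
  then obtain x where x: "x \<in> C k" "r \<sim> x" using pq by blast
  show False using r(1)
  proof (cases rule: cells_cover)
    case (1 i)
    have "i = k + 1 \<or> i = k + 2" using D_inverted_C[OF 1(2) x] .
    then show False using D_inverted_C_all[OF k pq(1) 1(2)] D_inverted_C_all[OF k pq(2) 1(2)]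
      r(4) by blast
  next
    case (2 j)
    then have "r \<in> C k" using C_inverted_C[OF 2(3) x] by simp
    then show False using clique_C[OF k] pq r cliqueD by metis
  qed
qed

(* If w and w' differ, one of them can be replaced by the other, since the pairs of consecutive cells
   are compared in different coordinates; then e (i + 1) is the centre of a claw. *)
lemma not_both:
  assumes i: "1 \<le> i" "i + 2 \<le> n"
    and u: "u \<in> D i" and w: "w \<in> D (i + 1)" "w' \<in> D (i + 1)" and z: "z \<in> D (i + 2)"
    and uw: "u \<lless> w" and wz: "w' \<lless> z"
  shows False
proof -
  have r: "i \<in> {1..n}" "i + 1 \<in> {1..n}" "i + 2 \<in> {1..n}" using i by auto
  have eu: "e (i + 1) \<sim> u"
    using D_inverted_e_other(2)[OF u r(2) r(1)] by simp
  have ez: "e (i + 1) \<sim> z"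
    using D_inverted_e_other(2)[OF z r(2) r(3)] by simp
  have no: False if "x \<in> D (i + 1)" "u \<lless> x" "x \<lless> z" for x
  proof -
    have "x \<noteq> e (i + 1)" using that eu sw_not_inverted by blast
    then have "e (i + 1) \<sim> x" using D_inverted_e[OF that(1) r(2) r(2)] inverted_sym by auto
    then show False using no_claw[OF claw_free, of "e (i + 1)" u x z] that eu ez u z D_S e_in r
      by auto
  qed
  show False
  proof (cases "w = w'")
    case True
    then show False using no w uw wz by blast
  next
    case False
    then have ww: "w \<sim> w'" using clique_D_all[OF r(2)] w cliqueD by blast
    have z': "z \<in> D (Suc (i + 1))" using z by simp
    note d = D_next(1)[OF u _ i(1), of w] D_next(1)[OF u _ i(1), of w']
      D_next(1)[OF w(1) z'] D_next(1)[OF w(2) z']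
    have "u \<lless> w' \<or> w \<lless> z"
      using d ww w uw wz i lr_Suc[of i]
      by (auto simp: key_def inverted_def nw_def split: if_splits)
    then show False using no w uw wz by blast
  qed
qed

text \<open>One increasing pair between the two cells makes the outer neighbouring cells useless for
  distinguishing entries. Twin-freeness must therefore be witnessed inside the two cells, and
  inversion there is comparison by \<open>key i\<close>, so each distinguishing entry lies strictly
  between the two keys it distinguishes.\<close>

lemma interlace_if:
  assumes i: "1 \<le> i" "i < n" and nc: "\<not> clique (K i \<union> K (i + 1))"
  shows "interlace (K i) (K (i + 1))"
proof -
  have r: "i \<in> {1..n}" "i + 1 \<in> {1..n}" using i by auto
  obtain p q where pq: "p \<in> K i \<union> K (i + 1)" "q \<in> K i \<union> K (i + 1)" "p \<noteq> q" "\<not> p \<sim> q"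
    using nc unfolding clique_def by blast
  have "\<not> (p \<in> K i \<and> q \<in> K i)" "\<not> (p \<in> K (i + 1) \<and> q \<in> K (i + 1))"
    using clique_K r pq cliqueD by blast+
  then obtain u0 v0 where uv0: "u0 \<in> K i" "v0 \<in> K (i + 1)" "\<not> u0 \<sim> v0"
    using pq inverted_sym by blast
  have lt0: "u0 \<lless> v0" using D_next(3)[of u0 i v0] uv0 K_D i by auto
  \<comment> \<open>By \<open>not_both\<close> the pair \<open>u0\<close>, \<open>v0\<close> rules
    out any increasing pair from \<open>D (i - 1)\<close> to \<open>D i\<close>, even one that ends
    in an entry other than \<open>u0\<close>; \<open>nxt\<close> is the same on the other
    side.\<close>
  have prev: "w \<sim> u" if "2 \<le> i" "w \<in> D (i - 1)" "u \<in> D i" for w u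
  proof (rule ccontr)
    assume n: "\<not> w \<sim> u"
    have e: "Suc (i - 1) = i" "i - 1 + 1 = i" "i - 1 + 2 = i + 1" using that(1) by auto
    then have "w \<lless> u" using D_next(3)[of w "i - 1" u] that n i by auto
    then show False
      using not_both[of "i - 1" w u u0 v0] that e uv0 lt0 i K_D by fastforce
  qed
  have nxt: "w \<sim> u" if "i + 1 < n" "w \<in> D (i + 2)" "u \<in> D (i + 1)" for w u
  proof (rule ccontr)
    assume n: "\<not> w \<sim> u"
    then have "u \<lless> w" using D_next(3)[of u "i + 1" w] that inverted_sym by auto
    then show False
      using not_both[of i u0 v0 u w] that uv0 lt0 i K_D by auto
  qed
  let ?f = "key i"
  have lt: "u \<lless> v \<longleftrightarrow> ?f u < ?f v" and inv: "u \<sim> v \<longleftrightarrow> ?f v < ?f u"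
    if "u \<in> D i" "v \<in> D (i + 1)" for u v
    using D_next(1,2)[of u i v] that i by auto
  have dist1: "\<exists>r\<in>K (i + 1). (r \<sim> u) \<noteq> (r \<sim> u')" if u: "u \<in> D i" "u' \<in> D i" "u \<noteq> u'" for u u'
    using distinguish_D[OF r(1) u]
  proof cases
    case (1 s)
    then show ?thesis using prev u by blast
  next
    case (2 s)
    \<comment> \<open>The point \<open>e (i + 1)\<close> is inverted with all of \<open>D i\<close>
      and distinguishes nothing there, so the witness lies in the cell
      \<open>K (i + 1)\<close>.\<close>
    have "s \<noteq> e (i + 1)"
      using 2(3) D_inverted_e_other(2)[OF u(1) r(2) r(1)] D_inverted_e_other(2)[OF u(2) r(2) r(1)]
      by auto
    then show ?thesis using 2 by (auto simp: K_def)
  qed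
  have dist2: "\<exists>r\<in>K i. (r \<sim> u) \<noteq> (r \<sim> u')"
    if u: "u \<in> D (i + 1)" "u' \<in> D (i + 1)" "u \<noteq> u'" for u u'
    using distinguish_D[OF r(2) u]
  proof cases
    case (1 s)
    have "s \<noteq> e i"
      using 1(3) D_inverted_e_other(2)[OF u(1) r(1) r(2)] D_inverted_e_other(2)[OF u(2) r(1) r(2)]
      by auto
    then show ?thesis using 1 by (auto simp: K_def)
  next
    case (2 s)
    then show ?thesis using nxt u by auto
  qed
  have 1: "\<exists>v\<in>K (i + 1). ?f u < ?f v \<and> ?f v < ?f u'"
    if u: "u \<in> K i" "u' \<in> K i" "?f u < ?f u'" for u u'
  proof -
    obtain v where v: "v \<in> K (i + 1)" "(v \<sim> u) \<noteq> (v \<sim> u')"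
      using dist1[of u u'] u K_D by blast
    note a = inv[OF K_D[OF u(1)] K_D[OF v(1)]] inv[OF K_D[OF u(2)] K_D[OF v(1)]]
      lt[OF K_D[OF u(1)] K_D[OF v(1)]] D_next(3)[of u i v] D_next(3)[of u' i v]
    show ?thesis using a v u K_D i lt[OF K_D[OF u(2)] K_D[OF v(1)]]
      by (intro bexI[of _ v]) (auto simp: inverted_sym[of v])
  qed
  have 2: "\<exists>u\<in>K i. ?f v < ?f u \<and> ?f u < ?f v'"
    if v: "v \<in> K (i + 1)" "v' \<in> K (i + 1)" "?f v < ?f v'" for v v'
  proof -
    obtain u where u: "u \<in> K i" "(u \<sim> v) \<noteq> (u \<sim> v')"
      using dist2[of v v'] v K_D by blast
    note a = inv[OF K_D[OF u(1)] K_D[OF v(1)]] inv[OF K_D[OF u(1)] K_D[OF v(2)]]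
      lt[OF K_D[OF u(1)] K_D[OF v(2)]] D_next(3)[of u i v] D_next(3)[of u i v']
    show ?thesis using a v u K_D i by (intro bexI[of _ u]) auto
  qed
  \<comment> \<open>Ends of the merged sequence: \<open>u\<close> and \<open>e i\<close> are
    distinguished by some \<open>v\<close>. Since \<open>v\<close> is inverted with
    \<open>e i\<close>, it is not inverted with \<open>u\<close>, and so it has the larger key.
    Claim \<open>4\<close> uses \<open>e (i + 1)\<close> in the same way.\<close>
  have 3: "\<exists>v\<in>K (i + 1). ?f u < ?f v" if u: "u \<in> K i" for u
  proof -
    have "e i \<in> D i" "u \<noteq> e i" using u e_in_D r by (auto simp: K_def)
    then obtain v where v: "v \<in> K (i + 1)" "(v \<sim> u) \<noteq> (v \<sim> e i)"
      using dist1[of u "e i"] u K_D by blast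
    have "v \<sim> e i" using D_inverted_e_other(1)[OF K_D[OF v(1)] r(1) r(2)] by simp
    then have "\<not> u \<sim> v" using v inverted_sym by blast
    then have "?f u < ?f v" using D_next(3)[of u i v] K_D[OF u] K_D[OF v(1)] lt i by auto
    then show ?thesis using v by blast
  qed
  have 4: "\<exists>u\<in>K i. ?f u < ?f v" if v: "v \<in> K (i + 1)" for v
  proof -
    have "e (i + 1) \<in> D (i + 1)" "v \<noteq> e (i + 1)" using v e_in_D r by (auto simp: K_def)
    then obtain u where u: "u \<in> K i" "(u \<sim> v) \<noteq> (u \<sim> e (i + 1))"
      using dist2[of v "e (i + 1)"] v K_D by blast
    have "u \<sim> e (i + 1)"
      using D_inverted_e_other(1)[OF K_D[OF u(1)] r(2) r(1)] by simp
    then have "\<not> u \<sim> v" using u by blast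
    then have "?f u < ?f v" using D_next(3)[of u i v] K_D[OF u(1)] K_D[OF v] lt i by auto
    then show ?thesis using u by blast
  qed
  have fin: "finite (K i)" "finite (K (i + 1))" using finite_S by (simp_all add: K_def D_def)
  have ne: "K i \<noteq> {}" using uv0 by blast
  have side: "if lr i then fst u < fst v else snd u < snd v" if "u \<in> K i" "v \<in> K (i + 1)" for u v
    using D_next_side[of u i v] that K_D i by auto
  show ?thesis
  proof (cases "lr i")
    case True
    then have f: "?f = snd" by (simp add: key_def)
    show ?thesis
      using side True by (intro interlace_horizontal fin ne clique_K r 1[unfolded f] 2[unfolded f]
        3[unfolded f] 4[unfolded f]) auto
  next
    case False
    then have f: "?f = fst" by (simp add: key_def)
    show ?thesis
      using side False by (intro interlace_vertical fin ne clique_K r 1[unfolded f] 2[unfolded f]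
        3[unfolded f] 4[unfolded f]) auto
  qed
qed

text \<open>An entry \<open>u\<close> of \<open>K i\<close> is not a twin of \<open>e i\<close>.
  What distinguishes them lies in an adjacent corner class and is inverted with \<open>e i\<close>,
  so it fails to be inverted with \<open>u\<close>.\<close>

lemma interlacing_neighbour:
  assumes i: "i \<in> {1..n}" and ne: "K i \<noteq> {}"
  shows "\<exists>j. j \<in> {1..n} \<and> (j + 1 = i \<or> j = i + 1) \<and> \<not> clique (K i \<union> K j)"
proof -
  obtain u where u: "u \<in> K i" using ne by blast
  have eu: "e i \<in> D i" "u \<in> D i" "u \<noteq> e i" using u e_in_D[OF i] by (auto simp: K_def)
  have works: "\<not> clique (K i \<union> K j)"
    if j: "j \<in> {1..n}" "j + 1 = i \<or> j = i + 1" and r: "r \<in> D j" "(r \<sim> u) \<noteq> (r \<sim> e i)" for j r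
  proof -
    have "r \<sim> e i" using D_inverted_e_other(1)[OF r(1) i j(1)] j(2) by auto
    then have nu: "\<not> r \<sim> u" using r(2) by blast
    have "u \<sim> e j" using D_inverted_e_other(1)[OF eu(2) j(1) i] j(2) by auto
    then have "r \<noteq> e j" using nu inverted_sym by blast
    then have "r \<in> K j" using r(1) by (simp add: K_def)
    moreover have "r \<noteq> u"
    proof
      assume "r = u"
      then show False using r(1) eu(2) j i four
        by (auto simp: D_def min_def max_def split: if_splits)
    qed
    ultimately show ?thesis using nu u cliqueD[of "K i \<union> K j" r u] by blast
  qed
  show ?thesis using distinguish_D[OF i eu(2) eu(1) eu(3)]
  proof cases
    case (1 r)
    then show ?thesis using works[of "i - 1" r] i by (intro exI[of _ "i - 1"]) fastforce
  next
    case (2 r)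
    then show ?thesis using works[of "i + 1" r] i by (intro exI[of _ "i + 1"]) auto
  qed
qed

text \<open>Each failure supplies an increasing pair between its two cells, and
  \<open>not_both\<close> excludes two such pairs meeting in the middle cell, even at different
  entries.\<close>

lemma unique_interlacing:
  assumes "1 \<le> i" "i + 2 \<le> n"
  shows "clique (K i \<union> K (i + 1)) \<or> clique (K (i + 1) \<union> K (i + 2))"
proof (rule ccontr)
  have r: "i \<in> {1..n}" "i + 1 \<in> {1..n}" "i + 2 \<in> {1..n}" using assms by auto
  have ex: "\<exists>u\<in>D j. \<exists>v\<in>D (j + 1). u \<lless> v"
    if j: "1 \<le> j" "j < n" and nc: "\<not> clique (K j \<union> K (j + 1))" for j
  proof -
    have r: "j \<in> {1..n}" "j + 1 \<in> {1..n}" using j by auto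
    obtain p q where pq: "p \<in> K j \<union> K (j + 1)" "q \<in> K j \<union> K (j + 1)" "p \<noteq> q" "\<not> p \<sim> q"
      using nc unfolding clique_def by blast
    have "\<not> (p \<in> K j \<and> q \<in> K j)" "\<not> (p \<in> K (j + 1) \<and> q \<in> K (j + 1))"
      using clique_K r pq cliqueD by blast+
    then obtain u0 v0 where uv0: "u0 \<in> K j" "v0 \<in> K (j + 1)" "\<not> u0 \<sim> v0"
      using pq inverted_sym by blast
    have "u0 \<lless> v0" using D_next(3)[of u0 j v0] uv0 K_D j by auto
    then show ?thesis using uv0 K_D by blast
  qed
  assume "\<not> (clique (K i \<union> K (i + 1)) \<or> clique (K (i + 1) \<union> K (i + 2)))"
  then show False using ex[of i] ex[of "i + 1"] not_both[OF assms] assms by fastforce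
qed

end

subsection \<open>Simple permutations\<close>

locale simple_permutation =
  fixes N :: nat and \<pi> :: "nat \<Rightarrow> nat"
  assumes perm: "\<pi> permutes {1..N}" and simple: "simple_perm N \<pi>" and N: "N > 2"
begin

lemma pi_inj: "\<pi> i = \<pi> j \<Longrightarrow> i = j"
  using injD[OF permutes_inj[OF perm]] .

lemma pi_range: "i \<in> {1..N} \<Longrightarrow> \<pi> i \<in> {1..N}"
  by (simp only: permutes_in_image[OF perm])

lemma pi_surj:
  assumes "v \<in> {1..N}"
  shows "\<exists>i\<in>{1..N}. \<pi> i = v"
proof -
  have "v \<in> \<pi> ` {1..N}" using assms by (simp only: permutes_image[OF perm])
  then show ?thesis by blast
qed

lemma finite_entries: "finite (entries N \<pi>)"
  by (simp add: entries_def)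

lemma inj_fst_entries: "inj_on fst (entries N \<pi>)"
  by (auto simp: entries_def inj_on_def)

lemma inj_snd_entries: "inj_on snd (entries N \<pi>)"
  by (auto simp: entries_def inj_on_def dest!: pi_inj)

lemma in_entries_iff: "p \<in> entries N \<pi> \<longleftrightarrow> fst p \<in> {1..N} \<and> snd p = \<pi> (fst p)"
  unfolding entries_def by (cases p) auto

lemma no_proper_interval:
  assumes "1 \<le> i" "i < j" "j \<le> N" "\<pi> ` {i..j} = {c..d}"
  shows "i = 1 \<and> j = N"
proof -
  have "perm_interval N \<pi> i j" using assms unfolding perm_interval_def by auto
  then show ?thesis using simple assms(2) unfolding simple_perm_def by blast
qed

lemma image_tail: "\<pi> ` {2..N} = {1..N} - {\<pi> 1}"
proof -
  have "{2..N} = {1..N} - {1}" using N by auto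
  then have "\<pi> ` {2..N} = \<pi> ` {1..N} - \<pi> ` {1}"
    using image_set_diff[OF permutes_inj[OF perm]] by metis
  then show ?thesis using permutes_image[OF perm] by simp
qed

text \<open>Otherwise the entries at positions 2 to \<open>N\<close> form an interval, and a proper
  non-singleton one because \<open>N > 2\<close>.\<close>

lemma pi_1_not_extreme: "\<pi> 1 \<noteq> 1" "\<pi> 1 \<noteq> N"
proof -
  show "\<pi> 1 \<noteq> 1"
  proof
    assume "\<pi> 1 = 1"
    then have "\<pi> ` {2..N} = {2..N}" using image_tail by auto
    then show False using no_proper_interval[of 2 N 2 N] N by simp
  qed
  show "\<pi> 1 \<noteq> N"
  proof
    assume "\<pi> 1 = N"
    then have "\<pi> ` {2..N} = {1..N} - {N}" using image_tail by simp
    also have "\<dots> = {1..N - 1}" using N by auto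
    finally have "\<pi> ` {2..N} = {1..N - 1}" .
    then show False using no_proper_interval[of 2 N 1 "N - 1"] N by simp
  qed
qed

(* If p, q are twins then the entries in the box spanned by p and q form an interval. *)
lemma twin_free_entries: "twin_free (entries N \<pi>)"
proof -
  have main: "\<exists>r\<in>entries N \<pi>. r \<noteq> p \<and> r \<noteq> q \<and> (r \<sim> p) \<noteq> (r \<sim> q)"
    if pq: "p \<in> entries N \<pi>" "q \<in> entries N \<pi>" "p \<leadsto> q" for p q
  proof (rule ccontr)
    assume "\<not> (\<exists>r\<in>entries N \<pi>. r \<noteq> p \<and> r \<noteq> q \<and> (r \<sim> p) \<noteq> (r \<sim> q))"
    then have no: "(r \<sim> p) = (r \<sim> q)" if "r \<in> entries N \<pi>" "r \<noteq> p" "r \<noteq> q" for r using that by blast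
    obtain i j where ij: "p = (i, \<pi> i)" "q = (j, \<pi> j)" "i \<in> {1..N}" "j \<in> {1..N}"
      using pq(1,2) unfolding entries_def by blast
    have lt: "i < j" "\<pi> j < \<pi> i" using pq(3) by (auto simp: ij nw_def)
    have iff: "k \<in> {i..j} \<longleftrightarrow> \<pi> k \<in> {\<pi> j..\<pi> i}" if k: "k \<in> {1..N}" for k
    proof (cases "k = i \<or> k = j")
      case True then show ?thesis using lt by auto
    next
      case False
      then have ne: "\<pi> k \<noteq> \<pi> i" "\<pi> k \<noteq> \<pi> j" using pi_inj by blast+
      have "((k, \<pi> k) \<sim> p) = ((k, \<pi> k) \<sim> q)" using no[of "(k, \<pi> k)"] k False
        by (auto simp: ij entries_def)
      then show ?thesis using False ne lt by (auto simp: ij inverted_def nw_def)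
    qed
    have "\<pi> ` {i..j} = {\<pi> j..\<pi> i}"
    proof (intro equalityI subsetI)
      fix v assume "v \<in> \<pi> ` {i..j}"
      then obtain k where "k \<in> {i..j}" "v = \<pi> k" by blast
      then show "v \<in> {\<pi> j..\<pi> i}" using iff[of k] ij by auto
    next
      fix v assume v: "v \<in> {\<pi> j..\<pi> i}"
      then have "v \<in> {1..N}" using pi_range[OF ij(3)] pi_range[OF ij(4)] by auto
      then obtain k where "k \<in> {1..N}" "\<pi> k = v" using pi_surj by blast
      then show "v \<in> \<pi> ` {i..j}" using iff[of k] v by blast
    qed
    \<comment> \<open>Simplicity still allows the box to be the whole permutation; that would put
      the value \<open>N\<close> in first place.\<close>
    then have eq: "i = 1" "j = N" "\<pi> ` {1..N} = {\<pi> j..\<pi> i}"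
      using no_proper_interval[of i j "\<pi> j" "\<pi> i"] ij lt by auto
    then have "{\<pi> j..\<pi> i} = {1..N}" using permutes_image[OF perm] by simp
    then have "\<pi> 1 = N" using lt eq N by (auto simp: Icc_eq_Icc)
    then show False using pi_1_not_extreme by blast
  qed
  show ?thesis unfolding twin_free_def
  proof (intro ballI impI)
    fix p q assume S: "p \<in> entries N \<pi>" "q \<in> entries N \<pi>" and "p \<sim> q"
    then consider "p \<leadsto> q" | "q \<leadsto> p" unfolding inverted_def by blast
    then show "\<exists>r\<in>entries N \<pi>. r \<noteq> p \<and> r \<noteq> q \<and> (r \<sim> p) \<noteq> (r \<sim> q)"
      using main[OF S] main[OF S(2,1)] by cases metis+
  qed
qed

text \<open>If no inversion crosses the cut after position \<open>j\<close>, the first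
  \<open>j\<close> entries carry the \<open>j\<close> smallest values and form an interval.\<close>

lemma sum_indecomposable:
  assumes j: "1 \<le> j" "j < N"
  shows "\<exists>i\<in>{1..j}. \<exists>i'\<in>{j<..N}. \<pi> i' < \<pi> i"
proof (rule ccontr)
  assume "\<not> ?thesis"
  then have le: "\<pi> i \<le> \<pi> i'" if "i \<in> {1..j}" "i' \<in> {j<..N}" for i i' using that by force
  define m where "m = Max (\<pi> ` {1..j})"
  have fin: "finite (\<pi> ` {1..j})" "\<pi> ` {1..j} \<noteq> {}" using j by auto
  have eq: "\<pi> ` {1..j} = {1..m}"
  proof (intro equalityI subsetI)
    fix v assume v: "v \<in> \<pi> ` {1..j}"
    then have "1 \<le> v" using pi_range j by fastforce
    then show "v \<in> {1..m}" using v fin by (simp add: m_def)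
  next
    fix v assume v: "v \<in> {1..m}"
    obtain i where i: "i \<in> {1..j}" "\<pi> i = m" using Max_in[OF fin] by (auto simp: m_def)
    have "m \<le> N" using pi_range[of i] i j by auto
    then obtain k where k: "k \<in> {1..N}" "\<pi> k = v" using pi_surj[of v] v by auto
    have "k \<le> j"
    proof (rule ccontr)
      assume "\<not> k \<le> j"
      then have "\<pi> i \<le> \<pi> k" "i \<noteq> k" using le[of i k] i k by auto
      then show False using i(2) k v pi_inj[of i k] by auto
    qed
    then show "v \<in> \<pi> ` {1..j}" using k by auto
  qed
  show False
  \<comment> \<open>A single position is an interval in every permutation, so for
    \<open>j = 1\<close> the contradiction comes from \<open>\<pi> 1 = 1\<close> instead.\<close>
  proof (cases "j = 1")
    case True
    then have "{\<pi> 1} = {1..m}" using eq by simp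
    then have "\<pi> 1 = 1"
      by (metis atLeastAtMost_iff atLeastatMost_empty_iff2 dual_order.refl insert_not_empty
        singletonD)
    then show False using pi_1_not_extreme by blast
  next
    case False
    then show False using no_proper_interval[of 1 j 1 m] eq j by auto
  qed
qed

section \<open>Left-to-right maxima and right-to-left minima\<close>

abbreviation "L \<equiv> lr_max_pos N \<pi>"
abbreviation "R \<equiv> rl_min_pos N \<pi>"
abbreviation "Ls \<equiv> lr_max_list N \<pi>"
abbreviation "Rs \<equiv> rl_min_list N \<pi>"

lemma pi_N_not_1: "\<pi> N \<noteq> 1"
proof
  assume a: "\<pi> N = 1"
  have "{1..N - 1} = {1..N} - {N}" using N by auto
  then have "\<pi> ` {1..N - 1} = \<pi> ` {1..N} - \<pi> ` {N}"
    using image_set_diff[OF permutes_inj[OF perm]] by metis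
  also have "\<dots> = {1..N} - {1}" using permutes_image[OF perm] a by simp
  also have "\<dots> = {2..N}" by auto
  finally have "\<pi> ` {1..N - 1} = {2..N}" .
  moreover have "1 < N - 1" "N - 1 \<le> N" using N by auto
  ultimately have "N - 1 = N" using no_proper_interval[of 1 "N - 1" 2 N] by blast
  then show False using N by simp
qed

lemma L_range: "i \<in> L \<Longrightarrow> 1 \<le> i \<and> i \<le> N"
  by (simp add: lr_max_pos_def)

lemma R_range: "i \<in> R \<Longrightarrow> 1 \<le> i \<and> i \<le> N"
  by (simp add: rl_min_pos_def)

lemma finite_L: "finite L" and finite_R: "finite R"
  by (simp_all add: lr_max_pos_def rl_min_pos_def)

lemma L_max: "\<lbrakk>j \<in> L; 1 \<le> i; i < j\<rbrakk> \<Longrightarrow> \<pi> i < \<pi> j"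
  by (simp add: lr_max_pos_def)

lemma R_min: "\<lbrakk>j \<in> R; j < i; i \<le> N\<rbrakk> \<Longrightarrow> \<pi> j < \<pi> i"
  by (simp add: rl_min_pos_def)

lemma below_L:
  assumes "k \<in> {1..N}" "k \<notin> L"
  shows "\<exists>i\<in>L. i < k \<and> \<pi> k < \<pi> i"
  using assms
proof (induction k rule: less_induct)
  case (less k)
  then obtain i where i: "i \<in> {1..<k}" "\<not> \<pi> i < \<pi> k" by (auto simp: lr_max_pos_def)
  then have lt: "\<pi> k < \<pi> i" using pi_inj[of i k]
    by (metis atLeastLessThan_iff linorder_neqE_nat less_irrefl)
  show ?case
  proof (cases "i \<in> L")
    case True then show ?thesis using i lt by auto
  next
    case False
    then obtain j where "j \<in> L" "j < i" "\<pi> i < \<pi> j" using less.IH[of i] i less.prems by auto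
    then show ?thesis using i lt by (intro bexI[of _ j]) auto
  qed
qed

lemma above_R:
  assumes "k \<in> {1..N}" "k \<notin> R"
  shows "\<exists>i\<in>R. k < i \<and> \<pi> i < \<pi> k"
  using assms
proof (induction "N - k" arbitrary: k rule: less_induct)
  case (less k)
  then obtain i where i: "i \<in> {k<..N}" "\<not> \<pi> k < \<pi> i" by (auto simp: rl_min_pos_def)
  then have lt: "\<pi> i < \<pi> k" using pi_inj[of i k]
    by (metis greaterThanAtMost_iff linorder_neqE_nat less_irrefl)
  show ?case
  proof (cases "i \<in> R")
    case True then show ?thesis using i lt by auto
  next
    case False
    have "N - i < N - k" using i by auto
    then obtain j where "j \<in> R" "i < j" "\<pi> j < \<pi> i" using less.hyps[of i] False i less.prems by auto
    then show ?thesis using i lt by (intro bexI[of _ j]) auto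
  qed
qed

text \<open>An entry of both kinds exceeds everything before it and is exceeded by everything after
  it, so no inversion crosses the cut directly after it, or directly before it when it is the last
  entry.\<close>

lemma L_R_disjoint:
  assumes "k \<in> L" "k \<in> R"
  shows False
proof (cases "k = N")
  case False
  then have "1 \<le> k" "k < N" using L_range[OF assms(1)] by auto
  then obtain i i' where i: "i \<in> {1..k}" "i' \<in> {k<..N}" "\<pi> i' < \<pi> i" using sum_indecomposable
    by blast
  then have "\<pi> i \<le> \<pi> k" using L_max[OF assms(1), of i] by (cases "i = k") auto
  then show False using R_min[OF assms(2), of i'] i by auto
next
  case True
  have "1 \<le> N - 1" "N - 1 < N" using N by auto
  then obtain i i' where i: "i \<in> {1..N - 1}" "i' \<in> {N - 1<..N}" "\<pi> i' < \<pi> i"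
    using sum_indecomposable by blast
  then have "i' = k" using True by auto
  then show False using i L_max[OF assms(1), of i] True by auto
qed

lemma one_in_L: "1 \<in> L"
  using N by (simp add: lr_max_pos_def)

lemma N_in_R: "N \<in> R"
  using N by (simp add: rl_min_pos_def)

lemma top_in_L: "\<exists>i\<in>L. \<pi> i = N"
proof -
  obtain i where i: "i \<in> {1..N}" "\<pi> i = N" using pi_surj[of N] N by auto
  have "i \<in> L"
  proof (rule ccontr)
    assume "i \<notin> L"
    then obtain j where "j \<in> L" "\<pi> i < \<pi> j" using below_L i by blast
    then show False using i(2) pi_range[of j] L_range[of j] by auto
  qed
  then show ?thesis using i by blast
qed

lemma bottom_in_R: "\<exists>i\<in>R. \<pi> i = 1"
proof -
  obtain i where i: "i \<in> {1..N}" "\<pi> i = 1" using pi_surj[of 1] N by auto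
  have "i \<in> R"
  proof (rule ccontr)
    assume "i \<notin> R"
    then obtain j where "j \<in> R" "\<pi> j < \<pi> i" using above_R i by blast
    then show False using i(2) pi_range[of j] R_range[of j] by auto
  qed
  then show ?thesis using i by blast
qed

lemma set_Ls [simp]: "set Ls = L" and set_Rs [simp]: "set Rs = R"
  using finite_L finite_R by (simp_all add: lr_max_list_def rl_min_list_def)

lemma Ls_in: "r < length Ls \<Longrightarrow> Ls ! r \<in> L" and Rs_in: "r < length Rs \<Longrightarrow> Rs ! r \<in> R"
  using nth_mem[of r Ls] nth_mem[of r Rs] by simp_all

lemma Ls_less: "\<lbrakk>r < s; s < length Ls\<rbrakk> \<Longrightarrow> Ls ! r < Ls ! s"
  and Rs_less: "\<lbrakk>r < s; s < length Rs\<rbrakk> \<Longrightarrow> Rs ! r < Rs ! s"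
  using strict_sorted_list_of_set[of L] strict_sorted_list_of_set[of R]
  by (simp_all add: lr_max_list_def rl_min_list_def sorted_wrt_iff_nth_less)

lemma pi_Ls_less: "\<lbrakk>r < s; s < length Ls\<rbrakk> \<Longrightarrow> \<pi> (Ls ! r) < \<pi> (Ls ! s)"
  using L_max[OF Ls_in, of s "Ls ! r"] Ls_less L_range[OF Ls_in, of r] by auto

lemma pi_Rs_less: "\<lbrakk>r < s; s < length Rs\<rbrakk> \<Longrightarrow> \<pi> (Rs ! r) < \<pi> (Rs ! s)"
  using R_min[OF Rs_in, of r "Rs ! s"] Rs_less R_range[OF Rs_in, of s] by auto

text \<open>The first entry and the entry with value \<open>N\<close> are maxima, and they differ by
  \<open>pi_1_not_extreme\<close>; dually for the last entry and the value 1.\<close>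

lemma two_le_length: "2 \<le> length Ls" "2 \<le> length Rs"
proof -
  obtain i where i: "i \<in> L" "\<pi> i = N" using top_in_L by blast
  then have "i \<noteq> 1" using pi_1_not_extreme by auto
  then have "card {1, i} = 2" by simp
  moreover have "card {1, i} \<le> card L" using i one_in_L finite_L by (intro card_mono) auto
  ultimately show "2 \<le> length Ls" by (simp add: lr_max_list_def)
  obtain j where j: "j \<in> R" "\<pi> j = 1" using bottom_in_R by blast
  then have "j \<noteq> N" using pi_N_not_1 by auto
  then have "card {j, N} = 2" by simp
  moreover have "card {j, N} \<le> card R" using j N_in_R finite_R by (intro card_mono) auto
  ultimately show "2 \<le> length Rs" by (simp add: rl_min_list_def)
qed

lemma before_Ls:
  assumes "Suc r < length Ls" "1 \<le> i" "i < Ls ! Suc r"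
  shows "\<pi> i \<le> \<pi> (Ls ! r)"
proof -
  have Lr: "\<pi> j \<le> \<pi> (Ls ! r)" if j: "j \<in> L" "j < Ls ! Suc r" for j
  proof -
    obtain t where t: "t < length Ls" "j = Ls ! t" using j(1) by (metis in_set_conv_nth set_Ls)
    have "t \<le> r"
    proof (rule ccontr)
      assume "\<not> t \<le> r"
      then have "t = Suc r \<or> Suc r < t" by auto
      then show False using Ls_less[of "Suc r" t] t j(2) by auto
    qed
    then show ?thesis using pi_Ls_less[of t r] t assms(1) by (cases "t = r") auto
  qed
  have "i \<le> N" using assms Ls_in[OF assms(1)] L_range by fastforce
  show ?thesis
  proof (cases "i \<in> L")
    case False
    then obtain j where "j \<in> L" "j < i" "\<pi> i < \<pi> j" using below_L[of i] assms(2) \<open>i \<le> N\<close> by auto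
    then show ?thesis using Lr[of j] assms(3) by auto
  qed (use Lr assms in blast)
qed

lemma after_Rs:
  assumes "Suc r < length Rs" "Rs ! r < i" "i \<le> N"
  shows "\<pi> (Rs ! Suc r) \<le> \<pi> i"
proof -
  have Rr: "\<pi> (Rs ! Suc r) \<le> \<pi> j" if j: "j \<in> R" "Rs ! r < j" for j
  proof -
    obtain t where t: "t < length Rs" "j = Rs ! t" using j(1) by (metis in_set_conv_nth set_Rs)
    have "Suc r \<le> t"
    proof (rule ccontr)
      assume "\<not> Suc r \<le> t"
      then have "t = r \<or> t < r" by auto
      then show False using Rs_less[of t r] t j(2) assms(1) by auto
    qed
    then show ?thesis using pi_Rs_less[of "Suc r" t] t by (cases "t = Suc r") auto
  qed
  have "1 \<le> i" using assms by simp
  show ?thesis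
  proof (cases "i \<in> R")
    case False
    then obtain j where "j \<in> R" "i < j" "\<pi> j < \<pi> i" using above_R[of i] assms(3) \<open>1 \<le> i\<close> by auto
    then show ?thesis using Rr[of j] assms(2) by auto
  qed (use Rr assms in blast)
qed

section \<open>Comparability and alternation of the inflection points\<close>

definition lr_inflection :: "nat \<Rightarrow> point" where
  "lr_inflection r = (Ls ! Suc r, \<pi> (Ls ! r))"

definition rl_inflection :: "nat \<Rightarrow> point" where
  "rl_inflection r = (Rs ! r, \<pi> (Rs ! Suc r))"

lemma lr_inflections_eq: "lr_inflections N \<pi> = lr_inflection ` {..<length Ls - 1}"
  unfolding lr_inflections_def lr_inflection_def Let_def by force

lemma rl_inflections_eq: "rl_inflections N \<pi> = rl_inflection ` {..<length Rs - 1}"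
  unfolding rl_inflections_def rl_inflection_def Let_def by force

lemma lr_inflection_less: "\<lbrakk>r < s; Suc s < length Ls\<rbrakk> \<Longrightarrow> lr_inflection r \<lless> lr_inflection s"
  using Ls_less[of "Suc r" "Suc s"] pi_Ls_less[of r s] by (simp add: lr_inflection_def sw_def)

lemma rl_inflection_less: "\<lbrakk>r < s; Suc s < length Rs\<rbrakk> \<Longrightarrow> rl_inflection r \<lless> rl_inflection s"
  using Rs_less[of r s] pi_Rs_less[of "Suc r" "Suc s"] by (simp add: rl_inflection_def sw_def)

lemma finite_inflections: "finite (inflections N \<pi>)"
  by (simp add: inflections_def lr_inflections_eq rl_inflections_eq)

lemma fst_lr_inflection: "p \<in> lr_inflections N \<pi> \<Longrightarrow> fst p \<in> L"
  using Ls_in by (auto simp: lr_inflections_eq lr_inflection_def)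

lemma fst_rl_inflection: "p \<in> rl_inflections N \<pi> \<Longrightarrow> fst p \<in> R"
  using Rs_in by (auto simp: rl_inflections_eq rl_inflection_def)

lemma lr_rl_inflections_disjoint: "lr_inflections N \<pi> \<inter> rl_inflections N \<pi> = {}"
  using fst_lr_inflection fst_rl_inflection L_R_disjoint by blast

abbreviation "infl \<equiv> inflection_list N \<pi>"

lemma set_infl [simp]: "set infl = inflections N \<pi>"
  using finite_inflections by (simp add: inflection_list_def)

lemma sorted_infl: "sorted_wrt (<) infl"
  by (simp add: inflection_list_def)

lemma point_in_entries: "i \<in> {1..N} \<Longrightarrow> (i, \<pi> i) \<in> entries N \<pi>"
  by (simp add: entries_def)

text \<open>If the left-to-right inflection point lay before and above the other, the two maxima and
  two minima that define the points would form a square. In the opposite position every entry up to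
  \<open>Rs ! s\<close> would be smaller than every later one, against
  \<open>sum_indecomposable\<close>.\<close>

lemma lr_rl_comparable:
  assumes sq: "square_free (entries N \<pi>)"
    and r: "Suc r < length Ls" and s: "Suc s < length Rs"
  shows "lr_inflection r \<lless> rl_inflection s \<or> rl_inflection s \<lless> lr_inflection r"
proof -
  have in_LR: "Ls ! r \<in> L" "Ls ! Suc r \<in> L" "Rs ! s \<in> R" "Rs ! Suc s \<in> R"
    using Ls_in Rs_in r s by auto
  have lt: "Ls ! r < Ls ! Suc r" "\<pi> (Ls ! r) < \<pi> (Ls ! Suc r)"
     "Rs ! s < Rs ! Suc s" "\<pi> (Rs ! s) < \<pi> (Rs ! Suc s)"
    using Ls_less pi_Ls_less Rs_less pi_Rs_less r s by auto
  have ne: "Ls ! Suc r \<noteq> Rs ! s" "\<pi> (Ls ! r) \<noteq> \<pi> (Rs ! Suc s)"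
    using in_LR L_R_disjoint pi_inj by metis+
  have "\<not> (Ls ! Suc r < Rs ! s \<and> \<pi> (Rs ! Suc s) < \<pi> (Ls ! r))"
  proof
    assume a: "Ls ! Suc r < Rs ! s \<and> \<pi> (Rs ! Suc s) < \<pi> (Ls ! r)"
    have S: "(i, \<pi> i) \<in> entries N \<pi>" if "i \<in> L \<or> i \<in> R" for i
      using that point_in_entries[of i] L_range[of i] R_range[of i] by auto
    show False
      using sq[unfolded square_free_def, rule_format, OF S S S S, of "Ls ! r" "Ls ! Suc r"
        "Rs ! s" "Rs ! Suc s"]
        a lt in_LR by (auto simp: sw_def inverted_def nw_def)
  qed
  moreover have "\<not> (Rs ! s < Ls ! Suc r \<and> \<pi> (Ls ! r) < \<pi> (Rs ! Suc s))"
  proof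
    assume a: "Rs ! s < Ls ! Suc r \<and> \<pi> (Ls ! r) < \<pi> (Rs ! Suc s)"
    have "1 \<le> Rs ! s" "Rs ! s < N" using in_LR R_range[of "Rs ! s"] R_range[of "Rs ! Suc s"] lt
      by auto
    then obtain i i' where i: "i \<in> {1..Rs ! s}" "i' \<in> {Rs ! s<..N}" "\<pi> i' < \<pi> i"
      using sum_indecomposable by blast
    then have "\<pi> i \<le> \<pi> (Ls ! r)" "\<pi> (Rs ! Suc s) \<le> \<pi> i'"
      using before_Ls[OF r, of i] after_Rs[OF s, of i'] a by auto
    then show False using a i by auto
  qed
  ultimately show ?thesis using ne unfolding sw_def lr_inflection_def rl_inflection_def
    by auto
qed

text \<open>The inflection points form a chain, and lexicographic order lists it. Consecutive
  members of one type come from three successive extremal points of that type; with no inflection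
  point of the other type in between, a single extremal point of the other type is inverted with all
  three and centres a claw.\<close>

lemma alternate_if:
  assumes cf: "claw_free (entries N \<pi>)" and sq: "square_free (entries N \<pi>)"
  shows "inflections_alternate N \<pi>"
proof -
  let ?I = "inflections N \<pi>" and ?m = "length infl"
  have comparable: "p \<lless> q \<or> q \<lless> p" if "p \<in> ?I" "q \<in> ?I" "p \<noteq> q" for p q
  proof -
    have ll: ?thesis
      if "p = lr_inflection r" "q = lr_inflection s" "Suc r < length Ls" "Suc s < length Ls" for r s
      using that \<open>p \<noteq> q\<close> lr_inflection_less by (metis linorder_neqE_nat)
    have rr: ?thesis
      if "p = rl_inflection r" "q = rl_inflection s" "Suc r < length Rs" "Suc s < length Rs" for r s
      using that \<open>p \<noteq> q\<close> rl_inflection_less by (metis linorder_neqE_nat)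
    have "(\<exists>r. p = lr_inflection r \<and> Suc r < length Ls) \<or> (\<exists>r. p = rl_inflection r \<and>
      Suc r < length Rs)"
      "(\<exists>r. q = lr_inflection r \<and> Suc r < length Ls) \<or> (\<exists>r. q = rl_inflection r \<and>
        Suc r < length Rs)"
      using that by (auto simp: inflections_def lr_inflections_eq rl_inflections_eq)
    then show ?thesis using ll rr lr_rl_comparable[OF sq] by blast
  qed
  have sw: "infl ! a \<lless> infl ! b" if "a < b" "b < ?m" for a b
  proof -
    have "infl ! a < infl ! b" using sorted_infl that by (simp add: sorted_wrt_iff_nth_less)
    moreover have "infl ! a \<in> ?I" "infl ! b \<in> ?I" using that nth_mem[of _ infl] by auto
    ultimately show ?thesis
      using comparable[of "infl ! a" "infl ! b"] less_imp_neq[of "infl ! a" "infl ! b"]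
      by (auto simp: sw_def less_prod_def')
  qed
  show ?thesis unfolding inflections_alternate_def
  proof (intro allI impI)
    fix k assume k: "1 \<le> k \<and> k < ?m"
    define p q where "p = inflection_point N \<pi> k" and "q = inflection_point N \<pi> (k + 1)"
    have pq: "p = infl ! (k - 1)" "q = infl ! k" by (simp_all add: p_def q_def inflection_point_def)
    have lt: "p \<lless> q" using sw[of "k - 1" k] k by (simp add: pq)
    have I: "p \<in> ?I" "q \<in> ?I" using k pq nth_mem[of _ infl] by auto
    have between: "x = p \<or> x = q \<or> x \<lless> p \<or> q \<lless> x" if "x \<in> ?I" for x
    proof -
      obtain t where t: "t < ?m" "x = infl ! t" using \<open>x \<in> ?I\<close> by (metis in_set_conv_nth set_infl)
      have "t < k - 1 \<or> t = k - 1 \<or> t = k \<or> k < t" by auto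
      then show ?thesis using sw[of t "k - 1"] sw[of k t] t k unfolding pq by auto
    qed
    have "\<not> (p \<in> lr_inflections N \<pi> \<and> q \<in> lr_inflections N \<pi>)"
    proof
      assume same: "p \<in> lr_inflections N \<pi> \<and> q \<in> lr_inflections N \<pi>"
      then obtain r s where rs: "p = lr_inflection r" "q = lr_inflection s" "Suc r < length Ls"
        "Suc s < length Ls"
        by (auto simp: lr_inflections_eq)
      have "r < s" using lt lr_inflection_less[of s r] sw_asym rs not_sw_self
        by (metis linorder_neqE_nat)
      have "s = Suc r"
      proof (rule ccontr)
        assume "s \<noteq> Suc r"
        then have "Suc r < s" using \<open>r < s\<close> by simp
        then have b: "p \<lless> lr_inflection (Suc r)" "lr_inflection (Suc r) \<lless> q"
          using rs lr_inflection_less by auto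
        moreover have "lr_inflection (Suc r) \<in> ?I" using \<open>Suc r < s\<close> rs
          by (auto simp: inflections_def lr_inflections_eq)
        ultimately show False using between sw_asym not_sw_self by metis
      qed
      note q = rs(2,4)[unfolded this]
      \<comment> \<open>Wanted is a minimum to the right of the third maximum and below the first.
        The last minimum stands at position \<open>N\<close>, the first has value 1, and no
        inflection point of the minima falls between \<open>p\<close> and \<open>q\<close>; this is
        the input of \<open>crossing_index\<close>.\<close>
      have "\<exists>s<length Rs. Ls ! Suc (Suc r) < Rs ! s \<and> \<pi> (Rs ! s) < \<pi> (Ls ! r)"
      proof (rule crossing_index)
        show "0 < length Rs" using two_le_length by auto
        show "Ls ! Suc (Suc r) < Rs ! (length Rs - 1)"
        proof -
          obtain t where t: "t < length Rs" "N = Rs ! t" using N_in_R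
            by (metis in_set_conv_nth set_Rs)
          have "length Rs - 1 < length Rs" "t = length Rs - 1 \<or> t < length Rs - 1" using t(1)
            by linarith+
          then have "N \<le> Rs ! (length Rs - 1)" using t Rs_less[of t "length Rs - 1"] by auto
          moreover have "Ls ! Suc (Suc r) \<le> N" "Ls ! Suc (Suc r) \<noteq> N"
            using Ls_in[OF q(2)] L_range L_R_disjoint N_in_R by auto
          ultimately show ?thesis by linarith
        qed
        show "\<pi> (Rs ! 0) < \<pi> (Ls ! r)"
        proof -
          obtain j where j: "j \<in> R" "\<pi> j = 1" using bottom_in_R by blast
          then obtain t where t: "t < length Rs" "j = Rs ! t" by (metis in_set_conv_nth set_Rs)
          have "\<pi> (Rs ! 0) \<le> 1" using t j pi_Rs_less[of 0 t] by (cases "t = 0") auto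
          moreover have "\<pi> (Ls ! r) \<noteq> \<pi> j" using Ls_in[of r] rs(3) j L_R_disjoint pi_inj
            by (metis Suc_lessD)
          moreover have "1 \<le> \<pi> (Ls ! r)"
            using pi_range[of "Ls ! r"] L_range[OF Ls_in[of r]] rs(3) by auto
          ultimately show ?thesis using j by linarith
        qed
        fix s assume s: "Suc s < length Rs"
        then have "rl_inflection s \<in> rl_inflections N \<pi>" by (auto simp: rl_inflections_eq)
        then have "rl_inflection s \<in> ?I" "rl_inflection s \<noteq> p" "rl_inflection s \<noteq> q"
          using same lr_rl_inflections_disjoint by (auto simp: inflections_def)
        then have "rl_inflection s \<lless> p \<or> q \<lless> rl_inflection s"
          using between[of "rl_inflection s"] by blast
        then show "\<pi> (Rs ! Suc s) < \<pi> (Ls ! r) \<or> Ls ! Suc (Suc r) < Rs ! s"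
          unfolding rs(1) q(1) sw_def lr_inflection_def rl_inflection_def by auto
      qed
      then obtain s where s: "s < length Rs" "Ls ! Suc (Suc r) < Rs ! s"
        "\<pi> (Rs ! s) < \<pi> (Ls ! r)" by blast
      have S: "(Rs ! s, \<pi> (Rs ! s)) \<in> entries N \<pi>" "(Ls ! r, \<pi> (Ls ! r)) \<in> entries N \<pi>"
        "(Ls ! Suc r, \<pi> (Ls ! Suc r)) \<in> entries N \<pi>"
          "(Ls ! Suc (Suc r), \<pi> (Ls ! Suc (Suc r))) \<in> entries N \<pi>"
        using point_in_entries L_range[OF Ls_in] R_range[OF Rs_in] s rs q by auto
      have "Ls ! r < Ls ! Suc r" "Ls ! Suc r < Ls ! Suc (Suc r)" "\<pi> (Ls ! r) < \<pi> (Ls ! Suc r)"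
        "\<pi> (Ls ! Suc r) < \<pi> (Ls ! Suc (Suc r))" using Ls_less pi_Ls_less q by auto
      then show False using no_claw[OF cf S] s
        by (auto simp: sw_def inverted_def nw_def)
    qed
    moreover have "\<not> (p \<in> rl_inflections N \<pi> \<and> q \<in> rl_inflections N \<pi>)"
    proof
      assume same: "p \<in> rl_inflections N \<pi> \<and> q \<in> rl_inflections N \<pi>"
      then obtain r s where rs: "p = rl_inflection r" "q = rl_inflection s" "Suc r < length Rs"
        "Suc s < length Rs"
        by (auto simp: rl_inflections_eq)
      have "r < s" using lt rl_inflection_less[of s r] sw_asym rs not_sw_self
        by (metis linorder_neqE_nat)
      have "s = Suc r"
      proof (rule ccontr)
        assume "s \<noteq> Suc r"
        then have "Suc r < s" using \<open>r < s\<close> by simp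
        then have b: "p \<lless> rl_inflection (Suc r)" "rl_inflection (Suc r) \<lless> q"
          using rs rl_inflection_less by auto
        moreover have "rl_inflection (Suc r) \<in> ?I" using \<open>Suc r < s\<close> rs
          by (auto simp: inflections_def rl_inflections_eq)
        ultimately show False using between sw_asym not_sw_self by metis
      qed
      note q = rs(2,4)[unfolded this]
      \<comment> \<open>The transposed search: the last maximum has value \<open>N\<close> and the
        first stands at position 1.\<close>
      have "\<exists>s<length Ls. \<pi> (Rs ! Suc (Suc r)) < \<pi> (Ls ! s) \<and> Ls ! s < Rs ! r"
      proof (rule crossing_index)
        show "0 < length Ls" using two_le_length by auto
        show "\<pi> (Rs ! Suc (Suc r)) < \<pi> (Ls ! (length Ls - 1))"
        proof -
          obtain j where j: "j \<in> L" "\<pi> j = N" using top_in_L by blast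
          then obtain t where t: "t < length Ls" "j = Ls ! t" by (metis in_set_conv_nth set_Ls)
          have "length Ls - 1 < length Ls" "t = length Ls - 1 \<or> t < length Ls - 1" using t(1)
            by linarith+
          then have "N \<le> \<pi> (Ls ! (length Ls - 1))" using t j pi_Ls_less[of t "length Ls - 1"]
            by auto
          moreover have "\<pi> (Rs ! Suc (Suc r)) \<noteq> \<pi> j" using Rs_in[OF q(2)] j L_R_disjoint pi_inj
            by metis
          moreover have "\<pi> (Rs ! Suc (Suc r)) \<le> N"
            using pi_range[of "Rs ! Suc (Suc r)"] R_range[OF Rs_in[OF q(2)]] by auto
          ultimately show ?thesis using j by linarith
        qed
        show "Ls ! 0 < Rs ! r"
        proof -
          obtain t where t: "t < length Ls" "1 = Ls ! t" using one_in_L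
            by (metis in_set_conv_nth set_Ls)
          have "Ls ! 0 \<le> 1" using t Ls_less[of 0 t] by (cases "t = 0") auto
          moreover have "Rs ! r \<in> R" using rs(3) Rs_in by auto
          then have "1 \<le> Rs ! r" "Rs ! r \<noteq> 1" using R_range L_R_disjoint one_in_L by auto
          ultimately show ?thesis by linarith
        qed
        fix s assume s: "Suc s < length Ls"
        then have "lr_inflection s \<in> lr_inflections N \<pi>" by (auto simp: lr_inflections_eq)
        then have "lr_inflection s \<in> ?I" "lr_inflection s \<noteq> p" "lr_inflection s \<noteq> q"
          using same lr_rl_inflections_disjoint by (auto simp: inflections_def)
        then have "lr_inflection s \<lless> p \<or> q \<lless> lr_inflection s"
          using between[of "lr_inflection s"] by blast
        then show "Ls ! Suc s < Rs ! r \<or> \<pi> (Rs ! Suc (Suc r)) < \<pi> (Ls ! s)"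
          unfolding rs(1) q(1) sw_def lr_inflection_def rl_inflection_def by auto
      qed
      then obtain s where s: "s < length Ls" "\<pi> (Rs ! Suc (Suc r)) < \<pi> (Ls ! s)"
        "Ls ! s < Rs ! r" by blast
      have S: "(Ls ! s, \<pi> (Ls ! s)) \<in> entries N \<pi>" "(Rs ! r, \<pi> (Rs ! r)) \<in> entries N \<pi>"
        "(Rs ! Suc r, \<pi> (Rs ! Suc r)) \<in> entries N \<pi>"
          "(Rs ! Suc (Suc r), \<pi> (Rs ! Suc (Suc r))) \<in> entries N \<pi>"
        using point_in_entries L_range[OF Ls_in] R_range[OF Rs_in] s rs q by auto
      have "Rs ! r < Rs ! Suc r" "Rs ! Suc r < Rs ! Suc (Suc r)" "\<pi> (Rs ! r) < \<pi> (Rs ! Suc r)"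
        "\<pi> (Rs ! Suc r) < \<pi> (Rs ! Suc (Suc r))" using Rs_less pi_Rs_less q by auto
      then show False using no_claw[OF cf S] s
        by (auto simp: sw_def inverted_def nw_def)
    qed
    ultimately show "snd (inflection_point N \<pi> k) < snd (inflection_point N \<pi> (k + 1)) \<and>
        (inflection_point N \<pi> k \<in> lr_inflections N \<pi> \<and>
           inflection_point N \<pi> (k + 1) \<in> rl_inflections N \<pi> \<or>
         inflection_point N \<pi> k \<in> rl_inflections N \<pi> \<and>
           inflection_point N \<pi> (k + 1) \<in> lr_inflections N \<pi>)"
      using I lt unfolding p_def[symmetric] q_def[symmetric] inflections_def sw_def by auto
  qed
qed

section \<open>Indexing the alternating lists of inflection and extremal points\<close>

lemma filter_lr: "filter (\<lambda>x. x \<in> lr_inflections N \<pi>) infl = map lr_inflection [0..<length Ls - 1]"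
proof -
  have "sorted_list_of_set (lr_inflections N \<pi>) = filter (\<lambda>x. x \<in> lr_inflections N \<pi>) infl"
    by (rule sorted_list_of_set_eqI) (use sorted_infl in \<open>auto simp: sorted_wrt_filter
      inflections_def\<close>)
  moreover have "sorted_list_of_set (lr_inflections N \<pi>) = map lr_inflection [0..<length Ls - 1]"
  proof (rule sorted_list_of_set_eqI)
    show "sorted_wrt (<) (map lr_inflection [0..<length Ls - 1])"
      using lr_inflection_less by (auto simp: sorted_wrt_iff_nth_less sw_def less_prod_def')
  qed (auto simp: lr_inflections_eq)
  ultimately show ?thesis by simp
qed

lemma filter_rl: "filter (\<lambda>x. x \<notin> lr_inflections N \<pi>) infl = map rl_inflection [0..<length Rs - 1]"
proof -
  have "sorted_list_of_set (rl_inflections N \<pi>) = filter (\<lambda>x. x \<notin> lr_inflections N \<pi>) infl"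
    by (rule sorted_list_of_set_eqI)
      (use sorted_infl lr_rl_inflections_disjoint in \<open>auto simp: sorted_wrt_filter inflections_def\<close>)
  moreover have "sorted_list_of_set (rl_inflections N \<pi>) = map rl_inflection [0..<length Rs - 1]"
  proof (rule sorted_list_of_set_eqI)
    show "sorted_wrt (<) (map rl_inflection [0..<length Rs - 1])"
      using rl_inflection_less by (auto simp: sorted_wrt_iff_nth_less sw_def less_prod_def')
  qed (auto simp: rl_inflections_eq)
  ultimately show ?thesis by simp
qed

definition lr_first :: bool where
  "lr_first \<longleftrightarrow> inflection_point N \<pi> 1 \<in> lr_inflections N \<pi>"

text \<open>The type read off from the parity of the index, with index 1 having the type of the
  first inflection point. It serves for extremal points and inflection points alike.\<close>

definition lr_index :: "nat \<Rightarrow> bool" where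
  "lr_index i \<longleftrightarrow> lr_first = odd i"

abbreviation "en \<equiv> num_extremal N \<pi>"
abbreviation "ep \<equiv> extremal_point N \<pi>"
abbreviation "ip \<equiv> inflection_point N \<pi>"

lemma infl_parity:
  assumes "inflections_alternate N \<pi>" "k < length infl"
  shows "(infl ! k \<in> lr_inflections N \<pi>) = (lr_first = even k)"
  using assms(2)
proof (induction k)
  case 0
  then show ?case by (simp add: lr_first_def inflection_point_def)
next
  case (Suc k)
  have "infl ! k \<in> lr_inflections N \<pi> \<and> infl ! Suc k \<in> rl_inflections N \<pi> \<or>
      infl ! k \<in> rl_inflections N \<pi> \<and> infl ! Suc k \<in> lr_inflections N \<pi>"
    using assms(1)[unfolded inflections_alternate_def, rule_format, of "Suc k"] Suc.prems
    by (simp add: inflection_point_def)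
  then have "(infl ! Suc k \<in> lr_inflections N \<pi>) = (infl ! k \<notin> lr_inflections N \<pi>)"
    using lr_rl_inflections_disjoint by blast
  then show ?case using Suc by auto
qed

text \<open>Alternation makes the numbers of inflection points of the two types the two roundings of
  half the total. Each list of extremal points is longer by one than its list of inflection points,
  so the two are balanced in the same way and \<open>splice\<close> alternates to the end instead of
  appending a leftover block. The fourth and fifth claims guarantee that the numbering misses no
  extremal point.\<close>

lemma extremal_structure:
  assumes alt: "inflections_alternate N \<pi>"
  shows "en = length infl + 2"
    and "i \<in> {1..en} \<Longrightarrow> ep i = (if lr_index i then (Ls ! ((i - 1) div 2), \<pi> (Ls ! ((i - 1) div 2)))
          else (Rs ! ((i - 1) div 2), \<pi> (Rs ! ((i - 1) div 2))))"
    and "i \<in> {1..en} \<Longrightarrow> (i - 1) div 2 < (if lr_index i then length Ls else length Rs)"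
    and "r < length Ls \<Longrightarrow> \<exists>i\<in>{1..en}. lr_index i \<and> (i - 1) div 2 = r"
    and "r < length Rs \<Longrightarrow> \<exists>i\<in>{1..en}. \<not> lr_index i \<and> (i - 1) div 2 = r"
    and "k \<in> {1..en - 2} \<Longrightarrow> ip k = (if lr_index k then lr_inflection ((k - 1) div 2)
          else rl_inflection ((k - 1) div 2))"
proof -
  let ?m = "length infl"
  let ?l = "map lr_inflection [0..<length Ls - 1]" and ?r = "map rl_inflection [0..<length Rs - 1]"
  let ?L = "map (\<lambda>i. (i, \<pi> i)) Ls" and ?R = "map (\<lambda>i. (i, \<pi> i)) Rs"
  note two = two_le_length
  have halves: "(?m + 1) div 2 + ?m div 2 = ?m" by presburger
  have ip_nth: "ip k = infl ! (k - 1)" for k by (simp add: inflection_point_def)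
  have "en = length infl + 2 \<and>
    (i \<in> {1..en} \<longrightarrow> ep i = (if lr_index i then ?L ! ((i - 1) div 2) else ?R ! ((i - 1) div 2))) \<and>
    (i \<in> {1..en} \<longrightarrow> (i - 1) div 2 < (if lr_index i then length Ls else length Rs)) \<and>
    (r < length Ls \<longrightarrow> (\<exists>i\<in>{1..en}. lr_index i \<and> (i - 1) div 2 = r)) \<and>
    (r < length Rs \<longrightarrow> (\<exists>i\<in>{1..en}. \<not> lr_index i \<and> (i - 1) div 2 = r)) \<and>
    (k \<in> {1..en - 2} \<longrightarrow>
      ip k = (if lr_index k then ?l ! ((k - 1) div 2) else ?r ! ((k - 1) div 2)))" for i r k
  proof (cases lr_first)
    case True
    have "infl = splice ?l ?r \<and> length ?l = (?m + 1) div 2 \<and> length ?r = ?m div 2"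
      using alternating_splice[of infl "\<lambda>x. x \<in> lr_inflections N \<pi>"] infl_parity[OF alt] True
      unfolding filter_lr filter_rl by blast
    then have s: "infl = splice ?l ?r" "length ?l = (?m + 1) div 2" "length ?r = ?m div 2" by blast+
    have l: "length Ls = (?m + 1) div 2 + 1" "length Rs = ?m div 2 + 1" using s(2,3) two by simp_all
    then have n: "en = ?m + 2" unfolding num_extremal_def using l halves by linarith
    then have len: "length ?L = (en + 1) div 2" "length ?R = en div 2" using l by simp_all
    have el: "extremal_list N \<pi> = splice ?L ?R"
      using True by (simp add: extremal_list_def lr_first_def)
    have lr: "lr_index i = odd i" for i using True by (simp add: lr_index_def)
    have 1: "ep i = (if lr_index i then ?L ! ((i - 1) div 2) else ?R ! ((i - 1) div 2))"
      if "i \<in> {1..en}"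
    proof -
      have "ep i = (if even (i - 1) then ?L ! ((i - 1) div 2) else ?R ! ((i - 1) div 2))"
        unfolding extremal_point_def el using that by (intro nth_splice_balanced[OF len]) auto
      moreover have "even (i - 1) = odd i" using that by auto
      ultimately show ?thesis unfolding lr by simp
    qed
    have 2: "ip k = (if lr_index k then ?l ! ((k - 1) div 2) else ?r ! ((k - 1) div 2))"
      if "k \<in> {1..en - 2}"
    proof -
      have "ip k = (if even (k - 1) then ?l ! ((k - 1) div 2) else ?r ! ((k - 1) div 2))"
        unfolding ip_nth s(1) using that n by (intro nth_splice_balanced[OF s(2,3)]) auto
      moreover have "even (k - 1) = odd k" using that by auto
      ultimately show ?thesis unfolding lr by simp
    qed
    have len': "length Ls = (en + 1) div 2" "length Rs = en div 2" using len by simp_all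
    have 3: "(i - 1) div 2 < (if lr_index i then length Ls else length Rs)" if "i \<in> {1..en}"
    proof (cases "odd i")
      case True
      then have "(i - 1) div 2 < (en + 1) div 2" using that unfolding atLeastAtMost_iff
        by presburger
      then show ?thesis unfolding lr len' using True by simp
    next
      case False
      then have "(i - 1) div 2 < en div 2" using that unfolding atLeastAtMost_iff by presburger
      then show ?thesis unfolding lr len' using False by simp
    qed
    have 4: "\<exists>i\<in>{1..en}. lr_index i \<and> (i - 1) div 2 = r" if "r < length Ls"
      using that unfolding len' lr by (intro bexI[of _ "2 * r + 1"]) auto
    have 5: "\<exists>i\<in>{1..en}. \<not> lr_index i \<and> (i - 1) div 2 = r" if "r < length Rs"
      using that unfolding len' lr by (intro bexI[of _ "2 * r + 2"]) auto
    show ?thesis using n 1 2 3 4 5 by blast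
  next
    case False
    have "infl = splice ?r ?l \<and> length ?r = (?m + 1) div 2 \<and> length ?l = ?m div 2"
      using alternating_splice[of infl "\<lambda>x. x \<notin> lr_inflections N \<pi>"] infl_parity[OF alt] False
      unfolding not_not filter_lr filter_rl by blast
    then have s: "infl = splice ?r ?l" "length ?r = (?m + 1) div 2" "length ?l = ?m div 2" by blast+
    have l: "length Rs = (?m + 1) div 2 + 1" "length Ls = ?m div 2 + 1" using s(2,3) two by simp_all
    then have n: "en = ?m + 2" unfolding num_extremal_def using l halves by linarith
    then have len: "length ?R = (en + 1) div 2" "length ?L = en div 2" using l by simp_all
    have el: "extremal_list N \<pi> = splice ?R ?L"
      using False by (simp add: extremal_list_def lr_first_def)
    have lr: "lr_index i = even i" for i using False by (simp add: lr_index_def)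
    have 1: "ep i = (if lr_index i then ?L ! ((i - 1) div 2) else ?R ! ((i - 1) div 2))"
      if "i \<in> {1..en}"
    proof -
      have "ep i = (if even (i - 1) then ?R ! ((i - 1) div 2) else ?L ! ((i - 1) div 2))"
        unfolding extremal_point_def el using that by (intro nth_splice_balanced[OF len]) auto
      moreover have "even (i - 1) = odd i" using that by auto
      ultimately show ?thesis unfolding lr by simp
    qed
    have 2: "ip k = (if lr_index k then ?l ! ((k - 1) div 2) else ?r ! ((k - 1) div 2))"
      if "k \<in> {1..en - 2}"
    proof -
      have "ip k = (if even (k - 1) then ?r ! ((k - 1) div 2) else ?l ! ((k - 1) div 2))"
        unfolding ip_nth s(1) using that n by (intro nth_splice_balanced[OF s(2,3)]) auto
      moreover have "even (k - 1) = odd k" using that by auto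
      ultimately show ?thesis unfolding lr by simp
    qed
    have len': "length Rs = (en + 1) div 2" "length Ls = en div 2" using len by simp_all
    have 3: "(i - 1) div 2 < (if lr_index i then length Ls else length Rs)" if "i \<in> {1..en}"
    proof (cases "odd i")
      case True
      then have "(i - 1) div 2 < (en + 1) div 2" using that unfolding atLeastAtMost_iff
        by presburger
      then show ?thesis unfolding lr len' using True by simp
    next
      case False
      then have "(i - 1) div 2 < en div 2" using that unfolding atLeastAtMost_iff by presburger
      then show ?thesis unfolding lr len' using False by simp
    qed
    have 4: "\<exists>i\<in>{1..en}. \<not> lr_index i \<and> (i - 1) div 2 = r" if "r < length Rs"
      using that unfolding len' lr by (intro bexI[of _ "2 * r + 1"]) auto
    have 5: "\<exists>i\<in>{1..en}. lr_index i \<and> (i - 1) div 2 = r" if "r < length Ls"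
      using that unfolding len' lr by (intro bexI[of _ "2 * r + 2"]) auto
    show ?thesis using n 1 2 3 4 5 by blast
  qed
  note all = this
  show "en = length infl + 2" using all by blast
  show len: "i \<in> {1..en} \<Longrightarrow> (i - 1) div 2 < (if lr_index i then length Ls else length Rs)"
    for i using all by blast
  show "ep i = (if lr_index i then (Ls ! ((i - 1) div 2), \<pi> (Ls ! ((i - 1) div 2)))
          else (Rs ! ((i - 1) div 2), \<pi> (Rs ! ((i - 1) div 2))))" if i: "i \<in> {1..en}"
  proof -
    have "ep i = (if lr_index i then ?L ! ((i - 1) div 2) else ?R ! ((i - 1) div 2))" using all i
      by blast
    then show ?thesis using len[OF i] by (cases "lr_index i") simp_all
  qed
  show "r < length Ls \<Longrightarrow> \<exists>i\<in>{1..en}. lr_index i \<and> (i - 1) div 2 = r" using all by blast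
  show "r < length Rs \<Longrightarrow> \<exists>i\<in>{1..en}. \<not> lr_index i \<and> (i - 1) div 2 = r" using all by blast
  assume k: "k \<in> {1..en - 2}"
  \<comment> \<open>The bound for index \<open>k + 2\<close> is what places both extremal points
    defining the \<open>k\<close>-th inflection point inside their list.\<close>
  then have "k + 2 \<in> {1..en}" "(k + 2 - 1) div 2 = (k - 1) div 2 + 1"
    "lr_index (k + 2) = lr_index k"
    by (auto simp: lr_index_def)
  then have "(k - 1) div 2 + 1 < (if lr_index k then length Ls else length Rs)"
    using len[of "k + 2"] by metis
  moreover have "ip k = (if lr_index k then ?l ! ((k - 1) div 2) else ?r ! ((k - 1) div 2))"
    using all k by blast
  ultimately show "ip k = (if lr_index k then lr_inflection ((k - 1) div 2) else rl_inflection
    ((k - 1) div 2))"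
    by (cases "lr_index k") simp_all
qed

end

subsection \<open>Alternating inflection points\<close>

locale alternating_permutation = simple_permutation +
  assumes alt: "inflections_alternate N \<pi>"
begin

lemma lr_index_Suc: "lr_index (Suc i) = (\<not> lr_index i)"
  by (auto simp: lr_index_def)

lemma en_ge_4: "4 \<le> en"
  using two_le_length by (simp add: num_extremal_def)

lemma ep_L: "\<lbrakk>i \<in> {1..en}; lr_index i\<rbrakk> \<Longrightarrow> fst (ep i) \<in> L \<and> snd (ep i) = \<pi> (fst (ep i))"
  using extremal_structure(2,3)[OF alt, of i] Ls_in by auto

lemma ep_R: "\<lbrakk>i \<in> {1..en}; \<not> lr_index i\<rbrakk> \<Longrightarrow> fst (ep i) \<in> R \<and> snd (ep i) = \<pi> (fst (ep i))"
  using extremal_structure(2,3)[OF alt, of i] Rs_in by auto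

lemma L_ep:
  assumes "j \<in> L"
  shows "\<exists>i\<in>{1..en}. lr_index i \<and> ep i = (j, \<pi> j)"
proof -
  obtain r where r: "r < length Ls" "j = Ls ! r" using assms by (metis in_set_conv_nth set_Ls)
  then obtain i where "i \<in> {1..en}" "lr_index i" "(i - 1) div 2 = r"
    using extremal_structure(4)[OF alt] by blast
  then show ?thesis using extremal_structure(2)[OF alt] r by (intro bexI[of _ i]) auto
qed

lemma R_ep:
  assumes "j \<in> R"
  shows "\<exists>i\<in>{1..en}. \<not> lr_index i \<and> ep i = (j, \<pi> j)"
proof -
  obtain r where r: "r < length Rs" "j = Rs ! r" using assms by (metis in_set_conv_nth set_Rs)
  then obtain i where "i \<in> {1..en}" "\<not> lr_index i" "(i - 1) div 2 = r"
    using extremal_structure(5)[OF alt] by blast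
  then show ?thesis using extremal_structure(2)[OF alt] r by (intro bexI[of _ i]) auto
qed

lemma ep_in: "i \<in> {1..en} \<Longrightarrow> ep i \<in> entries N \<pi>"
  using ep_L[of i] ep_R[of i] L_range R_range by (cases "lr_index i") (auto simp: in_entries_iff)

lemma ep_same_parity_less:
  assumes "i \<in> {1..en}" "j \<in> {1..en}" "i < j" "even (i + j)"
  shows "ep i \<lless> ep j"
proof -
  have lr: "lr_index i = lr_index j" using assms(4) by (auto simp: lr_index_def)
  have lt: "(i - 1) div 2 < (j - 1) div 2" using assms unfolding atLeastAtMost_iff by presburger
  show ?thesis
    using extremal_structure(2,3)[OF alt, of i] extremal_structure(2,3)[OF alt, of j] assms(1,2)
      lr lt
      Ls_less[OF lt] Rs_less[OF lt] pi_Ls_less[OF lt] pi_Rs_less[OF lt]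
    by (auto simp: sw_def split: if_splits)
qed

lemma ip_eq:
  assumes k: "1 \<le> k" "k + 2 \<le> en"
  shows "ip k = (if lr_index k then (fst (ep (k + 2)), snd (ep k)) else (fst (ep k), snd (ep (k +
    2))))"
proof -
  have r: "k \<in> {1..en}" "k + 2 \<in> {1..en}" "k \<in> {1..en - 2}" using k by auto
  have "lr_index (k + 2) = lr_index k" "(k + 2 - 1) div 2 = Suc ((k - 1) div 2)"
    using k by (auto simp: lr_index_def)
  then show ?thesis
    using extremal_structure(2)[OF alt r(1)] extremal_structure(2)[OF alt r(2)]
      extremal_structure(6)[OF alt r(3)]
    by (simp add: lr_inflection_def rl_inflection_def)
qed

lemma inflections_ip: "inflections N \<pi> = ip ` {1..en - 2}"
proof -
  have "inflections N \<pi> = (\<lambda>k. infl ! k) ` {..<en - 2}"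
    using extremal_structure(1)[OF alt] set_infl by (auto simp: set_conv_nth)
  also have "\<dots> = ip ` {1..en - 2}"
  proof (intro equalityI subsetI)
    fix x assume "x \<in> (\<lambda>k. infl ! k) ` {..<en - 2}"
    then obtain k where "k < en - 2" "x = infl ! k" by auto
    then show "x \<in> ip ` {1..en - 2}"
      by (intro image_eqI[of _ _ "Suc k"]) (auto simp: inflection_point_def)
  next
    fix x assume "x \<in> ip ` {1..en - 2}"
    then obtain k where "k \<in> {1..en - 2}" "x = ip k" by auto
    then show "x \<in> (\<lambda>k. infl ! k) ` {..<en - 2}"
      by (intro image_eqI[of _ _ "k - 1"]) (auto simp: inflection_point_def)
  qed
  finally show ?thesis .
qed

lemma ip_step:
  assumes k: "1 \<le> k" "k + 2 < en"
  shows "ip k \<lless> ip (Suc k)"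
proof -
  have k': "1 \<le> k \<and> k < length infl" using k extremal_structure(1)[OF alt] by simp
  note a = alt[unfolded inflections_alternate_def, rule_format, OF k']
  have "infl ! (k - 1) < infl ! k" using sorted_infl k' by (simp add: sorted_wrt_iff_nth_less)
  then have "fst (ip k) \<le> fst (ip (Suc k))" by (auto simp: inflection_point_def less_prod_def')
  \<comment> \<open>The lexicographic listing gives only a weak inequality; it is strict because
    consecutive inflection points have first coordinates in \<open>L\<close> and \<open>R\<close>
    respectively, which are disjoint.\<close>
  moreover have "fst (ip k) \<noteq> fst (ip (Suc k))"
    using a fst_lr_inflection fst_rl_inflection L_R_disjoint by (metis Suc_eq_plus1)
  ultimately show ?thesis using a by (simp add: sw_def)
qed

lemma ip_less:
  assumes "1 \<le> i" "i < j" "j + 2 \<le> en"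
  shows "ip i \<lless> ip j"
  using assms(2,3)
proof (induction j)
  case (Suc j)
  have "ip j \<lless> ip (Suc j)" using Suc.prems assms(1) by (intro ip_step) auto
  then show ?case using Suc assms(1) sw_trans by (cases "i = j") auto
qed simp

text \<open>The two coordinates are those of the inflection points \<open>i - 2\<close> and
  \<open>j\<close>, and \<open>i - 2 < j\<close>, so the chain of inflection points compares
  them.\<close>

lemma fst_lr_less_rl:
  assumes "i \<in> {1..en}" "j \<in> {1..en}" "lr_index i" "\<not> lr_index j" "i \<le> j + 1"
  shows "fst (ep i) < fst (ep j)"
proof -
  have L: "fst (ep i) \<in> L" and R: "fst (ep j) \<in> R" using ep_L ep_R assms by auto
  show ?thesis
  proof (cases "3 \<le> i \<and> j + 2 \<le> en")
    case True
    then have "fst (ip (i - 2)) = fst (ep i)"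
      using ip_eq[of "i - 2"] assms lr_index_Suc[of "i - 2"] lr_index_Suc[of "Suc (i - 2)"]
      by (auto simp: Suc_diff_Suc numeral_2_eq_2)
    moreover have "fst (ip j) = fst (ep j)" using ip_eq[of j] True assms by auto
    moreover have "ip (i - 2) \<lless> ip j" using True assms by (intro ip_less) auto
    ultimately show ?thesis by (simp add: sw_def)
  next
    case False
    have ne: "fst (ep i) \<noteq> fst (ep j)" using L R L_R_disjoint by metis
    \<comment> \<open>Outside the range of inflection points, \<open>i \<le> 2\<close> makes
      \<open>ep i\<close> the first maximum, at position 1, or \<open>en < j + 2\<close> makes
      \<open>ep j\<close> the last minimum, at position \<open>N\<close>.\<close>
    have "fst (ep i) = 1 \<or> fst (ep j) = N"
    proof (cases "3 \<le> i")
      case i3: False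
      obtain i' where i': "i' \<in> {1..en}" "lr_index i'" "ep i' = (1, \<pi> 1)" using L_ep[OF one_in_L]
        by auto
      then have "even (i + i')" using assms(3) by (auto simp: lr_index_def)
      then have "i = i' \<or> i < i'" using i'(1) i3 assms(1) unfolding atLeastAtMost_iff by presburger
      then have "fst (ep i) \<le> 1"
        using ep_same_parity_less[OF assms(1) i'(1)] i' \<open>even (i + i')\<close> by (auto simp: sw_def)
      then show ?thesis using L_range[OF L] by auto
    next
      case True
      then have jn: "en < j + 2" using False by simp
      obtain j' where j': "j' \<in> {1..en}" "\<not> lr_index j'" "ep j' = (N, \<pi> N)" using R_ep[OF N_in_R]
        by auto
      then have "even (j' + j)" using assms(4) by (auto simp: lr_index_def)
      then have "j = j' \<or> j' < j" using j'(1) jn assms(2) unfolding atLeastAtMost_iff by presburger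
      then have "N \<le> fst (ep j)"
        using ep_same_parity_less[OF j'(1) assms(2)] j' \<open>even (j' + j)\<close> by (auto simp: sw_def)
      then show ?thesis using R_range[OF R] by auto
    qed
    then show ?thesis using ne L_range[OF L] R_range[OF R] by auto
  qed
qed

text \<open>The transpose of \<open>fst_lr_less_rl\<close>, with the values 1 and \<open>N\<close>
  as the extreme cases.\<close>

lemma snd_rl_less_lr:
  assumes "i \<in> {1..en}" "j \<in> {1..en}" "\<not> lr_index i" "lr_index j" "i \<le> j + 1"
  shows "snd (ep i) < snd (ep j)"
proof -
  have R: "fst (ep i) \<in> R" "snd (ep i) = \<pi> (fst (ep i))" and L: "fst (ep j) \<in> L"
    "snd (ep j) = \<pi> (fst (ep j))"
    using ep_L ep_R assms by auto
  have range: "1 \<le> snd (ep i)" "snd (ep j) \<le> N"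
    using pi_range[of "fst (ep i)"] pi_range[of "fst (ep j)"] R L R_range L_range by auto
  have range': "snd (ep i) \<le> N" "1 \<le> snd (ep j)"
    using pi_range[of "fst (ep i)"] pi_range[of "fst (ep j)"] R L R_range L_range by auto
  show ?thesis
  proof (cases "3 \<le> i \<and> j + 2 \<le> en")
    case True
    then have "snd (ip (i - 2)) = snd (ep i)"
      using ip_eq[of "i - 2"] assms lr_index_Suc[of "i - 2"] lr_index_Suc[of "Suc (i - 2)"]
      by (auto simp: Suc_diff_Suc numeral_2_eq_2)
    moreover have "snd (ip j) = snd (ep j)" using ip_eq[of j] True assms by auto
    moreover have "ip (i - 2) \<lless> ip j" using True assms by (intro ip_less) auto
    ultimately show ?thesis by (simp add: sw_def)
  next
    case False
    have ne: "snd (ep i) \<noteq> snd (ep j)" using L R L_R_disjoint pi_inj by metis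
    have "snd (ep i) = 1 \<or> snd (ep j) = N"
    proof (cases "3 \<le> i")
      case i3: False
      obtain x where x: "x \<in> R" "\<pi> x = 1" using bottom_in_R by blast
      obtain i' where i': "i' \<in> {1..en}" "\<not> lr_index i'" "ep i' = (x, \<pi> x)" using R_ep[OF x(1)]
        by auto
      then have "even (i + i')" using assms(3) by (auto simp: lr_index_def)
      then have "i = i' \<or> i < i'" using i'(1) i3 assms(1) unfolding atLeastAtMost_iff by presburger
      then have "snd (ep i) \<le> 1"
        using ep_same_parity_less[OF assms(1) i'(1)] i' x \<open>even (i + i')\<close> by (auto simp: sw_def)
      then show ?thesis using range by auto
    next
      case True
      then have jn: "en < j + 2" using False by simp
      obtain x where x: "x \<in> L" "\<pi> x = N" using top_in_L by blast
      obtain j' where j': "j' \<in> {1..en}" "lr_index j'" "ep j' = (x, \<pi> x)" using L_ep[OF x(1)]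
        by auto
      then have "even (j' + j)" using assms(4) by (auto simp: lr_index_def)
      then have "j = j' \<or> j' < j" using j'(1) jn assms(2) unfolding atLeastAtMost_iff by presburger
      then have "N \<le> snd (ep j)"
        using ep_same_parity_less[OF j'(1) assms(2)] j' x \<open>even (j' + j)\<close> by (auto simp: sw_def)
      then show ?thesis using range by auto
    qed
    then show ?thesis using ne range range' by auto
  qed
qed

lemma zigzag_entries: "zigzag (entries N \<pi>) en ep lr_index"
proof
  show "finite (entries N \<pi>)" "inj_on fst (entries N \<pi>)" "inj_on snd (entries N \<pi>)"
    using finite_entries inj_fst_entries inj_snd_entries .
  show "4 \<le> en" using en_ge_4 .
  show "lr_index (Suc i) = (\<not> lr_index i)" for i using lr_index_Suc .
  fix i j :: nat and v
  show "ep i \<in> entries N \<pi>" if "1 \<le> i" "i \<le> en" using ep_in that by auto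
  show "\<not> v \<leadsto> ep i" if "lr_index i" "1 \<le> i" "i \<le> en" "v \<in> entries N \<pi>"
    using ep_L[of i] L_max[of "fst (ep i)" "fst v"] that by (auto simp: nw_def in_entries_iff)
  show "\<not> ep i \<leadsto> v" if "\<not> lr_index i" "1 \<le> i" "i \<le> en" "v \<in> entries N \<pi>"
    using ep_R[of i] R_min[of "fst (ep i)" "fst v"] that by (auto simp: nw_def in_entries_iff)
  show "ep i \<sim> ep (Suc i)" if "1 \<le> i" "i < en"
  proof (cases "lr_index i")
    case True
    then show ?thesis using fst_lr_less_rl[of i "Suc i"] snd_rl_less_lr[of "Suc i" i] that
      by (auto simp: inverted_def nw_def lr_index_Suc)
  next
    case False
    then show ?thesis using fst_lr_less_rl[of "Suc i" i] snd_rl_less_lr[of i "Suc i"] that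
      by (auto simp: inverted_def nw_def lr_index_Suc)
  qed
  show "ep i \<lless> ep j" if "1 \<le> i" "i + 2 \<le> j" "j \<le> en"
  proof (cases "even (i + j)")
    case True
    then show ?thesis using ep_same_parity_less[of i j] that by auto
  next
    case odd: False
    then have "j \<noteq> i + 2" by auto
    then have j: "i + 3 \<le> j" "1 \<le> j - 2" "j - 2 + 2 = j" using that by auto
    have lr: "lr_index j = (\<not> lr_index i)" "lr_index (j - 2) = lr_index j"
      using odd j(3) lr_index_Suc[of "j - 2"] lr_index_Suc[of "Suc (j - 2)"]
        by (auto simp: lr_index_def)
    \<comment> \<open>At odd distance, at least 3, the points have opposite types. The chain of
      inflection points settles one coordinate, and \<open>fst_lr_less_rl\<close> or
      \<open>snd_rl_less_lr\<close> the other.\<close>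
    have lt: "ip i \<lless> ip (j - 2)" using j that by (intro ip_less) auto
    have e: "ip i = (if lr_index i then (fst (ep (i + 2)), snd (ep i)) else (fst (ep i), snd (ep
      (i + 2))))"
      using ip_eq[of i] j that by auto
    have f: "ip (j - 2) = (if lr_index j then (fst (ep j), snd (ep (j - 2))) else (fst (ep (j -
      2)), snd (ep j)))"
      using ip_eq[of "j - 2"] j that lr(2) by simp
    show ?thesis
    proof (cases "lr_index i")
      case True
      then show ?thesis using lt e f lr fst_lr_less_rl[of i j] that by (auto simp: sw_def)
    next
      case False
      then show ?thesis using lt e f lr snd_rl_less_lr[of i j] that by (auto simp: sw_def)
    qed
  qed
next
  fix v assume v: "v \<in> entries N \<pi>" "v \<notin> ep ` {1..en}"
  have vk: "fst v \<in> {1..N}" "v = (fst v, \<pi> (fst v))" using v(1)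
    by (auto simp: in_entries_iff prod_eq_iff)
  have "fst v \<notin> L" using L_ep[of "fst v"] v(2) vk(2) by (metis imageI)
  then obtain i where "i \<in> L" "i < fst v" "\<pi> (fst v) < \<pi> i" using below_L vk by blast
  then show "\<exists>i\<in>{1..en}. lr_index i \<and> ep i \<leadsto> v" using L_ep[of i] vk(2) unfolding nw_def
    by (metis fst_conv snd_conv)
  have "fst v \<notin> R" using R_ep[of "fst v"] v(2) vk(2) by (metis imageI)
  then obtain i where "i \<in> R" "fst v < i" "\<pi> i < \<pi> (fst v)" using above_R vk by blast
  then show "\<exists>i\<in>{1..en}. \<not> lr_index i \<and> v \<leadsto> ep i" using R_ep[of i] vk(2) unfolding nw_def
    by (metis fst_conv snd_conv)
qed

end

sublocale alternating_permutation \<subseteq> zigzag "entries N \<pi>" "num_extremal N \<pi>"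
  "extremal_point N \<pi>" lr_index
  by (rule zigzag_entries)

context alternating_permutation begin

text \<open>Turns the nearest lines, given by \<open>Min\<close> and \<open>Max\<close>, into a
  condition on all inflection points. The default values \<open>N + 1\<close> and 0 impose nothing,
  since entries have coordinates in \<open>{1..N}\<close>.\<close>

lemma lr_corner_cell_iff:
  "v \<in> lr_corner_cell N \<pi> p \<longleftrightarrow> v \<in> entries N \<pi> \<and> p \<leadsto> v \<and>
    (\<forall>q\<in>inflections N \<pi>. (fst p < fst q \<longrightarrow> fst v < fst q) \<and> (snd q < snd p \<longrightarrow> snd q < snd v))"
proof -
  have "v \<in> entries N \<pi> \<Longrightarrow> fst v < N + 1 \<and> 0 < snd v"
    using pi_range[of "fst v"] by (auto simp: in_entries_iff)
  then show ?thesis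
    using finite_inflections
    by (cases p; cases v) (auto simp: lr_corner_cell_def Let_def nw_def)
qed

lemma rl_corner_cell_iff:
  "v \<in> rl_corner_cell N \<pi> p \<longleftrightarrow> v \<in> entries N \<pi> \<and> v \<leadsto> p \<and>
    (\<forall>q\<in>inflections N \<pi>. (snd p < snd q \<longrightarrow> snd v < snd q) \<and> (fst q < fst p \<longrightarrow> fst q < fst v))"
proof -
  have "v \<in> entries N \<pi> \<Longrightarrow> snd v < N + 1 \<and> 0 < fst v"
    using pi_range[of "fst v"] by (auto simp: in_entries_iff)
  then show ?thesis
    using finite_inflections
    by (cases p; cases v) (auto simp: rl_corner_cell_def Let_def nw_def)
qed

lemma ball_inflections:
  "(\<forall>q\<in>inflections N \<pi>. P q) \<longleftrightarrow> (\<forall>j. 1 \<le> j \<and> j + 2 \<le> en \<longrightarrow>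
     P (if lr_index j then (fst (ep (j + 2)), snd (ep j)) else (fst (ep j), snd (ep (j + 2)))))"
proof -
  have "(\<forall>q\<in>inflections N \<pi>. P q) \<longleftrightarrow> (\<forall>j. 1 \<le> j \<and> j + 2 \<le> en \<longrightarrow> P (ip j))"
    unfolding inflections_ip by auto
  also have "\<dots> \<longleftrightarrow> (\<forall>j. 1 \<le> j \<and> j + 2 \<le> en \<longrightarrow>
     P (if lr_index j then (fst (ep (j + 2)), snd (ep j)) else (fst (ep j), snd (ep (j + 2)))))"
  proof (intro iff_allI imp_cong refl)
    fix j assume "1 \<le> j \<and> j + 2 \<le> en"
    then have "ip j = (if lr_index j then (fst (ep (j + 2)), snd (ep j)) else (fst (ep j), snd
      (ep (j + 2))))"
      using ip_eq[of j] by blast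
    then show "P (ip j) = P (if lr_index j then (fst (ep (j + 2)), snd (ep j)) else (fst (ep j),
      snd (ep (j + 2))))"
      by (rule arg_cong)
  qed
  finally show ?thesis .
qed

lemma corner_cell_eq:
  assumes i: "i \<in> {1..en}"
  shows "corner_cell N \<pi> i = K i"
proof (cases "lr_index i")
  case True
  then have "fst (ep i) \<in> L" using ep_L i by blast
  then have "corner_cell N \<pi> i = lr_corner_cell N \<pi> (ep i)" by (simp add: corner_cell_def)
  also have "\<dots> = K i"
    unfolding set_eq_iff in_K_lr_iff[OF i True] lr_corner_cell_iff ball_inflections by auto
  finally show ?thesis .
next
  case False
  then have "fst (ep i) \<notin> L" using ep_R i L_R_disjoint by blast
  then have "corner_cell N \<pi> i = rl_corner_cell N \<pi> (ep i)" by (simp add: corner_cell_def)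
  also have "\<dots> = K i"
    unfolding set_eq_iff in_K_rl_iff[OF i False] rl_corner_cell_iff ball_inflections by auto
  finally show ?thesis .
qed

lemma central_cell_eq:
  assumes k: "1 \<le> k" "k + 3 \<le> en"
  shows "central_cell N \<pi> k = C k"
proof -
  have "ip k = (if lr_index k then (fst (ep (k + 2)), snd (ep k)) else (fst (ep k), snd (ep (k +
    2))))"
    "ip (k + 1) = (if lr_index k then (fst (ep (k + 1)), snd (ep (k + 3))) else (fst (ep (k +
      3)), snd (ep (k + 1))))"
    using ip_eq[of k] ip_eq[of "k + 1"] k by (simp_all add: lr_index_Suc numeral_3_eq_3)
  then show ?thesis
    unfolding set_eq_iff in_C_iff[OF k] central_cell_def by auto
qed

lemma decreasing_entries_iff:
  assumes "X \<subseteq> entries N \<pi>"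
  shows "decreasing X \<longleftrightarrow> clique X"
  using finite_subset[OF assms finite_entries] inj_on_subset[OF inj_fst_entries assms]
  by (rule decreasing_iff_clique)

lemma K_subset: "K i \<subseteq> entries N \<pi>" and C_subset: "C k \<subseteq> entries N \<pi>"
  by (auto dest: K_D D_S C_S)

lemma cell_conditions_if:
  assumes cf: "claw_free (entries N \<pi>)"
  shows "\<And>i. i \<in> {1..en} \<Longrightarrow> decreasing (K i)"
    and "\<And>i. i \<in> {1..<en} \<Longrightarrow> decreasing (K i \<union> K (i + 1)) \<or> interlace (K i) (K (i + 1))"
    and "\<And>i. \<lbrakk>i \<in> {1..en}; K i \<noteq> {}\<rbrakk> \<Longrightarrow>
      \<exists>!j. j \<in> {1..en} \<and> (j + 1 = i \<or> j = i + 1) \<and> interlace (K i) (K j)"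
    and "\<And>k. 1 \<le> k \<and> k + 3 \<le> en \<Longrightarrow> card (C k) \<le> 1 \<and>
      (if interlace (K (k + 1)) (K (k + 2)) then C k = {}
       else decreasing (K (k + 1) \<union> C k \<union> K (k + 2)))"
proof -
  interpret claw_free_zigzag "entries N \<pi>" en ep lr_index
    by unfold_locales (rule cf, rule twin_free_entries)
  note dec = decreasing_entries_iff
  \<comment> \<open>The two outcomes in (c) are exhaustive by \<open>interlace_if\<close> and
    exclusive by \<open>interlace_not_decreasing\<close>, so interlacing can be replaced by failure
    of the clique condition.\<close>
  have interlace_iff: "interlace (K i) (K (i + 1)) \<longleftrightarrow> \<not> clique (K i \<union> K (i + 1))"
    if "1 \<le> i" "i < en" for i
    using interlace_if[OF that] interlace_not_decreasing dec K_subset by (metis Un_least)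
  show "decreasing (K i)" if "i \<in> {1..en}" for i
    using clique_K[OF that] dec K_subset by blast
  show c: "decreasing (K i \<union> K (i + 1)) \<or> interlace (K i) (K (i + 1))" if "i \<in> {1..<en}" for i
    using interlace_if[of i] dec[of "K i \<union> K (i + 1)"] K_subset that by auto
  show "\<exists>!j. j \<in> {1..en} \<and> (j + 1 = i \<or> j = i + 1) \<and> interlace (K i) (K j)"
    if i: "i \<in> {1..en}" and ne: "K i \<noteq> {}" for i
  proof -
    have iff: "interlace (K i) (K j) \<longleftrightarrow> \<not> clique (K i \<union> K j)"
      if "j \<in> {1..en}" "j + 1 = i \<or> j = i + 1" for j
    proof -
      have sym: "interlace (K i) (K j) = interlace (K j) (K i)"
        by (auto simp: interlace_def Un_commute)
      show ?thesis using that interlace_iff[of i] interlace_iff[of j] i sym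
        by (auto simp: Un_commute)
    qed
    obtain j where j: "j \<in> {1..en}" "j + 1 = i \<or> j = i + 1" "\<not> clique (K i \<union> K j)"
      using interlacing_neighbour[OF i ne] by blast
    have unique: "j' = j"
      if "j' \<in> {1..en}" "j' + 1 = i \<or> j' = i + 1" "\<not> clique (K i \<union> K j')" for j'
    proof (rule ccontr)
      assume "j' \<noteq> j"
      \<comment> \<open>Two distinct partners must be the two neighbours of \<open>i\<close>, which
        puts \<open>i\<close> in the middle of a triple excluded by
        \<open>unique_interlacing\<close>.\<close>
      then have "j + 1 = i \<and> j' = i + 1 \<or> j' + 1 = i \<and> j = i + 1" using j(2) that(2) by auto
      then show False
        using unique_interlacing[of j] unique_interlacing[of j'] j that by (auto simp: Un_commute)
    qed
    show ?thesis
    proof (rule ex1I[of _ j])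
      show "j \<in> {1..en} \<and> (j + 1 = i \<or> j = i + 1) \<and> interlace (K i) (K j)"
        using j iff[OF j(1,2)] by blast
      show "j' = j" if "j' \<in> {1..en} \<and> (j' + 1 = i \<or> j' = i + 1) \<and> interlace (K i) (K j')" for j'
        using that unique[of j'] iff[of j'] by blast
    qed
  qed
  show "card (C k) \<le> 1 \<and>
      (if interlace (K (k + 1)) (K (k + 2)) then C k = {}
       else decreasing (K (k + 1) \<union> C k \<union> K (k + 2)))" if k: "1 \<le> k \<and> k + 3 \<le> en" for k
  proof -
    have r: "k + 1 \<in> {1..<en}" "1 \<le> k + 1" "k + 1 < en" "k + 1 + 1 = k + 2" using k by auto
    have "clique (K (k + 1) \<union> C k \<union> K (k + 2))" if "C k \<noteq> {}"
      by (rule clique_subset[OF C_clique_D_Un_D[of k]]) (use k that K_D in auto)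
    moreover have "interlace (K (k + 1)) (K (k + 2)) \<longleftrightarrow> \<not> clique (K (k + 1) \<union> K (k + 2))"
      using interlace_iff[OF r(2,3)] r(4) by simp
    moreover have "decreasing (K (k + 1) \<union> C k \<union> K (k + 2)) \<longleftrightarrow> clique (K (k + 1) \<union> C k \<union> K (k + 2))"
      using K_subset C_subset by (intro dec) blast
    moreover have "clique (K (k + 1) \<union> C k \<union> K (k + 2)) \<Longrightarrow> clique (K (k + 1) \<union> K (k + 2))"
      by (elim clique_subset) blast
    ultimately show ?thesis using card_C_le_1[of k] k by (cases "C k = {}") auto
  qed
qed

lemma claw_square_free_if:
  assumes b: "\<And>i. i \<in> {1..en} \<Longrightarrow> decreasing (K i)"
    and c: "\<And>i. i \<in> {1..<en} \<Longrightarrow> decreasing (K i \<union> K (i + 1)) \<or> interlace (K i) (K (i + 1))"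
    and d: "\<And>i. \<lbrakk>i \<in> {1..en}; K i \<noteq> {}\<rbrakk> \<Longrightarrow>
      \<exists>!j. j \<in> {1..en} \<and> (j + 1 = i \<or> j = i + 1) \<and> interlace (K i) (K j)"
    and e: "\<And>k. 1 \<le> k \<and> k + 3 \<le> en \<Longrightarrow> card (C k) \<le> 1 \<and>
      (if interlace (K (k + 1)) (K (k + 2)) then C k = {}
       else decreasing (K (k + 1) \<union> C k \<union> K (k + 2)))"
  shows "claw_free (entries N \<pi>) \<and> square_free (entries N \<pi>)"
proof -
  note dec = decreasing_entries_iff
  have cK: "clique (K i)" if "i \<in> {1..en}" for i
    using b[OF that] dec K_subset by blast
  have cd: central_decreasing unfolding central_decreasing_def
  proof (intro allI impI)
    fix k assume k: "1 \<le> k \<and> k + 3 \<le> en \<and> C k \<noteq> {}"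
    then have "decreasing (K (k + 1) \<union> C k \<union> K (k + 2))" using e[of k] by (auto split: if_splits)
    moreover have "K (k + 1) \<union> C k \<union> K (k + 2) \<subseteq> entries N \<pi>" using K_subset C_subset by blast
    ultimately show "clique (K (k + 1) \<union> C k \<union> K (k + 2))" using dec by blast
  qed
  have one: "clique (K i \<union> K (i + 1)) \<or> clique (K (i + 1) \<union> K (i + 2))"
    if i: "1 \<le> i" "i + 2 \<le> en" for i
  proof (rule ccontr)
    assume "\<not> (clique (K i \<union> K (i + 1)) \<or> clique (K (i + 1) \<union> K (i + 2)))"
    then have "\<not> decreasing (K i \<union> K (i + 1))" "\<not> decreasing (K (i + 1) \<union> K (i + 2))"
      using dec K_subset by (metis Un_least)+
    then have "interlace (K i) (K (i + 1))" and 2: "interlace (K (i + 1)) (K (i + 2))"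
      using c[of i] c[of "i + 1"] i by auto
    then have 1: "interlace (K (i + 1)) (K i)" and ne: "K (i + 1) \<noteq> {}"
      by (auto simp: interlace_def Un_commute)
    have "i + 1 \<in> {1..en}" using i by simp
    \<comment> \<open>Only the uniqueness half of (d) is taken; both \<open>i\<close> and
      \<open>i + 2\<close> would be partners of the middle cell.\<close>
    from d[OF this ne] obtain j where
      "\<And>j'. j' \<in> {1..en} \<and> (j' + 1 = i + 1 \<or> j' = i + 1 + 1) \<and> interlace (K (i + 1)) (K j') \<Longrightarrow>
        j' = j"
      by blast
    from this[of i] this[of "i + 2"] show False using 1 2 i by auto
  qed
  show ?thesis using claw_free_if[OF cK cd one] square_free_if[OF cK cd] by blast
qed

end

theorem theorem8:
  fixes N :: nat and \<pi> :: "nat \<Rightarrow> nat"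
  assumes perm: "\<pi> permutes {1..N}" and simple: "simple_perm N \<pi>" and N: "N > 2"
  defines n_def: "n \<equiv> num_extremal N \<pi>"
  shows "(avoids N \<pi> [2,3,4,1] \<and> avoids N \<pi> [4,1,2,3] \<and> avoids N \<pi> [3,4,1,2]) \<longleftrightarrow>
    (inflections_alternate N \<pi> \<and>
     (\<forall>i \<in> {1..n}. decreasing (corner_cell N \<pi> i)) \<and>
     (\<forall>i \<in> {1..<n}. decreasing (corner_cell N \<pi> i \<union> corner_cell N \<pi> (i + 1)) \<or>
                     interlace (corner_cell N \<pi> i) (corner_cell N \<pi> (i + 1))) \<and>
     (\<forall>i \<in> {1..n}. corner_cell N \<pi> i \<noteq> {} \<longrightarrow>
        (\<exists>!j. j \<in> {1..n} \<and> (j + 1 = i \<or> j = i + 1) \<and>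
              interlace (corner_cell N \<pi> i) (corner_cell N \<pi> j))) \<and>
     (\<forall>k. 1 \<le> k \<and> k + 3 \<le> n \<longrightarrow>
        card (central_cell N \<pi> k) \<le> 1 \<and>
        (if interlace (corner_cell N \<pi> (k + 1)) (corner_cell N \<pi> (k + 2))
         then central_cell N \<pi> k = {}
         else decreasing (corner_cell N \<pi> (k + 1) \<union> central_cell N \<pi> k \<union>
                            corner_cell N \<pi> (k + 2)))))"
proof -
  interpret simple_permutation N \<pi> by unfold_locales (fact perm, fact simple, fact N)
  have avoids_iff: "avoids N \<pi> [2,3,4,1] \<and> avoids N \<pi> [4,1,2,3] \<and> avoids N \<pi> [3,4,1,2] \<longleftrightarrow>
      claw_free (entries N \<pi>) \<and> square_free (entries N \<pi>)"
    using avoids_claws_iff avoids_square_iff by blast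
  show ?thesis unfolding n_def
  proof
    assume "avoids N \<pi> [2,3,4,1] \<and> avoids N \<pi> [4,1,2,3] \<and> avoids N \<pi> [3,4,1,2]"
    then have cf: "claw_free (entries N \<pi>)" and sf: "square_free (entries N \<pi>)"
      using avoids_iff by blast+
    interpret alternating_permutation N \<pi> by unfold_locales (rule alternate_if[OF cf sf])
    note c = cell_conditions_if[OF cf]
    note K = corner_cell_eq
    show "(inflections_alternate N \<pi> \<and>
     (\<forall>i \<in> {1..num_extremal N \<pi>}. decreasing (corner_cell N \<pi> i)) \<and>
     (\<forall>i \<in> {1..<num_extremal N \<pi>}. decreasing (corner_cell N \<pi> i \<union> corner_cell N \<pi> (i + 1)) \<or>
                     interlace (corner_cell N \<pi> i) (corner_cell N \<pi> (i + 1))) \<and>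
     (\<forall>i \<in> {1..num_extremal N \<pi>}. corner_cell N \<pi> i \<noteq> {} \<longrightarrow>
        (\<exists>!j. j \<in> {1..num_extremal N \<pi>} \<and> (j + 1 = i \<or> j = i + 1) \<and>
              interlace (corner_cell N \<pi> i) (corner_cell N \<pi> j))) \<and>
     (\<forall>k. 1 \<le> k \<and> k + 3 \<le> num_extremal N \<pi> \<longrightarrow>
        card (central_cell N \<pi> k) \<le> 1 \<and>
        (if interlace (corner_cell N \<pi> (k + 1)) (corner_cell N \<pi> (k + 2))
         then central_cell N \<pi> k = {}
         else decreasing (corner_cell N \<pi> (k + 1) \<union> central_cell N \<pi> k \<union>
                            corner_cell N \<pi> (k + 2)))))"
    proof (intro conjI ballI allI impI)
      show "inflections_alternate N \<pi>" by (rule alt)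
      show "decreasing (corner_cell N \<pi> i)" if "i \<in> {1..num_extremal N \<pi>}" for i
        using c(1)[OF that] K[OF that] by simp
      show "decreasing (corner_cell N \<pi> i \<union> corner_cell N \<pi> (i + 1)) \<or>
          interlace (corner_cell N \<pi> i) (corner_cell N \<pi> (i + 1))" if
            "i \<in> {1..<num_extremal N \<pi>}" for i
        using c(2)[OF that] K[of i] K[of "i + 1"] that by simp
      show "\<exists>!j. j \<in> {1..num_extremal N \<pi>} \<and> (j + 1 = i \<or> j = i + 1) \<and>
          interlace (corner_cell N \<pi> i) (corner_cell N \<pi> j)"
        if "i \<in> {1..num_extremal N \<pi>}" "corner_cell N \<pi> i \<noteq> {}" for i
        using c(3)[of i] that K by (simp cong: conj_cong)
      fix k assume k: "1 \<le> k \<and> k + 3 \<le> num_extremal N \<pi>"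
      then have "k + 1 \<in> {1..num_extremal N \<pi>}" "k + 2 \<in> {1..num_extremal N \<pi>}" by auto
      then have eq: "corner_cell N \<pi> (k + 1) = K (k + 1)" "corner_cell N \<pi> (k + 2) = K (k + 2)"
        "central_cell N \<pi> k = C k"
        using K central_cell_eq k by auto
      show "card (central_cell N \<pi> k) \<le> 1"
        "if interlace (corner_cell N \<pi> (k + 1)) (corner_cell N \<pi> (k + 2))
         then central_cell N \<pi> k = {}
         else decreasing (corner_cell N \<pi> (k + 1) \<union> central_cell N \<pi> k \<union> corner_cell N \<pi> (k + 2))"
        unfolding eq using c(4)[OF k] by blast+
    qed
  next
    assume "(inflections_alternate N \<pi> \<and>
     (\<forall>i \<in> {1..num_extremal N \<pi>}. decreasing (corner_cell N \<pi> i)) \<and>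
     (\<forall>i \<in> {1..<num_extremal N \<pi>}. decreasing (corner_cell N \<pi> i \<union> corner_cell N \<pi> (i + 1)) \<or>
                     interlace (corner_cell N \<pi> i) (corner_cell N \<pi> (i + 1))) \<and>
     (\<forall>i \<in> {1..num_extremal N \<pi>}. corner_cell N \<pi> i \<noteq> {} \<longrightarrow>
        (\<exists>!j. j \<in> {1..num_extremal N \<pi>} \<and> (j + 1 = i \<or> j = i + 1) \<and>
              interlace (corner_cell N \<pi> i) (corner_cell N \<pi> j))) \<and>
     (\<forall>k. 1 \<le> k \<and> k + 3 \<le> num_extremal N \<pi> \<longrightarrow>
        card (central_cell N \<pi> k) \<le> 1 \<and>
        (if interlace (corner_cell N \<pi> (k + 1)) (corner_cell N \<pi> (k + 2))
         then central_cell N \<pi> k = {}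
         else decreasing (corner_cell N \<pi> (k + 1) \<union> central_cell N \<pi> k \<union>
                            corner_cell N \<pi> (k + 2)))))"
    then have alternate: "inflections_alternate N \<pi>"
      and b: "(\<forall>i \<in> {1..num_extremal N \<pi>}. decreasing (corner_cell N \<pi> i))"
      and c: "(\<forall>i \<in> {1..<num_extremal N \<pi>}. decreasing (corner_cell N \<pi> i
        \<union> corner_cell N \<pi> (i + 1)) \<or> interlace (corner_cell N \<pi> i)
        (corner_cell N \<pi> (i + 1)))"
      and d: "(\<forall>i \<in> {1..num_extremal N \<pi>}. corner_cell N \<pi> i \<noteq> {}
        \<longrightarrow> (\<exists>!j. j \<in> {1..num_extremal N \<pi>} \<and> (j + 1 = i
        \<or> j = i + 1) \<and> interlace (corner_cell N \<pi> i) (corner_cell N \<pi> j)))"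
      and e: "(\<forall>k. 1 \<le> k \<and> k + 3 \<le> num_extremal N \<pi> \<longrightarrow> card
        (central_cell N \<pi> k) \<le> 1 \<and> (if interlace (corner_cell N \<pi> (k + 1))
        (corner_cell N \<pi> (k + 2)) then central_cell N \<pi> k = {} else decreasing
        (corner_cell N \<pi> (k + 1) \<union> central_cell N \<pi> k \<union> corner_cell N
        \<pi> (k + 2))))"
      by blast+
    interpret alternating_permutation N \<pi> by unfold_locales (rule alternate)
    note K = corner_cell_eq
    have "claw_free (entries N \<pi>) \<and> square_free (entries N \<pi>)"
    proof (rule claw_square_free_if)
      show "decreasing (K i)" if "i \<in> {1..num_extremal N \<pi>}" for i
        using b that unfolding K[OF that, symmetric] by blast
      show "decreasing (K i \<union> K (i + 1)) \<or> interlace (K i) (K (i + 1))"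
        if "i \<in> {1..<num_extremal N \<pi>}" for i
        using c[rule_format, OF that] K[of i] K[of "i + 1"] that by simp
      show "\<exists>!j. j \<in> {1..num_extremal N \<pi>} \<and> (j + 1 = i \<or> j = i + 1) \<and> interlace (K i) (K j)"
        if i: "i \<in> {1..num_extremal N \<pi>}" "K i \<noteq> {}" for i
      proof -
        have "\<exists>!j. j \<in> {1..num_extremal N \<pi>} \<and> (j + 1 = i \<or> j = i + 1) \<and>
            interlace (corner_cell N \<pi> i) (corner_cell N \<pi> j)"
          using d i unfolding K[OF i(1), symmetric] by blast
        then show ?thesis using i(1) K by (simp cong: conj_cong)
      qed
      fix k assume k: "1 \<le> k \<and> k + 3 \<le> num_extremal N \<pi>"
      then have "k + 1 \<in> {1..num_extremal N \<pi>}" "k + 2 \<in> {1..num_extremal N \<pi>}" by auto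
      then have eq: "corner_cell N \<pi> (k + 1) = K (k + 1)" "corner_cell N \<pi> (k + 2) = K (k + 2)"
        "central_cell N \<pi> k = C k"
        using K central_cell_eq k by auto
      have "card (central_cell N \<pi> k) \<le> 1 \<and>
        (if interlace (corner_cell N \<pi> (k + 1)) (corner_cell N \<pi> (k + 2))
         then central_cell N \<pi> k = {}
         else decreasing (corner_cell N \<pi> (k + 1) \<union> central_cell N \<pi> k \<union> corner_cell N \<pi> (k + 2)))"
        using e k by blast
      then show "card (C k) \<le> 1 \<and>
        (if interlace (K (k + 1)) (K (k + 2)) then C k = {}
         else decreasing (K (k + 1) \<union> C k \<union> K (k + 2)))" unfolding eq .
    qed
    then show "avoids N \<pi> [2,3,4,1] \<and> avoids N \<pi> [4,1,2,3] \<and> avoids N \<pi> [3,4,1,2]"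
      using avoids_iff by blast
  qed
qed

end
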